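(* Let $\mathcal{G}$ be a locally compact étale groupoid with unit space $\mathcal{G}^{(0)}$. For a family $(T_x)_{x\in\mathcal{G}^{(0)}}\in\prod_{x\in\mathcal{G}^{(0)}}\mathcal{B}(\ell^2(\mathcal{G}_x))$, the following are equivalent: (1) $(T_x)_{x\in\mathcal{G}^{(0)}}$ belongs to $\Phi(\mathcal{L}(L^2(\mathcal{G})))$; (2) the map $x\mapsto T_x$ is a continuous section of the operator fibre space $E$ associated to $\mathcal{G}$, and both families $(T_x)_{x\in\mathcal{G}^{(0)}}$ and $(T_x^* )_{x\in\mathcal{G}^{(0)}}$ are vector-wise uniformly quasi-local.
   Context: Locally compact spaces are assumed Hausdorff. A locally compact étale groupoid $\mathcal{G}$ is a topological groupoid with locally compact topology whose range map $\mathrm{r}$ (hence source map $\mathrm{s}$) is a local homeomorphism; $\mathcal{G}^{(0)}$ is its unit space and $\mathcal{G}_x=\mathrm{s}^{-1}(x)$ (discrete). For $A,B\subseteq\mathcal{G}$, $AB=A\cdot B=\{\alpha\beta:\alpha\in A,\beta\in B,\mathrm{s}(\alpha)=\mathrm{r}(\beta)\}$. Inner products are linear in the second variable. $L^2(\mathcal{G})$ is the Hilbert $C_0(\mathcal{G}^{(0)})$-module obtained by completing $C_c(\mathcal{G})$ for $\langle\eta,\xi\rangle(x)=\sum_{\gamma\in\mathcal{G}_x}\overline{\eta(\gamma)}\xi(\gamma)$, with $(\xi f)(\gamma)=\xi(\gamma)f(\mathrm{s}(\gamma))$; its elements are regarded as functions in $C_0(\mathcal{G})$. $\mathcal{L}(L^2(\mathcal{G}))$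 is the $C^*$-algebra of adjointable operators. For $T\in\mathcal{L}(L^2(\mathcal{G}))$ and $x\in\mathcal{G}^{(0)}$, the slice $\Phi_x(T)\in\mathcal{B}(\ell^2(\mathcal{G}_x))$ is the (well-defined) operator with $\Phi_x(T)(\xi|_{\mathcal{G}_x})=T(\xi)|_{\mathcal{G}_x}$ for $\xi\in L^2(\mathcal{G})$, and $\Phi(T)=(\Phi_x(T))_{x}\in\prod_{x}\mathcal{B}(\ell^2(\mathcal{G}_x))$ (the product consists of uniformly norm-bounded families). Operator fibre space: $E=\bigsqcup_{x\in\mathcal{G}^{(0)}}\mathcal{B}(\ell^2(\mathcal{G}_x))$, topologised so that a net $\sigma_{x_i}\in\mathcal{B}(\ell^2(\mathcal{G}_{x_i}))$ converges to $\sigma_x\in\mathcal{B}(\ell^2(\mathcal{G}_x))$ iff $x_i\to x$ and for any $\gamma_i'\to\gamma'$, $\gamma_i''\to\gamma''$ in $\mathcal{G}$ with $\mathrm{s}(\gamma_i')=x_i=\mathrm{s}(\gamma_i'')$ one has $\langle\delta_{\gamma_i''},\sigma_{x_i}(\delta_{\gamma_i'})\rangle\to\langle\delta_{\gamma''},\sigma_x(\delta_{\gamma'})\rangle$. A family $(T_x)_x\in\prod_x\mathcal{B}(\ell^2(\mathcal{G}_x))$ is vector-wise uniformly quasi-local if for any $\varepsilon>0$ and $\xi\in C_c(\mathcal{G})$ there is a compact $K\subseteq\mathcal{G}$ such that for any $x\in\mathcal{G}^{(0)}$ and $A_x,B_x\subseteq\mathcal{G}_x$ with $A_x\cap(KB_x)=\emptyset$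 we have $\|(\chi_{A_x}T_x\chi_{B_x})(\xi|_{\mathcal{G}_x})\|<\varepsilon$. Here characteristic functions act by pointwise multiplication. *)

theory Defs
  imports "HOL-Analysis.Analysis"
begin

record 'g groupoid =
  gmult :: "'g \<Rightarrow> 'g \<Rightarrow> 'g"  (infixl "\<cdot>\<index>" 70)
  ginv :: "'g \<Rightarrow> 'g"
  src :: "'g \<Rightarrow> 'g"
  rng :: "'g \<Rightarrow> 'g"

text \<open>
  The arrows of the groupoid are all elements of the type \<open>'g\<close>.  The product is a total function,
  but only its values on pairs with \<open>src \<alpha> = rng \<beta>\<close> are meaningful.
\<close>

locale groupoid =
  fixes G :: "'g groupoid" (structure)
  assumes src_src: "src G (src G \<gamma>) = src G \<gamma>"
    and rng_src: "rng G (src G \<gamma>) = src G \<gamma>"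
    and src_rng: "src G (rng G \<gamma>) = rng G \<gamma>"
    and rng_rng: "rng G (rng G \<gamma>) = rng G \<gamma>"
    and src_mult: "src G \<alpha> = rng G \<beta> \<Longrightarrow> src G (\<alpha> \<cdot> \<beta>) = src G \<beta>"
    and rng_mult: "src G \<alpha> = rng G \<beta> \<Longrightarrow> rng G (\<alpha> \<cdot> \<beta>) = rng G \<alpha>"
    and mult_assoc: "src G \<alpha> = rng G \<beta> \<Longrightarrow> src G \<beta> = rng G \<gamma> \<Longrightarrow> (\<alpha> \<cdot> \<beta>) \<cdot> \<gamma> = \<alpha> \<cdot> (\<beta> \<cdot> \<gamma>)"
    and unit_left: "rng G \<gamma> \<cdot> \<gamma> = \<gamma>"
    and unit_right: "\<gamma> \<cdot> src G \<gamma> = \<gamma>"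
    and src_inv: "src G (ginv G \<gamma>) = rng G \<gamma>"
    and rng_inv: "rng G (ginv G \<gamma>) = src G \<gamma>"
    and inv_left: "ginv G \<gamma> \<cdot> \<gamma> = src G \<gamma>"
    and inv_right: "\<gamma> \<cdot> ginv G \<gamma> = rng G \<gamma>"

definition units :: "'g groupoid \<Rightarrow> 'g set" where
  "units G = range (rng G)"

definition fibre :: "'g groupoid \<Rightarrow> 'g \<Rightarrow> 'g set" where
  "fibre G x = {\<gamma>. src G \<gamma> = x}"

definition set_mult :: "'g groupoid \<Rightarrow> 'g set \<Rightarrow> 'g set \<Rightarrow> 'g set" where
  "set_mult G A B = {\<alpha> \<cdot>\<^bsub>G\<^esub> \<beta> |\<alpha> \<beta>. \<alpha> \<in> A \<and> \<beta> \<in> B \<and> src G \<alpha> = rng G \<beta>}"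

locale lc_etale_groupoid = groupoid G for G :: "'g::t2_space groupoid" (structure) +
  assumes locally_compact: "locally compact (UNIV :: 'g set)"
    and continuous_mult:
      "continuous_on {(\<alpha>, \<beta>). src G \<alpha> = rng G \<beta>} (\<lambda>(\<alpha>, \<beta>). \<alpha> \<cdot> \<beta>)"
    and continuous_inv: "continuous_on UNIV (ginv G)"
    and rng_local_homeomorphism:
      "\<exists>U h. open U \<and> \<gamma> \<in> U \<and> openin (top_of_set (units G)) (rng G ` U)
         \<and> homeomorphism U (rng G ` U) (rng G) h"


definition ell2 :: "'g set \<Rightarrow> ('g \<Rightarrow> complex) set" where
  "ell2 S = {v. (\<forall>\<gamma>. \<gamma> \<notin> S \<longrightarrow> v \<gamma> = 0) \<and> (\<lambda>\<gamma>. (cmod (v \<gamma>))\<^sup>2) summable_on S}"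

definition ell2_inner :: "'g set \<Rightarrow> ('g \<Rightarrow> complex) \<Rightarrow> ('g \<Rightarrow> complex) \<Rightarrow> complex" where
  "ell2_inner S v w = (\<Sum>\<^sub>\<infinity>\<gamma>\<in>S. cnj (v \<gamma>) * w \<gamma>)"

definition ell2_norm :: "'g set \<Rightarrow> ('g \<Rightarrow> complex) \<Rightarrow> real" where
  "ell2_norm S v = sqrt (\<Sum>\<^sub>\<infinity>\<gamma>\<in>S. (cmod (v \<gamma>))\<^sup>2)"

definition delta :: "'g \<Rightarrow> 'g \<Rightarrow> complex" where
  "delta \<gamma> = indicator {\<gamma>}"

text \<open>
  Multiplication by the characteristic function of \<open>A\<close>.  As elements of \<open>ell2 S\<close> vanish off \<open>S\<close>,
  it also renders the restriction of a function on \<open>'g\<close> to the set \<open>A\<close>.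
\<close>

definition cutoff :: "'g set \<Rightarrow> ('g \<Rightarrow> complex) \<Rightarrow> 'g \<Rightarrow> complex" where
  "cutoff A v = (\<lambda>\<gamma>. indicator A \<gamma> * v \<gamma>)"

type_synonym 'g operator = "('g \<Rightarrow> complex) \<Rightarrow> 'g \<Rightarrow> complex"

text \<open>
  Operators are extensional functions on their domain, so that equality of operators is equality in
  the logic.
\<close>

definition bounded_ops :: "'g set \<Rightarrow> 'g operator set" where
  "bounded_ops S = {T \<in> ell2 S \<rightarrow>\<^sub>E ell2 S.
     (\<forall>v\<in>ell2 S. \<forall>w\<in>ell2 S. T (\<lambda>\<gamma>. v \<gamma> + w \<gamma>) = (\<lambda>\<gamma>. T v \<gamma> + T w \<gamma>)) \<and>
     (\<forall>c. \<forall>v\<in>ell2 S. T (\<lambda>\<gamma>. c * v \<gamma>) = (\<lambda>\<gamma>. c * T v \<gamma>)) \<and>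
     (\<exists>C. \<forall>v\<in>ell2 S. ell2_norm S (T v) \<le> C * ell2_norm S v)}"

definition op_adjoint :: "'g set \<Rightarrow> 'g operator \<Rightarrow> 'g operator" where
  "op_adjoint S T = (THE R. R \<in> bounded_ops S \<and>
     (\<forall>v\<in>ell2 S. \<forall>w\<in>ell2 S. ell2_inner S (R v) w = ell2_inner S v (T w)))"

definition op_families :: "'g groupoid \<Rightarrow> ('g \<Rightarrow> 'g operator) set" where
  "op_families G = {T \<in> (\<Pi>\<^sub>E x\<in>units G. bounded_ops (fibre G x)).
     \<exists>C. \<forall>x\<in>units G. \<forall>v\<in>ell2 (fibre G x).
       ell2_norm (fibre G x) (T x v) \<le> C * ell2_norm (fibre G x) v}"

definition family_adjoint :: "'g groupoid \<Rightarrow> ('g \<Rightarrow> 'g operator) \<Rightarrow> 'g \<Rightarrow> 'g operator" where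
  "family_adjoint G T = (\<lambda>x\<in>units G. op_adjoint (fibre G x) (T x))"


definition Cc :: "('g::topological_space \<Rightarrow> complex) set" where
  "Cc = {f. continuous_on UNIV f \<and> compact (closure {\<gamma>. f \<gamma> \<noteq> 0})}"

definition L2_inner :: "'g groupoid \<Rightarrow> ('g \<Rightarrow> complex) \<Rightarrow> ('g \<Rightarrow> complex) \<Rightarrow> 'g \<Rightarrow> complex" where
  "L2_inner G \<eta> \<xi> = (\<lambda>x\<in>units G. \<Sum>\<^sub>\<infinity>\<gamma>\<in>fibre G x. cnj (\<eta> \<gamma>) * \<xi> \<gamma>)"

definition L2_norm :: "'g groupoid \<Rightarrow> ('g \<Rightarrow> complex) \<Rightarrow> real" where
  "L2_norm G \<xi> = sqrt (SUP x\<in>units G. cmod (L2_inner G \<xi> \<xi> x))"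

text \<open>
  The completion of \<open>Cc\<close>, realised as functions on \<open>'g\<close>: the class of a Cauchy sequence is
  identified with its pointwise limit.
\<close>

definition L2 :: "'g::topological_space groupoid \<Rightarrow> ('g \<Rightarrow> complex) set" where
  "L2 G = {\<xi>. \<exists>f. (\<forall>n. f n \<in> Cc) \<and>
     (\<forall>\<epsilon>>0. \<exists>N. \<forall>m\<ge>N. \<forall>n\<ge>N. L2_norm G (\<lambda>\<gamma>. f m \<gamma> - f n \<gamma>) < \<epsilon>) \<and>
     (\<forall>\<gamma>. (\<lambda>n. f n \<gamma>) \<longlonglongrightarrow> \<xi> \<gamma>)}"

text \<open>
  As usual for Hilbert modules, an adjointable map is any map possessing an adjoint; linearity,
  boundedness and linearity over the coefficient algebra are then automatic.
\<close>

definition adjointable_ops :: "'g::topological_space groupoid \<Rightarrow> 'g operator set" where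
  "adjointable_ops G = {T \<in> L2 G \<rightarrow>\<^sub>E L2 G.
     \<exists>R \<in> L2 G \<rightarrow>\<^sub>E L2 G. \<forall>\<eta>\<in>L2 G. \<forall>\<xi>\<in>L2 G. L2_inner G (T \<eta>) \<xi> = L2_inner G \<eta> (R \<xi>)}"

definition slice :: "'g::topological_space groupoid \<Rightarrow> 'g \<Rightarrow> 'g operator \<Rightarrow> 'g operator" where
  "slice G x T = (THE R. R \<in> bounded_ops (fibre G x) \<and>
     (\<forall>\<xi>\<in>L2 G. R (cutoff (fibre G x) \<xi>) = cutoff (fibre G x) (T \<xi>)))"

definition Phi :: "'g::topological_space groupoid \<Rightarrow> 'g operator \<Rightarrow> 'g \<Rightarrow> 'g operator" where
  "Phi G T = (\<lambda>x\<in>units G. slice G x T)"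


definition op_fibre_space :: "'g groupoid \<Rightarrow> ('g \<times> 'g operator) set" where
  "op_fibre_space G = (SIGMA x:units G. bounded_ops (fibre G x))"

text \<open>
  The prescribed convergence in the operator fibre space; nets are rendered as functions along a
  filter on the index type.
\<close>

definition op_fibre_conv ::
  "'g::topological_space groupoid \<Rightarrow> ('i \<Rightarrow> 'g \<times> 'g operator) \<Rightarrow> 'g \<times> 'g operator \<Rightarrow> 'i filter \<Rightarrow> bool"
  where
  "op_fibre_conv G e e0 F \<longleftrightarrow>
     e0 \<in> op_fibre_space G \<and> (\<forall>\<^sub>F i in F. e i \<in> op_fibre_space G) \<and>
     ((\<lambda>i. fst (e i)) \<longlongrightarrow> fst e0) F \<and>
     (\<forall>g' g'' \<gamma>' \<gamma>''.
        (g' \<longlongrightarrow> \<gamma>') F \<longrightarrow> (g'' \<longlongrightarrow> \<gamma>'') F \<longrightarrow>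
        (\<forall>\<^sub>F i in F. src G (g' i) = fst (e i) \<and> src G (g'' i) = fst (e i)) \<longrightarrow>
        ((\<lambda>i. ell2_inner (fibre G (fst (e i))) (delta (g'' i)) (snd (e i) (delta (g' i))))
           \<longlongrightarrow> ell2_inner (fibre G (fst e0)) (delta \<gamma>'') (snd e0 (delta \<gamma>'))) F)"

text \<open>
  The topology determined by this convergence: a set is open iff everything converging to one of its
  points is eventually inside.  For locally compact etale groupoids its convergence is exactly
  \<open>op_fibre_conv\<close>, for every index type; see \<open>limitin_op_fibre_topology\<close>.
\<close>

definition op_fibre_open :: "'g::topological_space groupoid \<Rightarrow> ('g \<times> 'g operator) set \<Rightarrow> bool" where
  "op_fibre_open G W \<longleftrightarrow> W \<subseteq> op_fibre_space G \<and>
     (\<forall>e0\<in>W. \<forall>F. op_fibre_conv G (\<lambda>e. e) e0 F \<longrightarrow> (\<forall>\<^sub>F e in F. e \<in> W))"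

definition op_fibre_topology :: "'g::topological_space groupoid \<Rightarrow> ('g \<times> 'g operator) topology" where
  "op_fibre_topology G = topology (op_fibre_open G)"

lemma openin_op_fibre_topology: "openin (op_fibre_topology G) = op_fibre_open G"
proof -
  have "istopology (op_fibre_open G)"
    unfolding istopology_def
  proof (intro conjI allI impI)
    fix S T assume "op_fibre_open G S" "op_fibre_open G T"
    then show "op_fibre_open G (S \<inter> T)"
      unfolding op_fibre_open_def by (auto intro: eventually_conj)
  next
    fix K assume K: "\<forall>S\<in>K. op_fibre_open G S"
    show "op_fibre_open G (\<Union>K)"
      unfolding op_fibre_open_def
    proof (intro conjI ballI allI impI)
      show "\<Union>K \<subseteq> op_fibre_space G"
        using K unfolding op_fibre_open_def by blast
      fix e0 F assume "e0 \<in> \<Union>K" and c: "op_fibre_conv G (\<lambda>e. e) e0 F"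
      then obtain S where S: "S \<in> K" "e0 \<in> S" by blast
      then have "\<forall>\<^sub>F e in F. e \<in> S"
        using K c unfolding op_fibre_open_def by blast
      then show "\<forall>\<^sub>F e in F. e \<in> \<Union>K"
        by (rule eventually_mono) (use S in blast)
    qed
  qed
  then show ?thesis
    by (simp add: op_fibre_topology_def)
qed

lemma topspace_op_fibre_topology: "topspace (op_fibre_topology G) = op_fibre_space G"
proof -
  have "op_fibre_open G (op_fibre_space G)"
    by (auto simp: op_fibre_open_def op_fibre_conv_def)
  moreover have "W \<subseteq> op_fibre_space G" if "op_fibre_open G W" for W
    using that by (simp add: op_fibre_open_def)
  ultimately show ?thesis
    unfolding topspace_def openin_op_fibre_topology by blast
qed

lemma (in lc_etale_groupoid) continuous_src: "continuous_on UNIV (src G)"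
proof -
  have "continuous_on UNIV (rng G)"
  proof (subst continuous_on_eq_continuous_at, simp, intro ballI)
    fix \<gamma>
    obtain U h where U: "open U" "\<gamma> \<in> U" "homeomorphism U (rng G ` U) (rng G) h"
      using rng_local_homeomorphism by blast
    then have "continuous_on U (rng G)" by (simp add: homeomorphism_def)
    then show "isCont (rng G) \<gamma>"
      using U continuous_on_eq_continuous_at by blast
  qed
  then have "continuous_on UNIV (\<lambda>\<gamma>. rng G (ginv G \<gamma>))"
    by (rule continuous_on_compose2[OF _ continuous_inv]) simp
  then show ?thesis by (simp add: rng_inv)
qed

lemma (in groupoid) inv_inv: "ginv G (ginv G \<gamma>) = \<gamma>"
proof -
  have "ginv G (ginv G \<gamma>) = ginv G (ginv G \<gamma>) \<cdot> (ginv G \<gamma> \<cdot> \<gamma>)"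
    by (metis inv_left rng_inv src_inv unit_right)
  also have "\<dots> = (ginv G (ginv G \<gamma>) \<cdot> ginv G \<gamma>) \<cdot> \<gamma>"
    by (simp add: mult_assoc src_inv)
  also have "\<dots> = \<gamma>"
    by (simp add: inv_left src_inv unit_left)
  finally show ?thesis .
qed

lemma (in lc_etale_groupoid) src_section:
  obtains U Y c where "open U" "\<gamma> \<in> U" "open Y" "src G ` U = Y \<inter> units G"
    "continuous_on (src G ` U) c" "\<forall>\<alpha>\<in>U. c (src G \<alpha>) = \<alpha>"
proof -
  obtain V h where V: "open V" "ginv G \<gamma> \<in> V" "openin (top_of_set (units G)) (rng G ` V)"
      "homeomorphism V (rng G ` V) (rng G) h"
    using rng_local_homeomorphism by blast
  define U where "U = ginv G -` V"
  have oU: "open U"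
    using continuous_inv V(1) unfolding U_def by (metis open_vimage)
  have im: "src G ` U = rng G ` V"
  proof (intro subset_antisym image_subsetI)
    fix \<alpha> assume "\<alpha> \<in> U"
    then show "src G \<alpha> \<in> rng G ` V"
      unfolding U_def by (intro image_eqI[of _ _ "ginv G \<alpha>"]) (simp_all add: rng_inv)
  next
    fix \<alpha> assume "\<alpha> \<in> V"
    then show "rng G \<alpha> \<in> src G ` U"
      unfolding U_def by (intro image_eqI[of _ _ "ginv G \<alpha>"]) (simp_all add: src_inv inv_inv)
  qed
  obtain Y where Y: "open Y" "rng G ` V = Y \<inter> units G"
    using V(3) unfolding openin_open by auto
  have "continuous_on (src G ` U) (\<lambda>x. ginv G (h x))"
    unfolding im using V(4)
    by (intro continuous_on_compose2[OF continuous_inv]) (auto simp: homeomorphism_def)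
  moreover have "ginv G (h (src G \<alpha>)) = \<alpha>" if "\<alpha> \<in> U" for \<alpha>
  proof -
    have "h (rng G (ginv G \<alpha>)) = ginv G \<alpha>"
      using that V(4) unfolding U_def homeomorphism_def by blast
    then show ?thesis by (simp add: rng_inv inv_inv)
  qed
  ultimately show ?thesis
    using that[of U Y "\<lambda>x. ginv G (h x)"] oU V(2) Y im by (auto simp: U_def)
qed

lemma (in lc_etale_groupoid) limitin_op_fibre_topology:
  "limitin (op_fibre_topology G) e e0 F \<longleftrightarrow> op_fibre_conv G e e0 F"
proof
  assume conv: "op_fibre_conv G e e0 F"
  have "op_fibre_conv G (\<lambda>e. e) e0 (filtermap e F)"
    using conv unfolding op_fibre_conv_def eventually_filtermap filterlim_filtermap by blast
  then have "\<forall>\<^sub>F e in filtermap e F. e \<in> W" if "op_fibre_open G W" "e0 \<in> W" for W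
    using that unfolding op_fibre_open_def by blast
  then show "limitin (op_fibre_topology G) e e0 F"
    using conv unfolding limitin_def topspace_op_fibre_topology openin_op_fibre_topology
    by (auto simp: op_fibre_conv_def eventually_filtermap)
next
  assume lim: "limitin (op_fibre_topology G) e e0 F"
  then have e0: "e0 \<in> op_fibre_space G"
    by (simp add: limitin_def topspace_op_fibre_topology)
  have ev: "\<forall>\<^sub>F i in F. e i \<in> W" if "op_fibre_open G W" "e0 \<in> W" for W
    using lim that unfolding limitin_def openin_op_fibre_topology by blast
  have evE: "\<forall>\<^sub>F i in F. e i \<in> op_fibre_space G"
    using ev[of "op_fibre_space G"] e0 openin_op_fibre_topology topspace_op_fibre_topology
    by (metis openin_topspace)
  have base: "((\<lambda>i. fst (e i)) \<longlongrightarrow> fst e0) F"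
  proof (rule topological_tendstoI)
    fix V assume V: "open V" "fst e0 \<in> V"
    have "op_fibre_open G {d \<in> op_fibre_space G. fst d \<in> V}"
      unfolding op_fibre_open_def
    proof (intro conjI ballI allI impI)
      fix d0 D assume d0: "d0 \<in> {d \<in> op_fibre_space G. fst d \<in> V}"
        and D: "op_fibre_conv G (\<lambda>d. d) d0 D"
      have "\<forall>\<^sub>F d in D. fst d \<in> V"
        using D d0 V unfolding op_fibre_conv_def by (auto dest: topological_tendstoD)
      then show "\<forall>\<^sub>F d in D. d \<in> {d \<in> op_fibre_space G. fst d \<in> V}"
        using D unfolding op_fibre_conv_def by (auto elim: eventually_elim2)
    qed auto
    from ev[OF this] show "\<forall>\<^sub>F i in F. fst (e i) \<in> V"
      using e0 V by (auto elim: eventually_mono)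
  qed
  show "op_fibre_conv G e e0 F"
    unfolding op_fibre_conv_def
  proof (intro conjI allI impI)
    fix g' g'' \<gamma>' \<gamma>''
    assume g': "(g' \<longlongrightarrow> \<gamma>') F" and g'': "(g'' \<longlongrightarrow> \<gamma>'') F"
      and lift: "\<forall>\<^sub>F i in F. src G (g' i) = fst (e i) \<and> src G (g'' i) = fst (e i)"
    let ?m = "\<lambda>d a b. ell2_inner (fibre G (fst d)) (delta b) (snd d (delta a))"
    show "((\<lambda>i. ?m (e i) (g' i) (g'' i)) \<longlongrightarrow> ?m e0 \<gamma>' \<gamma>'') F"
    proof (cases "F = bot")
      case False
      have src_lim: "src G \<gamma> = fst e0"
        if g: "(g \<longlongrightarrow> \<gamma>) F" and l: "\<forall>\<^sub>F i in F. src G (g i) = fst (e i)" for g \<gamma>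
      proof -
        have "((\<lambda>i. src G (g i)) \<longlongrightarrow> src G \<gamma>) F"
          using continuous_on_tendsto_compose[OF continuous_src g] by simp
        then have "((\<lambda>i. fst (e i)) \<longlongrightarrow> src G \<gamma>) F"
          using l tendsto_cong[OF l] by simp
        then show ?thesis
          using base False tendsto_unique by blast
      qed
      have s': "src G \<gamma>' = fst e0" and s'': "src G \<gamma>'' = fst e0"
        using src_lim[OF g'] src_lim[OF g''] lift by (simp_all add: eventually_conj_iff)
      obtain U' Y' c' where U': "open U'" "\<gamma>' \<in> U'" "open Y'" "src G ` U' = Y' \<inter> units G"
        "continuous_on (src G ` U') c'" "\<forall>\<alpha>\<in>U'. c' (src G \<alpha>) = \<alpha>"
        by (rule src_section[of \<gamma>']) blast
      obtain U'' Y'' c'' where U'': "open U''" "\<gamma>'' \<in> U''" "open Y''" "src G ` U'' = Y'' \<inter> units G"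
        "continuous_on (src G ` U'') c''" "\<forall>\<alpha>\<in>U''. c'' (src G \<alpha>) = \<alpha>"
        by (rule src_section[of \<gamma>'']) blast
      show ?thesis
      proof (rule topological_tendstoI)
        fix Z assume Z: "open Z" "?m e0 \<gamma>' \<gamma>'' \<in> Z"
        define W where "W = {d \<in> op_fibre_space G. fst d \<in> Y' \<inter> Y'' \<and> ?m d (c' (fst d)) (c'' (fst d)) \<in> Z}"
        have "op_fibre_open G W"
          unfolding op_fibre_open_def
        proof (intro conjI ballI allI impI)
          show "W \<subseteq> op_fibre_space G" by (auto simp: W_def)
          fix d0 D assume d0: "d0 \<in> W" and D: "op_fibre_conv G (\<lambda>d. d) d0 D"
          have u0: "fst d0 \<in> units G" and
            evu: "\<forall>\<^sub>F d in D. fst d \<in> units G"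
            using D unfolding op_fibre_conv_def
            by (auto simp: op_fibre_space_def elim!: eventually_mono)
          have ft: "(fst \<longlongrightarrow> fst d0) D"
            using D unfolding op_fibre_conv_def by simp
          have evY: "\<forall>\<^sub>F d in D. fst d \<in> Y' \<inter> Y''"
            using topological_tendstoD[OF ft, of "Y' \<inter> Y''"] U'(3) U''(3) d0 by (auto simp: W_def)
          have ev1: "\<forall>\<^sub>F d in D. fst d \<in> src G ` U'"
            using evY evu by eventually_elim (use U'(4) in blast)
          have ev2: "\<forall>\<^sub>F d in D. fst d \<in> src G ` U''"
            using evY evu by eventually_elim (use U''(4) in blast)
          have in1: "fst d0 \<in> src G ` U'" and in2: "fst d0 \<in> src G ` U''"
            using d0 u0 U'(4) U''(4) by (auto simp: W_def)
          have t1: "((\<lambda>d. c' (fst d)) \<longlongrightarrow> c' (fst d0)) D"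
            by (rule continuous_on_tendsto_compose[OF U'(5) ft in1 ev1])
          have t2: "((\<lambda>d. c'' (fst d)) \<longlongrightarrow> c'' (fst d0)) D"
            by (rule continuous_on_tendsto_compose[OF U''(5) ft in2 ev2])
          have l: "\<forall>\<^sub>F d in D. src G (c' (fst d)) = fst d \<and> src G (c'' (fst d)) = fst d"
            using ev1 ev2 by eventually_elim (use U'(6) U''(6) in auto)
          have "((\<lambda>d. ?m d (c' (fst d)) (c'' (fst d))) \<longlongrightarrow> ?m d0 (c' (fst d0)) (c'' (fst d0))) D"
            using D t1 t2 l unfolding op_fibre_conv_def by blast
          then have "\<forall>\<^sub>F d in D. ?m d (c' (fst d)) (c'' (fst d)) \<in> Z"
            by (rule topological_tendstoD) (use Z d0 in \<open>auto simp: W_def\<close>)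
          moreover have "\<forall>\<^sub>F d in D. d \<in> op_fibre_space G"
            using D unfolding op_fibre_conv_def by blast
          ultimately show "\<forall>\<^sub>F d in D. d \<in> W"
            using evY by eventually_elim (auto simp: W_def)
        qed
        moreover have "e0 \<in> W"
        proof -
          have "c' (fst e0) = \<gamma>'" "c'' (fst e0) = \<gamma>''"
            using U'(2,6) U''(2,6) s' s'' by force+
          moreover have "fst e0 \<in> Y'" "fst e0 \<in> Y''"
            using imageI[OF U'(2), of "src G"] U'(4) imageI[OF U''(2), of "src G"] U''(4) s' s''
            by auto
          ultimately show ?thesis
            using e0 Z by (simp add: W_def)
        qed
        ultimately have "\<forall>\<^sub>F i in F. e i \<in> W" by (rule ev)
        moreover have "\<forall>\<^sub>F i in F. g' i \<in> U'" "\<forall>\<^sub>F i in F. g'' i \<in> U''"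
          using topological_tendstoD[OF g' U'(1,2)] topological_tendstoD[OF g'' U''(1,2)] by auto
        ultimately show "\<forall>\<^sub>F i in F. ?m (e i) (g' i) (g'' i) \<in> Z"
          using lift
        proof eventually_elim
          case (elim i)
          then have "c' (fst (e i)) = g' i" "c'' (fst (e i)) = g'' i"
            using U'(6) U''(6) by force+
          then show ?case using elim by (simp add: W_def)
        qed
      qed
    qed simp
  qed (use e0 evE base in auto)
qed


definition quasi_local :: "'g::topological_space groupoid \<Rightarrow> ('g \<Rightarrow> 'g operator) \<Rightarrow> bool" where
  "quasi_local G T \<longleftrightarrow> (\<forall>\<epsilon>>0. \<forall>\<xi>\<in>Cc. \<exists>K. compact K \<and>
     (\<forall>x\<in>units G. \<forall>A B. A \<subseteq> fibre G x \<longrightarrow> B \<subseteq> fibre G x \<longrightarrow> A \<inter> set_mult G K B = {} \<longrightarrow>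
        ell2_norm (fibre G x) (cutoff A (T x (cutoff B (cutoff (fibre G x) \<xi>)))) < \<epsilon>))"

end

theory Submission
  imports Defs
begin

text \<open>
  Every function in \<open>Cc\<close> is a finite sum of functions supported in bisections, and such a function has
  at most one non-zero value in each fibre.  Hence slices of an adjointable operator \<open>S\<close> act on point
  masses through \<open>S \<zeta>\<close> for \<open>\<zeta>\<close> supported in a bisection: \<open>S \<zeta>\<close> is continuous, which gives continuity of
  the matrix coefficients, and it is approximated by compactly supported functions, which gives
  quasi-locality.  Conversely, a continuous family maps \<open>\<xi> \<in> Cc\<close> to a continuous function, which
  quasi-locality approximates by its products with compactly supported bump functions, so it lies in
  \<open>L2\<close>; the adjoint family provides the adjoint operator.

  That an adjointable operator has slices at all rests on a bound in each fibre.  For a symmetric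
  operator \<open>P\<close> a gliding hump argument gives a global bound \<open>C\<close>, and log-convexity of the fibre norms of
  \<open>P\<^sup>n \<xi>\<close> turns it into the same bound in each fibre; apply this to \<open>P = S S\<^sup>*\<close>.
\<close>

section \<open>Square-summable functions\<close>

text \<open>\<open>adjointable_ops\<close> demands neither boundedness nor linearity, yet a slice at
  \<open>x\<close> exists only if \<open>S \<xi>\<close> on the fibre over \<open>x\<close> is
  controlled by \<open>\<xi>\<close> on that same fibre. A bound in \<open>L2_norm\<close> alone
  does not say this, since it compares suprema over all fibres. The customary remedy multiplies
  \<open>\<xi>\<close> by functions on the unit space concentrated near \<open>x\<close>. Iterating
  a symmetric operator replaces this localisation: the global norm of \<open>\<xi>\<close> enters
  the growth of the iterates only as a constant factor, which cannot affect an exponential rate.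
  Symmetry is what moves one factor of the operator across the inner product within a single fibre.
  The bound is proved for the adjoint \<open>R\<close> rather than for \<open>S\<close>: if
  \<open>\<zeta>\<close> lifts a point mass to \<open>L2 G\<close>, then \<open>R \<zeta>\<close> is
  the vector whose inner products give the values of \<open>S\<close> at that point. A bound for
  \<open>R\<close> on finite combinations of such lifts is therefore a bound for the slice of
  \<open>S\<close>. In the converse direction each of the two quasi-locality conditions serves one
  operator: it puts the values of that operator into \<open>L2 G\<close>.\<close>

text \<open>
  A norm bound stated through finite partial sums, so that it entails square-summability; the
  junk value 0 of a divergent \<open>infsum\<close> would make \<open>ell2_norm S v \<le> c\<close> too weak.
\<close>

definition ell2_le :: "'g set \<Rightarrow> ('g \<Rightarrow> complex) \<Rightarrow> real \<Rightarrow> bool" where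
  "ell2_le S v c \<longleftrightarrow> (\<forall>F. finite F \<longrightarrow> F \<subseteq> S \<longrightarrow> L2_set (\<lambda>\<gamma>. cmod (v \<gamma>)) F \<le> c)"

abbreviation square_summable :: "'g set \<Rightarrow> ('g \<Rightarrow> complex) \<Rightarrow> bool" where
  "square_summable S v \<equiv> (\<lambda>\<gamma>. (cmod (v \<gamma>))\<^sup>2) summable_on S"

lemma L2_set_le_iff: "0 \<le> c \<Longrightarrow> L2_set f F \<le> c \<longleftrightarrow> (\<Sum>i\<in>F. (f i)\<^sup>2) \<le> c\<^sup>2"
  unfolding L2_set_def using real_sqrt_le_iff[of "\<Sum>i\<in>F. (f i)\<^sup>2" "c\<^sup>2"] by simp

lemma ell2_le_nonneg: "ell2_le S v c \<Longrightarrow> 0 \<le> c"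
  unfolding ell2_le_def by (metis L2_set_empty empty_subsetI finite.emptyI)

lemma ell2_norm_nonneg: "0 \<le> ell2_norm S v"
  by (simp add: ell2_norm_def infsum_nonneg)

lemma ell2_norm_power2: "(ell2_norm S v)\<^sup>2 = (\<Sum>\<^sub>\<infinity>\<gamma>\<in>S. (cmod (v \<gamma>))\<^sup>2)"
  by (simp add: ell2_norm_def infsum_nonneg)

lemma ell2_leI: "square_summable S v \<Longrightarrow> ell2_norm S v \<le> c \<Longrightarrow> ell2_le S v c"
  unfolding ell2_le_def
proof (intro allI impI)
  fix F assume s: "square_summable S v" "ell2_norm S v \<le> c" and F: "finite F" "F \<subseteq> S"
  have "(\<Sum>\<gamma>\<in>F. (cmod (v \<gamma>))\<^sup>2) \<le> (ell2_norm S v)\<^sup>2"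
    unfolding ell2_norm_power2 by (rule finite_sum_le_infsum[OF s(1) F]) simp
  then show "L2_set (\<lambda>\<gamma>. cmod (v \<gamma>)) F \<le> c"
    using s(2) L2_set_le_iff[OF ell2_norm_nonneg[of S v], of "\<lambda>\<gamma>. cmod (v \<gamma>)" F] by linarith
qed

lemma ell2_le_summable: 
  assumes "ell2_le S v c" shows "square_summable S v"
proof (rule nonneg_bdd_above_summable_on)
  show "bdd_above (sum (\<lambda>\<gamma>. (cmod (v \<gamma>))\<^sup>2) ` {F. F \<subseteq> S \<and> finite F})"
    by (rule bdd_aboveI2[of _ _ "c\<^sup>2"])
      (use assms ell2_le_nonneg[OF assms] in \<open>auto simp: ell2_le_def L2_set_le_iff\<close>)
qed simp

lemma ell2_le_norm: 
  assumes "ell2_le S v c" shows "ell2_norm S v \<le> c"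
proof -
  have "(\<Sum>\<^sub>\<infinity>\<gamma>\<in>S. (cmod (v \<gamma>))\<^sup>2) \<le> c\<^sup>2"
    by (rule infsum_le_finite_sums[OF ell2_le_summable[OF assms]])
      (use assms ell2_le_nonneg[OF assms] in \<open>auto simp: ell2_le_def L2_set_le_iff\<close>)
  then show ?thesis
    using ell2_le_nonneg[OF assms] by (simp add: ell2_norm_def real_le_lsqrt)
qed

lemma ell2_le_mono:
  "ell2_le S v c \<Longrightarrow> (\<And>\<gamma>. \<gamma> \<in> S \<Longrightarrow> cmod (w \<gamma>) \<le> cmod (v \<gamma>)) \<Longrightarrow> c \<le> d \<Longrightarrow> ell2_le S w d"
  unfolding ell2_le_def by (meson L2_set_mono norm_ge_zero order_trans subset_iff)

lemma ell2_le_cong: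
  "(\<And>\<gamma>. \<gamma> \<in> S \<Longrightarrow> v \<gamma> = w \<gamma>) \<Longrightarrow> ell2_le S v c \<longleftrightarrow> ell2_le S w c"
  using ell2_le_mono[of S v c w c] ell2_le_mono[of S w c v c] by auto

lemma ell2_le_add:
  assumes "ell2_le S v c" "ell2_le S w d" shows "ell2_le S (\<lambda>\<gamma>. v \<gamma> + w \<gamma>) (c + d)"
  unfolding ell2_le_def
proof (intro allI impI)
  fix F assume F: "finite F" "F \<subseteq> S"
  have "L2_set (\<lambda>\<gamma>. cmod (v \<gamma> + w \<gamma>)) F \<le> L2_set (\<lambda>\<gamma>. cmod (v \<gamma>) + cmod (w \<gamma>)) F"
    by (intro L2_set_mono norm_triangle_ineq) auto
  also have "\<dots> \<le> L2_set (\<lambda>\<gamma>. cmod (v \<gamma>)) F + L2_set (\<lambda>\<gamma>. cmod (w \<gamma>)) F"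
    by (rule L2_set_triangle_ineq)
  also have "\<dots> \<le> c + d"
    using assms F by (intro add_mono) (auto simp: ell2_le_def)
  finally show "L2_set (\<lambda>\<gamma>. cmod (v \<gamma> + w \<gamma>)) F \<le> c + d" .
qed

lemma ell2_le_scale:
  assumes "ell2_le S v c" shows "ell2_le S (\<lambda>\<gamma>. a * v \<gamma>) (cmod a * c)"
  unfolding ell2_le_def
proof (intro allI impI)
  fix F assume F: "finite F" "F \<subseteq> S"
  have "L2_set (\<lambda>\<gamma>. cmod (a * v \<gamma>)) F = cmod a * L2_set (\<lambda>\<gamma>. cmod (v \<gamma>)) F"
    by (simp add: norm_mult L2_set_right_distrib)
  then show "L2_set (\<lambda>\<gamma>. cmod (a * v \<gamma>)) F \<le> cmod a * c"
    using assms F by (simp add: ell2_le_def mult_left_mono)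
qed

lemma ell2_le_diff:
  "ell2_le S v c \<Longrightarrow> ell2_le S w d \<Longrightarrow> ell2_le S (\<lambda>\<gamma>. v \<gamma> - w \<gamma>) (c + d)"
  using ell2_le_add[of S v c "\<lambda>\<gamma>. - w \<gamma>" d] ell2_le_mono[of S w d "\<lambda>\<gamma>. - w \<gamma>" d] by simp

lemma ell2_le_sym: "ell2_le S (\<lambda>\<gamma>. v \<gamma> - w \<gamma>) c \<Longrightarrow> ell2_le S (\<lambda>\<gamma>. w \<gamma> - v \<gamma>) c"
  by (erule ell2_le_mono) (auto simp: norm_minus_commute)

lemma ell2_le_triangle:
  "ell2_le S (\<lambda>\<gamma>. u \<gamma> - v \<gamma>) c \<Longrightarrow> ell2_le S (\<lambda>\<gamma>. v \<gamma> - w \<gamma>) d \<Longrightarrow> ell2_le S (\<lambda>\<gamma>. u \<gamma> - w \<gamma>) (c + d)"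
  using ell2_le_add[of S "\<lambda>\<gamma>. u \<gamma> - v \<gamma>" c "\<lambda>\<gamma>. v \<gamma> - w \<gamma>" d] by simp

lemma ell2_le_point: "ell2_le S v c \<Longrightarrow> \<gamma> \<in> S \<Longrightarrow> cmod (v \<gamma>) \<le> c"
  unfolding ell2_le_def by (drule spec[of _ "{\<gamma>}"]) (simp add: L2_set_def)

text \<open>A Fatou lemma: a bound on every finite partial sum survives pointwise limits. It gives
  norm estimates for limits of Cauchy sequences before convergence in norm is known.\<close>

lemma ell2_le_limit:
  assumes "\<And>\<gamma>. \<gamma> \<in> S \<Longrightarrow> (\<lambda>n. f n \<gamma>) \<longlonglongrightarrow> v \<gamma>" "\<forall>\<^sub>F n in sequentially. ell2_le S (f n) c"
  shows "ell2_le S v c"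
  unfolding ell2_le_def
proof (intro allI impI)
  fix F assume F: "finite F" "F \<subseteq> S"
  have "(\<lambda>n. L2_set (\<lambda>\<gamma>. cmod (f n \<gamma>)) F) \<longlonglongrightarrow> L2_set (\<lambda>\<gamma>. cmod (v \<gamma>)) F"
    unfolding L2_set_def using assms(1) F by (intro tendsto_intros) auto
  then show "L2_set (\<lambda>\<gamma>. cmod (v \<gamma>)) F \<le> c"
    by (rule tendsto_upperbound) (use assms(2) F in \<open>auto simp: ell2_le_def elim!: eventually_mono\<close>)
qed

lemma ell2_le_finite_support:
  assumes "finite F" "\<And>\<gamma>. \<gamma> \<in> S \<Longrightarrow> \<gamma> \<notin> F \<Longrightarrow> v \<gamma> = 0"
  shows "ell2_le S v (L2_set (\<lambda>\<gamma>. cmod (v \<gamma>)) F)"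
  unfolding ell2_le_def
proof (intro allI impI)
  fix F' assume F': "finite F'" "F' \<subseteq> S"
  have "(\<Sum>\<gamma>\<in>F'. (cmod (v \<gamma>))\<^sup>2) = (\<Sum>\<gamma>\<in>F' \<inter> F. (cmod (v \<gamma>))\<^sup>2)"
    using F' assms(2) by (intro sum.mono_neutral_right) auto
  also have "\<dots> \<le> (\<Sum>\<gamma>\<in>F. (cmod (v \<gamma>))\<^sup>2)"
    using assms(1) by (intro sum_mono2) auto
  finally show "L2_set (\<lambda>\<gamma>. cmod (v \<gamma>)) F' \<le> L2_set (\<lambda>\<gamma>. cmod (v \<gamma>)) F"
    by (simp add: L2_set_def)
qed

lemma ell2_iff: "v \<in> ell2 S \<longleftrightarrow> (\<forall>\<gamma>. \<gamma> \<notin> S \<longrightarrow> v \<gamma> = 0) \<and> (\<exists>c. ell2_le S v c)"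
  unfolding ell2_def using ell2_leI[of v S "ell2_norm S v"] ell2_le_summable[of S v] by auto

lemma ell2_le_ell2_norm: "v \<in> ell2 S \<Longrightarrow> ell2_le S v (ell2_norm S v)"
  by (rule ell2_leI) (auto simp: ell2_def)

lemma ell2_0: "(\<lambda>_. 0) \<in> ell2 S"
  by (simp add: ell2_def)

lemma ell2_add: "v \<in> ell2 S \<Longrightarrow> w \<in> ell2 S \<Longrightarrow> (\<lambda>\<gamma>. v \<gamma> + w \<gamma>) \<in> ell2 S"
  unfolding ell2_iff by (metis add.left_neutral ell2_le_add)

lemma ell2_scale: "v \<in> ell2 S \<Longrightarrow> (\<lambda>\<gamma>. a * v \<gamma>) \<in> ell2 S"
  unfolding ell2_iff by (metis ell2_le_scale mult_zero_right)

lemma ell2_diff: "v \<in> ell2 S \<Longrightarrow> w \<in> ell2 S \<Longrightarrow> (\<lambda>\<gamma>. v \<gamma> - w \<gamma>) \<in> ell2 S"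
  using ell2_add[of v S "\<lambda>\<gamma>. -1 * w \<gamma>"] ell2_scale[of w S "-1"] by simp

lemma cmod_cutoff_le: "cmod (cutoff A v \<gamma>) \<le> cmod (v \<gamma>)"
  by (simp add: cutoff_def indicator_def)

lemma cutoff_eq: "\<gamma> \<in> A \<Longrightarrow> cutoff A v \<gamma> = v \<gamma>" "\<gamma> \<notin> A \<Longrightarrow> cutoff A v \<gamma> = 0"
  by (simp_all add: cutoff_def)

lemma ell2_le_cutoff: "ell2_le S v c \<Longrightarrow> ell2_le S (cutoff A v) c"
  by (erule ell2_le_mono) (simp_all add: cmod_cutoff_le)

lemma cutoff_ell2: "ell2_le S v c \<Longrightarrow> cutoff S v \<in> ell2 S"
  unfolding ell2_iff using ell2_le_cutoff[of S v c S] by (auto simp: cutoff_eq)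

lemma cutoff_ell2': "v \<in> ell2 S \<Longrightarrow> cutoff A v \<in> ell2 S"
  unfolding ell2_iff using ell2_le_cutoff[of S v _ A] by (fastforce simp: cutoff_def)

lemma delta_simps [simp]: "delta \<gamma> \<gamma> = 1" "\<alpha> \<noteq> \<gamma> \<Longrightarrow> delta \<gamma> \<alpha> = 0"
  by (auto simp: delta_def)

lemma delta_ell2: "\<gamma> \<in> S \<Longrightarrow> delta \<gamma> \<in> ell2 S"
  unfolding ell2_iff using ell2_le_finite_support[of "{\<gamma>}" S "delta \<gamma>"]
  by (auto simp: delta_def indicator_def)

text \<open>Point masses are orthogonal, so the coefficient vector controls the norm. This is how
  coefficients are compared with combinations of columns when \<open>column_operator\<close> is
  applied.\<close>

lemma ell2_le_delta_sum:
  assumes "finite F"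
  shows "ell2_le S (\<lambda>\<alpha>. \<Sum>\<gamma>\<in>F. a \<gamma> * delta \<gamma> \<alpha>) (L2_set (\<lambda>\<gamma>. cmod (a \<gamma>)) F)"
proof -
  have val: "(\<Sum>\<gamma>\<in>F. a \<gamma> * delta \<gamma> \<alpha>) = (if \<alpha> \<in> F then a \<alpha> else 0)" for \<alpha>
    using assms by (simp add: delta_def indicator_def of_bool_def if_distrib[of "(*) _"] cong: if_cong)
  have "ell2_le S (\<lambda>\<alpha>. \<Sum>\<gamma>\<in>F. a \<gamma> * delta \<gamma> \<alpha>) (L2_set (\<lambda>\<alpha>. cmod (\<Sum>\<gamma>\<in>F. a \<gamma> * delta \<gamma> \<alpha>)) F)"
    by (rule ell2_le_finite_support[OF assms]) (simp add: val)
  moreover have "L2_set (\<lambda>\<alpha>. cmod (\<Sum>\<gamma>\<in>F. a \<gamma> * delta \<gamma> \<alpha>)) F = L2_set (\<lambda>\<gamma>. cmod (a \<gamma>)) F"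
    by (rule L2_set_cong) (simp_all add: val)
  ultimately show ?thesis by simp
qed

text \<open>Cauchy--Schwarz on finite partial sums. Absolute summability is recorded as well because
  additivity of \<open>infsum\<close> rests on it.\<close>

lemma ell2_inner_bound:
  assumes "ell2_le S v a" "ell2_le S w b"
  shows "(\<lambda>\<gamma>. norm (cnj (v \<gamma>) * w \<gamma>)) summable_on S" "cmod (ell2_inner S v w) \<le> a * b"
proof -
  have fin: "(\<Sum>\<gamma>\<in>F. norm (cnj (v \<gamma>) * w \<gamma>)) \<le> a * b" if "finite F" "F \<subseteq> S" for F
  proof -
    have "(\<Sum>\<gamma>\<in>F. norm (cnj (v \<gamma>) * w \<gamma>)) \<le> L2_set (\<lambda>\<gamma>. cmod (v \<gamma>)) F * L2_set (\<lambda>\<gamma>. cmod (w \<gamma>)) F"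
      using L2_set_mult_ineq[of "\<lambda>\<gamma>. cmod (v \<gamma>)" "\<lambda>\<gamma>. cmod (w \<gamma>)" F] by (simp add: norm_mult)
    also have "\<dots> \<le> a * b"
      using assms that ell2_le_nonneg[OF assms(1)] by (intro mult_mono) (auto simp: ell2_le_def)
    finally show ?thesis .
  qed
  show s: "(\<lambda>\<gamma>. norm (cnj (v \<gamma>) * w \<gamma>)) summable_on S"
    by (rule nonneg_bdd_above_summable_on) (auto intro!: bdd_aboveI2[of _ _ "a * b"] fin)
  have "cmod (ell2_inner S v w) \<le> (\<Sum>\<^sub>\<infinity>\<gamma>\<in>S. norm (cnj (v \<gamma>) * w \<gamma>))"
    unfolding ell2_inner_def by (rule norm_infsum_bound[OF s])
  also have "\<dots> \<le> a * b"
    by (rule infsum_le_finite_sums[OF s fin])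
  finally show "cmod (ell2_inner S v w) \<le> a * b" .
qed

lemma ell2_inner_cong:
  "(\<And>\<gamma>. \<gamma> \<in> S \<Longrightarrow> v \<gamma> = v' \<gamma>) \<Longrightarrow> (\<And>\<gamma>. \<gamma> \<in> S \<Longrightarrow> w \<gamma> = w' \<gamma>) \<Longrightarrow> ell2_inner S v w = ell2_inner S v' w'"
  unfolding ell2_inner_def by (rule infsum_cong) simp

lemma ell2_inner_cnj: "cnj (ell2_inner S v w) = ell2_inner S w v"
  unfolding ell2_inner_def infsum_cnj[symmetric] by (simp add: mult.commute)

lemma ell2_inner_add_right:
  assumes "ell2_le S v a" "ell2_le S w b" "ell2_le S w' b'"
  shows "ell2_inner S v (\<lambda>\<gamma>. w \<gamma> + w' \<gamma>) = ell2_inner S v w + ell2_inner S v w'"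
  unfolding ell2_inner_def distrib_left
  by (rule infsum_add[OF abs_summable_summable abs_summable_summable])
    (rule ell2_inner_bound(1)[OF assms(1,2)] ell2_inner_bound(1)[OF assms(1,3)])+

lemma ell2_inner_scale_right: "ell2_inner S v (\<lambda>\<gamma>. c * w \<gamma>) = c * ell2_inner S v w"
  unfolding ell2_inner_def infsum_cmult_right'[symmetric] by (simp add: mult_ac)

lemma ell2_inner_add_left:
  assumes "ell2_le S v a" "ell2_le S v' a'" "ell2_le S w b"
  shows "ell2_inner S (\<lambda>\<gamma>. v \<gamma> + v' \<gamma>) w = ell2_inner S v w + ell2_inner S v' w"
  by (metis ell2_inner_add_right[OF assms(3,1,2)] ell2_inner_cnj complex_cnj_add)

lemma ell2_inner_scale_left: "ell2_inner S (\<lambda>\<gamma>. c * v \<gamma>) w = cnj c * ell2_inner S v w"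
  by (metis ell2_inner_scale_right ell2_inner_cnj complex_cnj_mult)

lemma ell2_inner_self:
  assumes "ell2_le S v c"
  shows "ell2_inner S v v = complex_of_real ((ell2_norm S v)\<^sup>2)"
proof -
  have "((\<lambda>\<gamma>. complex_of_real ((cmod (v \<gamma>))\<^sup>2)) has_sum complex_of_real ((ell2_norm S v)\<^sup>2)) S"
    unfolding has_sum_of_real_iff ell2_norm_power2
    using ell2_le_summable[OF assms] by (rule has_sum_infsum)
  moreover have "complex_of_real ((cmod (v \<gamma>))\<^sup>2) = cnj (v \<gamma>) * v \<gamma>" for \<gamma>
    by (metis complex_norm_square mult.commute)
  ultimately show ?thesis
    unfolding ell2_inner_def by (simp add: infsumI)
qed

lemma ell2_inner_delta_left: "\<gamma> \<in> S \<Longrightarrow> ell2_inner S (delta \<gamma>) w = w \<gamma>"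
proof -
  assume "\<gamma> \<in> S"
  then have "ell2_inner S (delta \<gamma>) w = (\<Sum>\<^sub>\<infinity>\<alpha>\<in>{\<gamma>}. cnj (delta \<gamma> \<alpha>) * w \<alpha>)"
    unfolding ell2_inner_def by (intro infsum_cong_neutral) auto
  then show ?thesis by simp
qed

lemma ell2_inner_delta_right: "\<gamma> \<in> S \<Longrightarrow> ell2_inner S v (delta \<gamma>) = cnj (v \<gamma>)"
  by (metis ell2_inner_delta_left ell2_inner_cnj)

text \<open>Once the partial sum of squares over \<open>F\<close> is within
  \<open>\<epsilon>\<^sup>2\<close> of the total, any finite set of further indices carries at most
  \<open>\<epsilon>\<^sup>2\<close>.\<close>

lemma ell2_finite_approx:
  assumes "v \<in> ell2 S" "\<epsilon> > 0"
  obtains F where "finite F" "F \<subseteq> S" "ell2_le S (\<lambda>\<gamma>. v \<gamma> - cutoff F v \<gamma>) \<epsilon>"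
proof -
  let ?q = "\<lambda>\<gamma>. (cmod (v \<gamma>))\<^sup>2"
  have s: "square_summable S v" using assms by (simp add: ell2_def)
  obtain F where F: "finite F" "F \<subseteq> S" "dist (sum ?q F) (infsum ?q S) \<le> \<epsilon>\<^sup>2"
    using infsum_finite_approximation[OF s, of "\<epsilon>\<^sup>2"] assms(2) by auto
  have "ell2_le S (\<lambda>\<gamma>. v \<gamma> - cutoff F v \<gamma>) \<epsilon>"
    unfolding ell2_le_def
  proof (intro allI impI)
    fix H assume H: "finite H" "H \<subseteq> S"
    have "(\<Sum>\<gamma>\<in>H. (cmod (v \<gamma> - cutoff F v \<gamma>))\<^sup>2) = (\<Sum>\<gamma>\<in>H - F. ?q \<gamma>)"
      using H by (intro sum.mono_neutral_cong_right) (auto simp: cutoff_def)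
    also have "\<dots> = (\<Sum>\<gamma>\<in>H \<union> F. ?q \<gamma>) - (\<Sum>\<gamma>\<in>F. ?q \<gamma>)"
      using H F sum.subset_diff[of F "H \<union> F" ?q] by (simp add: Un_Diff)
    also have "\<dots> \<le> infsum ?q S - sum ?q F"
      using finite_sum_le_infsum[OF s, of "H \<union> F"] H F by simp
    also have "\<dots> \<le> \<epsilon>\<^sup>2"
      using F(3) by (auto simp: dist_real_def)
    finally show "L2_set (\<lambda>\<gamma>. cmod (v \<gamma> - cutoff F v \<gamma>)) H \<le> \<epsilon>"
      using assms(2) by (subst L2_set_le_iff) auto
  qed
  then show thesis using F that by blast
qed


lemma ell2_le_sum:
  assumes "finite F" "\<And>i. i \<in> F \<Longrightarrow> \<exists>c. ell2_le S (K i) c"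
  shows "\<exists>c. ell2_le S (\<lambda>\<alpha>. \<Sum>i\<in>F. a i * K i \<alpha>) c"
  using assms
proof (induction F rule: finite_induct)
  case empty
  show ?case using ell2_0[of S] by (auto simp: ell2_iff)
next
  case (insert i F)
  then obtain c d where "ell2_le S (\<lambda>\<alpha>. \<Sum>i\<in>F. a i * K i \<alpha>) c" "ell2_le S (K i) d"
    by (metis insertI1 insertI2)
  from ell2_le_add[OF ell2_le_scale[OF this(2), of "a i"] this(1)] show ?case
    using insert.hyps by auto
qed

lemma ell2_inner_sum_left:
  assumes "finite F" "\<And>i. i \<in> F \<Longrightarrow> \<exists>c. ell2_le S (K i) c" "ell2_le S w b"
  shows "ell2_inner S (\<lambda>\<alpha>. \<Sum>i\<in>F. a i * K i \<alpha>) w = (\<Sum>i\<in>F. cnj (a i) * ell2_inner S (K i) w)"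
  using assms(1,2)
proof (induction F rule: finite_induct)
  case empty
  show ?case by (simp add: ell2_inner_def)
next
  case (insert i F)
  obtain c where c: "ell2_le S (\<lambda>\<alpha>. \<Sum>i\<in>F. a i * K i \<alpha>) c"
    using ell2_le_sum[of F S K a] insert by auto
  obtain d where d: "ell2_le S (K i) d" using insert by blast
  show ?case
    using ell2_inner_add_left[OF ell2_le_scale[OF d, of "a i"] c assms(3)] insert
    by (simp add: ell2_inner_scale_left)
qed

section \<open>Bounded operators\<close>

lemma bounded_ops_mem: "T \<in> bounded_ops S \<Longrightarrow> v \<in> ell2 S \<Longrightarrow> T v \<in> ell2 S"
  unfolding bounded_ops_def by auto

lemma bounded_ops_outside: "T \<in> bounded_ops S \<Longrightarrow> v \<notin> ell2 S \<Longrightarrow> T v = undefined"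
  unfolding bounded_ops_def by (simp add: PiE_def extensional_def)

lemma bounded_ops_add:
  "T \<in> bounded_ops S \<Longrightarrow> v \<in> ell2 S \<Longrightarrow> w \<in> ell2 S \<Longrightarrow> T (\<lambda>\<gamma>. v \<gamma> + w \<gamma>) = (\<lambda>\<gamma>. T v \<gamma> + T w \<gamma>)"
  unfolding bounded_ops_def by auto

lemma bounded_ops_scale:
  "T \<in> bounded_ops S \<Longrightarrow> v \<in> ell2 S \<Longrightarrow> T (\<lambda>\<gamma>. c * v \<gamma>) = (\<lambda>\<gamma>. c * T v \<gamma>)"
  unfolding bounded_ops_def by auto

lemma bounded_ops_diff:
  assumes "T \<in> bounded_ops S" "v \<in> ell2 S" "w \<in> ell2 S"
  shows "T (\<lambda>\<gamma>. v \<gamma> - w \<gamma>) = (\<lambda>\<gamma>. T v \<gamma> - T w \<gamma>)"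
  using bounded_ops_add[OF assms(1,2) ell2_scale[OF assms(3), of "-1"]]
    bounded_ops_scale[OF assms(1,3), of "-1"] by simp

lemma bounded_ops_zero: "T \<in> bounded_ops S \<Longrightarrow> T (\<lambda>_. 0) = (\<lambda>_. 0)"
  using bounded_ops_scale[of T S "\<lambda>_. 0" 0] ell2_0[of S] by simp

lemma bounded_ops_bound:
  assumes "T \<in> bounded_ops S"
  shows "\<exists>C\<ge>0. \<forall>v\<in>ell2 S. \<forall>c. ell2_le S v c \<longrightarrow> ell2_le S (T v) (C * c)"
proof -
  obtain C where C: "\<forall>v\<in>ell2 S. ell2_norm S (T v) \<le> C * ell2_norm S v"
    using assms unfolding bounded_ops_def by blast
  show ?thesis
  proof (intro exI[of _ "max C 0"] conjI ballI allI impI)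
    fix v c assume v: "v \<in> ell2 S" "ell2_le S v c"
    have "ell2_norm S (T v) \<le> C * ell2_norm S v" using C v by blast
    also have "\<dots> \<le> max C 0 * ell2_norm S v"
      by (intro mult_right_mono ell2_norm_nonneg) simp
    also have "\<dots> \<le> max C 0 * c"
      by (intro mult_left_mono ell2_le_norm v) simp
    finally show "ell2_le S (T v) (max C 0 * c)"
      using ell2_le_mono[OF ell2_le_ell2_norm[OF bounded_ops_mem[OF assms v(1)]]] by simp
  qed simp
qed

text \<open>Finitely supported vectors are combinations of point masses and lie dense. The lemma is
  phrased for an arbitrary \<open>\<phi>\<close> so that both point evaluations of operators and
  inner products can be inserted.\<close>

lemma bounded_functional_eq_0:
  assumes add: "\<And>v w. v \<in> ell2 S \<Longrightarrow> w \<in> ell2 S \<Longrightarrow> \<phi> (\<lambda>\<gamma>. v \<gamma> + w \<gamma>) = \<phi> v + (\<phi> w :: complex)"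
    and scale: "\<And>v c. v \<in> ell2 S \<Longrightarrow> \<phi> (\<lambda>\<gamma>. c * v \<gamma>) = c * \<phi> v"
    and bound: "\<And>v c. v \<in> ell2 S \<Longrightarrow> ell2_le S v c \<Longrightarrow> cmod (\<phi> v) \<le> C * c"
    and delta: "\<And>\<gamma>. \<gamma> \<in> S \<Longrightarrow> \<phi> (delta \<gamma>) = 0"
    and v: "v \<in> ell2 S"
  shows "\<phi> v = 0"
proof -
  have zero: "\<phi> (\<lambda>_. 0) = 0"
    using scale[OF ell2_0, of 0] by simp
  have fin: "\<phi> (cutoff F v) = 0" if "finite F" "F \<subseteq> S" for F
    using that
  proof (induction F rule: finite_induct)
    case empty
    then show ?case using zero by (simp add: cutoff_def)
  next
    case (insert \<gamma> F)
    have "cutoff (insert \<gamma> F) v = (\<lambda>\<alpha>. cutoff F v \<alpha> + v \<gamma> * delta \<gamma> \<alpha>)"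
      using insert.hyps by (auto simp: cutoff_def delta_def indicator_def)
    then have "\<phi> (cutoff (insert \<gamma> F) v) = \<phi> (cutoff F v) + \<phi> (\<lambda>\<alpha>. v \<gamma> * delta \<gamma> \<alpha>)"
      using add[of "cutoff F v" "\<lambda>\<alpha>. v \<gamma> * delta \<gamma> \<alpha>"] cutoff_ell2'[OF v, of F]
        ell2_scale[OF delta_ell2[of \<gamma> S], of "v \<gamma>"] insert.prems by simp
    also have "\<dots> = 0"
      using insert scale[of "delta \<gamma>" "v \<gamma>"] delta[of \<gamma>] delta_ell2[of \<gamma> S] by auto
    finally show ?case .
  qed
  have small: "cmod (\<phi> v) \<le> C * \<epsilon>" if "\<epsilon> > 0" for \<epsilon>
  proof -
    obtain F where F: "finite F" "F \<subseteq> S" "ell2_le S (\<lambda>\<gamma>. v \<gamma> - cutoff F v \<gamma>) \<epsilon>"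
      using ell2_finite_approx[OF v \<open>\<epsilon> > 0\<close>] by blast
    have d: "(\<lambda>\<gamma>. v \<gamma> - cutoff F v \<gamma>) \<in> ell2 S"
      by (rule ell2_diff[OF v cutoff_ell2'[OF v]])
    have "\<phi> v = \<phi> (\<lambda>\<gamma>. v \<gamma> - cutoff F v \<gamma>) + \<phi> (cutoff F v)"
      using add[OF d cutoff_ell2'[OF v, of F]] by simp
    then show ?thesis
      using fin[OF F(1,2)] bound[OF d F(3)] by simp
  qed
  \<comment> \<open>The estimate with \<open>\<epsilon>\<close> equal to 1 forces the sign of
    \<open>C\<close>.\<close>
  have "C \<ge> 0" using order_trans[OF norm_ge_zero small[of 1]] by simp
  show ?thesis
  proof (rule ccontr)
    assume "\<phi> v \<noteq> 0"
    then have p: "cmod (\<phi> v) > 0" by simp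
    \<comment> \<open>The \<open>\<epsilon>\<close> is chosen so that \<open>C * \<epsilon>\<close>
      stays below \<open>cmod (\<phi> v)\<close>; \<open>C + 1\<close> keeps the denominator
      positive when \<open>C\<close> is 0.\<close>
    have "cmod (\<phi> v) \<le> C * (cmod (\<phi> v) / (2 * (C + 1)))"
      using p \<open>C \<ge> 0\<close> by (intro small) simp
    also have "\<dots> < cmod (\<phi> v)"
      using p mult_nonneg_nonneg[OF \<open>C \<ge> 0\<close> norm_ge_zero, of "\<phi> v"] \<open>C \<ge> 0\<close>
      by (simp add: field_simps add_nonneg_pos del: zero_less_norm_iff)
    finally show False by simp
  qed
qed

text \<open>The difference of the two operators, evaluated at a point of \<open>S\<close>, is a
  bounded functional vanishing on point masses. Off \<open>ell2 S\<close> both operators take the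
  value \<open>undefined\<close>, so agreement on point masses becomes equality of HOL
  functions.\<close>

lemma bounded_ops_eqI:
  assumes T: "T \<in> bounded_ops S" and R: "R \<in> bounded_ops S"
    and eq: "\<And>\<gamma>. \<gamma> \<in> S \<Longrightarrow> T (delta \<gamma>) = R (delta \<gamma>)"
  shows "T = R"
proof (rule ext)
  fix v
  show "T v = R v"
  proof (cases "v \<in> ell2 S")
    case v: True
    obtain C where C: "\<And>v c. v \<in> ell2 S \<Longrightarrow> ell2_le S v c \<Longrightarrow> ell2_le S (T v) (C * c)"
      using bounded_ops_bound[OF T] by blast
    obtain D where D: "\<And>v c. v \<in> ell2 S \<Longrightarrow> ell2_le S v c \<Longrightarrow> ell2_le S (R v) (D * c)"
      using bounded_ops_bound[OF R] by blast
    have "T v \<alpha> - R v \<alpha> = 0" if \<alpha>: "\<alpha> \<in> S" for \<alpha>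
    proof (rule bounded_functional_eq_0[where \<phi>="\<lambda>v. T v \<alpha> - R v \<alpha>" and S=S and C="C + D"])
      show "cmod (T v \<alpha> - R v \<alpha>) \<le> (C + D) * c" if "v \<in> ell2 S" "ell2_le S v c" for v c
        using ell2_le_point[OF ell2_le_diff[OF C[OF that] D[OF that]] \<alpha>] by (simp add: distrib_right)
      show "T (\<lambda>\<gamma>. v \<gamma> + w \<gamma>) \<alpha> - R (\<lambda>\<gamma>. v \<gamma> + w \<gamma>) \<alpha> = T v \<alpha> - R v \<alpha> + (T w \<alpha> - R w \<alpha>)"
        if "v \<in> ell2 S" "w \<in> ell2 S" for v w
        by (simp add: bounded_ops_add[OF T that] bounded_ops_add[OF R that])
      show "T (\<lambda>\<gamma>. c * v \<gamma>) \<alpha> - R (\<lambda>\<gamma>. c * v \<gamma>) \<alpha> = c * (T v \<alpha> - R v \<alpha>)"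
        if "v \<in> ell2 S" for v c
        by (simp add: bounded_ops_scale[OF T that] bounded_ops_scale[OF R that] right_diff_distrib)
      show "T (delta \<gamma>) \<alpha> - R (delta \<gamma>) \<alpha> = 0" if "\<gamma> \<in> S" for \<gamma>
        using eq[OF that] by simp
    qed (rule v)
    moreover have "T v \<alpha> = 0" "R v \<alpha> = 0" if "\<alpha> \<notin> S" for \<alpha>
      using bounded_ops_mem[OF T v] bounded_ops_mem[OF R v] that by (auto simp: ell2_def)
    ultimately show ?thesis by (intro ext) (metis eq_iff_diff_eq_0)
  qed (simp add: bounded_ops_outside[OF T] bounded_ops_outside[OF R])
qed

text \<open>Boundedness on finite combinations of the columns \<open>K \<gamma>\<close> is boundedness of the adjoint.\<close>

lemma column_operator:
  assumes K: "\<And>\<gamma>. \<gamma> \<in> S \<Longrightarrow> K \<gamma> \<in> ell2 S" and "C \<ge> 0"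
    and bound: "\<And>F a. finite F \<Longrightarrow> F \<subseteq> S \<Longrightarrow>
      ell2_le S (\<lambda>\<alpha>. \<Sum>\<gamma>\<in>F. a \<gamma> * K \<gamma> \<alpha>) (C * L2_set (\<lambda>\<gamma>. cmod (a \<gamma>)) F)"
  defines "R \<equiv> \<lambda>w\<in>ell2 S. \<lambda>\<gamma>. if \<gamma> \<in> S then ell2_inner S (K \<gamma>) w else 0"
  shows "R \<in> bounded_ops S" "\<And>w. w \<in> ell2 S \<Longrightarrow> ell2_norm S (R w) \<le> C * ell2_norm S w"
proof -
  have le: "ell2_le S (R w) (C * ell2_norm S w)" if w: "w \<in> ell2 S" for w
    unfolding ell2_le_def
  proof (intro allI impI)
    fix F assume F: "finite F" "F \<subseteq> S"
    let ?L = "L2_set (\<lambda>\<gamma>. cmod (R w \<gamma>)) F"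
    have w': "ell2_le S w (ell2_norm S w)" by (rule ell2_le_ell2_norm[OF w])
    \<comment> \<open>Duality: with the values \<open>R w \<gamma>\<close> themselves as
      coefficients, pairing the combination of columns with \<open>w\<close> gives exactly
      \<open>?L\<close> squared, while the hypothesis bounds it by
      \<open>C * ?L * ell2_norm S w\<close>. Cancelling \<open>?L\<close> leaves the claim.\<close>
    have "ell2_inner S (\<lambda>\<alpha>. \<Sum>\<gamma>\<in>F. R w \<gamma> * K \<gamma> \<alpha>) w = (\<Sum>\<gamma>\<in>F. cnj (R w \<gamma>) * ell2_inner S (K \<gamma>) w)"
      by (rule ell2_inner_sum_left[OF F(1) _ w']) (use K F in \<open>auto simp: ell2_iff\<close>)
    also have "\<dots> = (\<Sum>\<gamma>\<in>F. complex_of_real ((cmod (R w \<gamma>))\<^sup>2))"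
    proof (rule sum.cong)
      fix \<gamma> assume "\<gamma> \<in> F"
      then have "ell2_inner S (K \<gamma>) w = R w \<gamma>" using w F by (auto simp: R_def)
      then show "cnj (R w \<gamma>) * ell2_inner S (K \<gamma>) w = complex_of_real ((cmod (R w \<gamma>))\<^sup>2)"
        by (metis complex_norm_square mult.commute)
    qed simp
    also have "\<dots> = complex_of_real (?L\<^sup>2)"
      by (simp add: L2_set_def sum_nonneg)
    finally have "?L\<^sup>2 \<le> (C * ?L) * ell2_norm S w"
      using ell2_inner_bound(2)[OF bound[OF F, of "R w"] w'] by (simp add: norm_power)
    then have "?L * ?L \<le> ?L * (C * ell2_norm S w)"
      by (simp add: power2_eq_square mult_ac)
    then show "?L \<le> C * ell2_norm S w"
      using L2_set_nonneg[of "\<lambda>\<gamma>. cmod (R w \<gamma>)" F] \<open>C \<ge> 0\<close> ell2_norm_nonneg[of S w]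
      by (cases "?L = 0") (auto simp: mult_le_cancel_left)
  qed
  show bd: "ell2_norm S (R w) \<le> C * ell2_norm S w" if "w \<in> ell2 S" for w
    using ell2_le_norm[OF le[OF that]] .
  have mem: "R w \<in> ell2 S" if "w \<in> ell2 S" for w
    unfolding ell2_iff using le[OF that] that by (auto simp: R_def)
  have add: "R (\<lambda>\<gamma>. v \<gamma> + w \<gamma>) = (\<lambda>\<gamma>. R v \<gamma> + R w \<gamma>)" if "v \<in> ell2 S" "w \<in> ell2 S" for v w
    using that ell2_add[OF that] K
    by (auto simp: R_def fun_eq_iff intro!: ell2_inner_add_right ell2_le_ell2_norm)
  have scale: "R (\<lambda>\<gamma>. c * v \<gamma>) = (\<lambda>\<gamma>. c * R v \<gamma>)" if "v \<in> ell2 S" for v c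
    using that ell2_scale[OF that, of c] by (auto simp: R_def fun_eq_iff ell2_inner_scale_right)
  have "R \<in> ell2 S \<rightarrow>\<^sub>E ell2 S"
    using mem by (auto simp: R_def)
  then show "R \<in> bounded_ops S"
    unfolding bounded_ops_def using add scale bd by blast
qed

text \<open>The adjoint is the column operator whose columns are the images of point masses, which
  also shows that the definite description denotes. The constant \<open>C\<close> is carried through
  so that a bound common to all fibres passes to the adjoint family.\<close>

lemma op_adjoint:
  assumes T: "T \<in> bounded_ops S"
    and C: "C \<ge> 0" "\<And>v. v \<in> ell2 S \<Longrightarrow> ell2_norm S (T v) \<le> C * ell2_norm S v"
  shows "op_adjoint S T \<in> bounded_ops S"
    and "\<And>v w. v \<in> ell2 S \<Longrightarrow> w \<in> ell2 S \<Longrightarrow> ell2_inner S (op_adjoint S T v) w = ell2_inner S v (T w)"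
    and "\<And>v. v \<in> ell2 S \<Longrightarrow> ell2_norm S (op_adjoint S T v) \<le> C * ell2_norm S v"
proof -
  define R where "R = (\<lambda>w\<in>ell2 S. \<lambda>\<gamma>. if \<gamma> \<in> S then ell2_inner S (T (delta \<gamma>)) w else 0)"
  have Tle: "ell2_le S (T v) (C * c)" if "v \<in> ell2 S" "ell2_le S v c" for v c
    using C(2)[OF that(1)] mult_left_mono[OF ell2_le_norm[OF that(2)] C(1)]
    by (intro ell2_le_mono[OF ell2_le_ell2_norm[OF bounded_ops_mem[OF T that(1)]]]) auto
  have comb: "(\<lambda>\<alpha>. \<Sum>\<gamma>\<in>F. a \<gamma> * delta \<gamma> \<alpha>) \<in> ell2 S \<and>
      T (\<lambda>\<alpha>. \<Sum>\<gamma>\<in>F. a \<gamma> * delta \<gamma> \<alpha>) = (\<lambda>\<alpha>. \<Sum>\<gamma>\<in>F. a \<gamma> * T (delta \<gamma>) \<alpha>)"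
    if "finite F" "F \<subseteq> S" for F a
    using that
  proof (induction F rule: finite_induct)
    case empty
    then show ?case by (simp add: ell2_0 bounded_ops_zero[OF T])
  next
    case (insert \<gamma> F)
    have d: "delta \<gamma> \<in> ell2 S" using insert by (simp add: delta_ell2)
    show ?case
      using insert bounded_ops_add[OF T ell2_scale[OF d, of "a \<gamma>"], of "\<lambda>\<alpha>. \<Sum>\<gamma>\<in>F. a \<gamma> * delta \<gamma> \<alpha>"]
        ell2_add[OF ell2_scale[OF d, of "a \<gamma>"], of "\<lambda>\<alpha>. \<Sum>\<gamma>\<in>F. a \<gamma> * delta \<gamma> \<alpha>"]
        bounded_ops_scale[OF T d, of "a \<gamma>"] by simp
  qed
  have R: "R \<in> bounded_ops S" "\<And>w. w \<in> ell2 S \<Longrightarrow> ell2_norm S (R w) \<le> C * ell2_norm S w"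
  proof -
    have b: "ell2_le S (\<lambda>\<alpha>. \<Sum>\<gamma>\<in>F. a \<gamma> * T (delta \<gamma>) \<alpha>) (C * L2_set (\<lambda>\<gamma>. cmod (a \<gamma>)) F)"
      if F: "finite F" "F \<subseteq> S" for F a
      using Tle[of "\<lambda>\<alpha>. \<Sum>\<gamma>\<in>F. a \<gamma> * delta \<gamma> \<alpha>"] comb[OF F, of a] ell2_le_delta_sum[OF F(1), of S a]
      by simp
    have k: "\<And>\<gamma>. \<gamma> \<in> S \<Longrightarrow> T (delta \<gamma>) \<in> ell2 S"
      by (simp add: bounded_ops_mem[OF T] delta_ell2)
    show "R \<in> bounded_ops S" "\<And>w. w \<in> ell2 S \<Longrightarrow> ell2_norm S (R w) \<le> C * ell2_norm S w"
      using column_operator[of S "\<lambda>\<gamma>. T (delta \<gamma>)" C, OF k C(1) b] unfolding R_def by auto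
  qed
  have adj: "ell2_inner S (R v) w = ell2_inner S v (T w)" if v: "v \<in> ell2 S" and w: "w \<in> ell2 S" for v w
  proof -
    obtain c where c: "ell2_le S (R v) c" using bounded_ops_mem[OF R(1) v] by (auto simp: ell2_iff)
    obtain d where d: "ell2_le S v d" using v by (auto simp: ell2_iff)
    have le: "ell2_le S u (ell2_norm S u)" "ell2_le S (T u) (ell2_norm S (T u))" if "u \<in> ell2 S" for u
      using that bounded_ops_mem[OF T that] by (simp_all add: ell2_le_ell2_norm)
    \<comment> \<open>As functions of \<open>w\<close> both terms are bounded and linear, so it
      suffices to compare them on point masses, where they agree by the definition of
      \<open>R\<close>.\<close>
    have "ell2_inner S (R v) w - ell2_inner S v (T w) = 0"
    proof (rule bounded_functional_eq_0[where C="c + d * C" and S=S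
          and \<phi>="\<lambda>w. ell2_inner S (R v) w - ell2_inner S v (T w)"])
      show "ell2_inner S (R v) (delta \<gamma>) - ell2_inner S v (T (delta \<gamma>)) = 0" if "\<gamma> \<in> S" for \<gamma>
        using that v by (simp add: ell2_inner_delta_right R_def ell2_inner_cnj)
      show "cmod (ell2_inner S (R v) u - ell2_inner S v (T u)) \<le> (c + d * C) * e"
        if "u \<in> ell2 S" "ell2_le S u e" for u e
        using norm_triangle_ineq4[of "ell2_inner S (R v) u" "ell2_inner S v (T u)"]
          ell2_inner_bound(2)[OF c that(2)] ell2_inner_bound(2)[OF d Tle[OF that]]
        by (simp add: algebra_simps)
      show "ell2_inner S (R v) (\<lambda>\<gamma>. u \<gamma> + u' \<gamma>) - ell2_inner S v (T (\<lambda>\<gamma>. u \<gamma> + u' \<gamma>)) =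
          ell2_inner S (R v) u - ell2_inner S v (T u) + (ell2_inner S (R v) u' - ell2_inner S v (T u'))"
        if "u \<in> ell2 S" "u' \<in> ell2 S" for u u'
        using ell2_inner_add_right[OF c le(1)[OF that(1)] le(1)[OF that(2)]]
          ell2_inner_add_right[OF d le(2)[OF that(1)] le(2)[OF that(2)]] bounded_ops_add[OF T that]
        by simp
      show "ell2_inner S (R v) (\<lambda>\<gamma>. k * u \<gamma>) - ell2_inner S v (T (\<lambda>\<gamma>. k * u \<gamma>)) =
          k * (ell2_inner S (R v) u - ell2_inner S v (T u))" if "u \<in> ell2 S" for u k
        by (simp add: bounded_ops_scale[OF T that] ell2_inner_scale_right right_diff_distrib)
    qed (rule w)
    then show ?thesis by simp
  qed
  have "op_adjoint S T = R"
    unfolding op_adjoint_def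
  proof (rule the_equality)
    fix Q assume Q: "Q \<in> bounded_ops S \<and> (\<forall>v\<in>ell2 S. \<forall>w\<in>ell2 S. ell2_inner S (Q v) w = ell2_inner S v (T w))"
    have "Q v \<gamma> = R v \<gamma>" if "v \<in> ell2 S" "\<gamma> \<in> S" for v \<gamma>
      using adj[OF that(1) delta_ell2[OF that(2)]] Q that
      by (metis delta_ell2 ell2_inner_delta_right complex_cnj_cancel_iff)
    moreover have "Q v \<gamma> = R v \<gamma>" if "v \<in> ell2 S" "\<gamma> \<notin> S" for v \<gamma>
      using that bounded_ops_mem[of Q S v] bounded_ops_mem[OF R(1) that(1)] Q by (simp add: ell2_def)
    ultimately show "Q = R"
      using Q by (intro bounded_ops_eqI[of Q S R] R ext) (metis delta_ell2)+
  qed (use R adj in blast)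
  then show "op_adjoint S T \<in> bounded_ops S"
    "\<And>v w. v \<in> ell2 S \<Longrightarrow> w \<in> ell2 S \<Longrightarrow> ell2_inner S (op_adjoint S T v) w = ell2_inner S v (T w)"
    "\<And>v. v \<in> ell2 S \<Longrightarrow> ell2_norm S (op_adjoint S T v) \<le> C * ell2_norm S v"
    using R adj by simp_all
qed

section \<open>Compactly supported functions\<close>

text \<open>Urysohn's lemma in a locally compact Hausdorff space. A finite cover of \<open>L\<close>
  gives an open \<open>W\<close> and a compact \<open>M\<close> with \<open>W\<close> inside
  \<open>M\<close> inside \<open>U\<close>; a function vanishing off \<open>W\<close> has its closed
  support in \<open>M\<close>, hence compact and inside \<open>U\<close>.\<close>

lemma locally_compact_bump:
  fixes L U :: "'a::t2_space set"
  assumes "locally compact (UNIV :: 'a set)" "compact L" "open U" "L \<subseteq> U"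
  obtains h :: "'a \<Rightarrow> real" where "continuous_on UNIV h" "\<And>x. 0 \<le> h x" "\<And>x. h x \<le> 1"
    "\<And>x. x \<in> L \<Longrightarrow> h x = 1" "compact (closure {x. h x \<noteq> 0})" "closure {x. h x \<noteq> 0} \<subseteq> U"
proof -
  have nbhd: "\<exists>V K. open V \<and> compact K \<and> x \<in> V \<and> V \<subseteq> K \<and> K \<subseteq> W" if "open W" "x \<in> W" for x :: 'a and W
    using assms(1) that unfolding locally_def by (simp add: openin_open)
  have Haus: "Hausdorff_space (euclidean :: 'a topology)"
    unfolding Hausdorff_space_def disjnt_def by simp (metis hausdorff)
  have lc: "locally_compact_space (euclidean :: 'a topology)"
    unfolding locally_compact_space_def using nbhd[OF open_UNIV] by auto
  have cr: "completely_regular_space (euclidean :: 'a topology)"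
    using locally_compact_regular_imp_completely_regular_space lc Haus by blast
  obtain V K where VK: "\<And>x. x \<in> L \<Longrightarrow> open (V x) \<and> compact (K x) \<and> x \<in> V x \<and> V x \<subseteq> K x \<and> K x \<subseteq> U"
    using nbhd[OF assms(3)] assms(4) by (metis subsetD)
  obtain J where J: "J \<subseteq> L" "finite J" "L \<subseteq> (\<Union>x\<in>J. V x)"
    using compactE_image[OF assms(2), of L V] VK by (metis UN_I subsetI)
  define W where "W = (\<Union>x\<in>J. V x)"
  define M where "M = (\<Union>x\<in>J. K x)"
  have WM: "open W" "compact M" "L \<subseteq> W" "W \<subseteq> M" "M \<subseteq> U"
    using J VK unfolding W_def M_def by (auto intro!: compact_UN) (meson subsetD)+
  obtain f :: "'a \<Rightarrow> real" where f: "continuous_map euclidean (top_of_set {0..1}) f" "f ` L \<subseteq> {1}" "f ` (- W) \<subseteq> {0}"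
    by (rule Urysohn_completely_regular_compact_closed[OF zero_le_one cr, of L "- W"])
      (use assms(2) WM in \<open>auto simp: disjnt_def\<close>)
  show thesis
  proof (rule that[of f])
    show "continuous_on UNIV f" using f(1) by (simp add: continuous_map_in_subtopology)
    show "0 \<le> f x" "f x \<le> 1" for x
      using f(1) by (auto simp: continuous_map_in_subtopology Pi_iff)
    show "f x = 1" if "x \<in> L" for x using f(2) that by auto
    have "{x. f x \<noteq> 0} \<subseteq> M" using f(3) WM(4) by auto
    then have "closure {x. f x \<noteq> 0} \<subseteq> M"
      by (rule closure_minimal) (rule compact_imp_closed[OF WM(2)])
    then show "compact (closure {x. f x \<noteq> 0})" "closure {x. f x \<noteq> 0} \<subseteq> U"
      using WM compact_Int_closed[OF WM(2) closed_closure, of "{x. f x \<noteq> 0}"]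
      by (auto simp: Int_absorb1)
  qed
qed

lemma CcI:
  fixes f :: "'g::t2_space \<Rightarrow> complex"
  assumes "continuous_on UNIV f" "compact K" "\<And>\<gamma>. \<gamma> \<notin> K \<Longrightarrow> f \<gamma> = 0"
  shows "f \<in> Cc"
proof -
  have "closure {\<gamma>. f \<gamma> \<noteq> 0} \<subseteq> K"
    by (rule closure_minimal) (use assms compact_imp_closed in auto)
  then show ?thesis
    using assms compact_Int_closed[OF assms(2) closed_closure, of "{\<gamma>. f \<gamma> \<noteq> 0}"]
    by (simp add: Cc_def Int_absorb1)
qed

lemma CcD: "f \<in> Cc \<Longrightarrow> continuous_on UNIV f" "f \<in> Cc \<Longrightarrow> compact (closure {\<gamma>. f \<gamma> \<noteq> 0})"
  by (simp_all add: Cc_def)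

lemma not_in_support: "\<gamma> \<notin> closure {\<gamma>. f \<gamma> \<noteq> 0} \<Longrightarrow> f \<gamma> = 0"
  using closure_subset[of "{\<gamma>. f \<gamma> \<noteq> 0}"] by auto

lemma Cc_add:
  fixes f g :: "'g::t2_space \<Rightarrow> complex"
  assumes "f \<in> Cc" "g \<in> Cc" shows "(\<lambda>\<gamma>. f \<gamma> + g \<gamma>) \<in> Cc"
proof (rule CcI[of _ "closure {\<gamma>. f \<gamma> \<noteq> 0} \<union> closure {\<gamma>. g \<gamma> \<noteq> 0}"])
  show "compact (closure {\<gamma>. f \<gamma> \<noteq> 0} \<union> closure {\<gamma>. g \<gamma> \<noteq> 0})"
    by (intro compact_Un CcD assms)
  show "continuous_on UNIV (\<lambda>\<gamma>. f \<gamma> + g \<gamma>)"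
    by (rule continuous_on_add[OF assms[THEN CcD(1)]])
  show "f \<gamma> + g \<gamma> = 0" if "\<gamma> \<notin> closure {\<gamma>. f \<gamma> \<noteq> 0} \<union> closure {\<gamma>. g \<gamma> \<noteq> 0}" for \<gamma>
    using not_in_support[of \<gamma> f] not_in_support[of \<gamma> g] that by simp
qed

lemma Cc_mult:
  fixes f g :: "'g::t2_space \<Rightarrow> complex"
  assumes "f \<in> Cc" "continuous_on UNIV g" shows "(\<lambda>\<gamma>. g \<gamma> * f \<gamma>) \<in> Cc"
proof (rule CcI[of _ "closure {\<gamma>. f \<gamma> \<noteq> 0}"])
  show "compact (closure {\<gamma>. f \<gamma> \<noteq> 0})"
    by (rule CcD(2)[OF assms(1)])
  show "continuous_on UNIV (\<lambda>\<gamma>. g \<gamma> * f \<gamma>)"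
    by (rule continuous_on_mult[OF assms(2) CcD(1)[OF assms(1)]])
  show "g \<gamma> * f \<gamma> = 0" if "\<gamma> \<notin> closure {\<gamma>. f \<gamma> \<noteq> 0}" for \<gamma>
    using not_in_support[OF that] by simp
qed

lemma Cc_diff:
  fixes f g :: "'g::t2_space \<Rightarrow> complex"
  assumes "f \<in> Cc" "g \<in> Cc" shows "(\<lambda>\<gamma>. f \<gamma> - g \<gamma>) \<in> Cc"
proof -
  have "(\<lambda>\<gamma>. -1 * g \<gamma>) \<in> Cc"
    by (rule Cc_mult[OF assms(2)]) (rule continuous_on_const)
  from Cc_add[OF assms(1) this] show ?thesis by simp
qed

lemma Cc_bounded:
  assumes "f \<in> Cc"
  obtains b where "b \<ge> 0" "\<And>\<gamma>. cmod (f \<gamma>) \<le> b"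
proof -
  have "compact (f ` closure {\<gamma>. f \<gamma> \<noteq> 0})"
    by (rule compact_continuous_image) (use CcD[OF assms] continuous_on_subset in auto)
  then obtain b where b: "\<And>\<gamma>. \<gamma> \<in> closure {\<gamma>. f \<gamma> \<noteq> 0} \<Longrightarrow> cmod (f \<gamma>) \<le> b"
    using compact_imp_bounded bounded_iff by (metis (no_types, lifting) image_eqI)
  have "cmod (f \<gamma>) \<le> max b 0" for \<gamma>
    using b[of \<gamma>] not_in_support[of \<gamma> f] by (cases "\<gamma> \<in> closure {\<gamma>. f \<gamma> \<noteq> 0}") auto
  then show thesis using that[of "max b 0"] by simp
qed

section \<open>Functions supported in bisections and induction over \<open>Cc\<close>\<close>

text \<open>The continuous section \<open>c\<close> of the source map is kept, not only injectivity
  on \<open>U\<close>: along it the restriction of \<open>f\<close> to the fibre over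
  \<open>x\<close> is a multiple of the point mass at \<open>c x\<close>, and this point varies
  continuously with \<open>x\<close>. The closed support is required to lie in \<open>U\<close> so
  that \<open>f\<close> vanishes near the boundary of \<open>U\<close>.\<close>

definition bisection_supported :: "'g::topological_space groupoid \<Rightarrow> ('g \<Rightarrow> complex) \<Rightarrow> bool" where
  "bisection_supported G f \<longleftrightarrow> f \<in> Cc \<and> (\<exists>U Y c. open U \<and> open Y \<and> src G ` U = Y \<inter> units G
     \<and> continuous_on (src G ` U) c \<and> (\<forall>\<alpha>\<in>U. c (src G \<alpha>) = \<alpha>) \<and> closure {\<gamma>. f \<gamma> \<noteq> 0} \<subseteq> U)"

lemma bisection_supported_Cc: "bisection_supported G f \<Longrightarrow> f \<in> Cc"
  by (simp add: bisection_supported_def)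

lemma bisection_supported_inj:
  "bisection_supported G f \<Longrightarrow> f \<alpha> \<noteq> 0 \<Longrightarrow> f \<beta> \<noteq> 0 \<Longrightarrow> src G \<alpha> = src G \<beta> \<Longrightarrow> \<alpha> = \<beta>"
  unfolding bisection_supported_def using not_in_support[of _ f] by (metis subsetD)

lemma fibre_iff: "\<gamma> \<in> fibre G x \<longleftrightarrow> src G \<gamma> = x"
  by (simp add: fibre_def)

lemma (in groupoid) units_iff: "x \<in> units G \<longleftrightarrow> src G x = x"
  unfolding units_def by (metis rangeE rangeI src_rng rng_src)

lemma (in groupoid) src_units [simp]: "src G \<gamma> \<in> units G"
  by (simp add: units_iff src_src)

lemma (in groupoid) fibre_empty: "x \<notin> units G \<Longrightarrow> fibre G x = {}"
  by (auto simp: fibre_def)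

context lc_etale_groupoid
begin

text \<open>Real nonnegative values allow finitely many of these functions to be summed without
  cancellation, as the partition of unity in \<open>Cc_induct\<close> requires.\<close>

lemma bisection_supported_bump:
  obtains h :: "'g \<Rightarrow> complex" where "bisection_supported G h" "h \<gamma> = 1"
    "\<And>\<alpha>. h \<alpha> = complex_of_real (Re (h \<alpha>))" "\<And>\<alpha>. 0 \<le> Re (h \<alpha>)"
proof -
  obtain U Y c where U: "open U" "\<gamma> \<in> U" "open Y" "src G ` U = Y \<inter> units G"
    "continuous_on (src G ` U) c" "\<forall>\<alpha>\<in>U. c (src G \<alpha>) = \<alpha>"
    by (rule src_section[of \<gamma>]) blast
  obtain h :: "'g \<Rightarrow> real" where h: "continuous_on UNIV h" "\<And>x. 0 \<le> h x"
    "\<And>x. x \<in> {\<gamma>} \<Longrightarrow> h x = 1" "compact (closure {x. h x \<noteq> 0})" "closure {x. h x \<noteq> 0} \<subseteq> U"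
    by (rule locally_compact_bump[OF locally_compact, of "{\<gamma>}" U]) (use U in auto)
  show thesis
  proof (rule that[of "\<lambda>x. complex_of_real (h x)"])
    show "bisection_supported G (\<lambda>x. complex_of_real (h x))"
      unfolding bisection_supported_def
    proof
      show "(\<lambda>x. complex_of_real (h x)) \<in> Cc"
        using h(1,4) by (simp add: Cc_def continuous_on_of_real)
      have "closure {\<gamma>. complex_of_real (h \<gamma>) \<noteq> 0} \<subseteq> U"
        using h(5) by simp
      then show "\<exists>U Y c. open U \<and> open Y \<and> src G ` U = Y \<inter> units G \<and> continuous_on (src G ` U) c \<and>
          (\<forall>\<alpha>\<in>U. c (src G \<alpha>) = \<alpha>) \<and> closure {\<gamma>. complex_of_real (h \<gamma>) \<noteq> 0} \<subseteq> U"
        using U(1,3,4,5,6) by (intro exI conjI)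
    qed
  qed (use h in auto)
qed

text \<open>A partition of unity on the support reduces everything to functions supported in bisections.\<close>

lemma Cc_induct [consumes 1, case_names bisection add]:
  assumes \<xi>: "\<xi> \<in> Cc"
    and bis: "\<And>f. bisection_supported G f \<Longrightarrow> P f"
    and add: "\<And>f g. f \<in> Cc \<Longrightarrow> g \<in> Cc \<Longrightarrow> P f \<Longrightarrow> P g \<Longrightarrow> P (\<lambda>\<gamma>. f \<gamma> + g \<gamma>)"
  shows "P \<xi>"
proof -
  let ?K = "closure {\<gamma>. \<xi> \<gamma> \<noteq> 0}"
  have "\<exists>h. bisection_supported G h \<and> h p = 1 \<and> (\<forall>\<alpha>. h \<alpha> = complex_of_real (Re (h \<alpha>)) \<and> 0 \<le> Re (h \<alpha>))" for p
    by (rule bisection_supported_bump[of p]) blast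
  then obtain h where h: "\<And>p. bisection_supported G (h p)" "\<And>p. h p p = 1"
    "\<And>p \<alpha>. h p \<alpha> = complex_of_real (Re (h p \<alpha>))" "\<And>p \<alpha>. 0 \<le> Re (h p \<alpha>)"
    by metis
  have hc: "continuous_on UNIV (h p)" for p
    using CcD(1)[OF bisection_supported_Cc[OF h(1)]] .
  have "open {\<alpha>. Re (h p \<alpha>) > 1/2}" for p
    by (intro open_Collect_less continuous_intros hc)
  then obtain J where J: "J \<subseteq> ?K" "finite J" "?K \<subseteq> (\<Union>p\<in>J. {\<alpha>. Re (h p \<alpha>) > 1/2})"
    using compactE_image[OF CcD(2)[OF \<xi>], of ?K "\<lambda>p. {\<alpha>. Re (h p \<alpha>) > 1/2}"] h(2)
    by (smt (verit, ccfv_threshold) UN_I mem_Collect_eq one_complex.sel(1) subsetI field_sum_of_halves)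
  define H where "H = (\<lambda>\<alpha>. \<Sum>p\<in>J. Re (h p \<alpha>))"
  \<comment> \<open>On the support of \<open>\<xi>\<close> some summand of \<open>H\<close> exceeds
    1/2, so there the maximum is just \<open>H\<close>. Elsewhere the cut at 1/2 only keeps the
    denominator away from 0, which makes the quotient continuous everywhere.\<close>
  define D where "D = (\<lambda>\<alpha>. complex_of_real (max (H \<alpha>) (1/2)))"
  have Dc: "continuous_on UNIV D" unfolding D_def H_def
    by (intro continuous_intros hc)
  have D0: "D \<alpha> \<noteq> 0" for \<alpha> unfolding D_def by simp
  define f where "f = (\<lambda>p \<alpha>. (\<xi> \<alpha> / D \<alpha>) * h p \<alpha>)"
  have fc: "continuous_on UNIV (\<lambda>\<alpha>. \<xi> \<alpha> / D \<alpha>)"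
    by (intro continuous_intros CcD(1)[OF \<xi>] Dc) (simp add: D0)
  have fb: "bisection_supported G (f p)" for p
  proof -
    have "closure {\<gamma>. f p \<gamma> \<noteq> 0} \<subseteq> closure {\<gamma>. h p \<gamma> \<noteq> 0}"
      by (rule closure_mono) (auto simp: f_def)
    then show ?thesis
      using h(1)[of p] Cc_mult[OF bisection_supported_Cc[OF h(1)] fc, of p]
      unfolding bisection_supported_def f_def by (meson order_trans)
  qed
  have P: "P (\<lambda>\<alpha>. \<Sum>p\<in>F. f p \<alpha>) \<and> (\<lambda>\<alpha>. \<Sum>p\<in>F. f p \<alpha>) \<in> Cc" if "finite F" for F
    using that
  proof (induction F rule: finite_induct)
    case empty
    \<comment> \<open>The induction rule has no case for the zero function, so the empty sum is
      treated as a function supported in a bisection.\<close>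
    have "bisection_supported G (\<lambda>_. 0)"
      using src_section unfolding bisection_supported_def Cc_def by simp metis
    then show ?case using bis bisection_supported_Cc by auto
  next
    case (insert p F)
    then show ?case
      using add[of "f p"] bis[OF fb] Cc_add[of "f p"] bisection_supported_Cc[OF fb] by simp
  qed
  have "\<xi> \<alpha> = (\<Sum>p\<in>J. f p \<alpha>)" for \<alpha>
  proof (cases "\<alpha> \<in> ?K")
    case True
    then obtain p where p: "p \<in> J" "Re (h p \<alpha>) > 1/2" using J(3) by auto
    have "Re (h p \<alpha>) \<le> H \<alpha>"
      unfolding H_def using J(2) p(1) h(4) by (intro member_le_sum) auto
    then have "D \<alpha> = complex_of_real (H \<alpha>)" using p(2) by (simp add: D_def max_def)
    also have "\<dots> = (\<Sum>p\<in>J. h p \<alpha>)"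
      unfolding H_def of_real_sum using h(3) by simp
    finally have "D \<alpha> = (\<Sum>p\<in>J. h p \<alpha>)" .
    moreover have "(\<Sum>p\<in>J. f p \<alpha>) = \<xi> \<alpha> / D \<alpha> * (\<Sum>p\<in>J. h p \<alpha>)"
      by (simp add: f_def sum_distrib_left)
    ultimately show ?thesis using D0[of \<alpha>] by simp
  next
    case False
    from not_in_support[OF this] show ?thesis by (simp add: f_def)
  qed
  then have "\<xi> = (\<lambda>\<alpha>. \<Sum>p\<in>J. f p \<alpha>)" by blast
  then show ?thesis using P[OF J(2)] by simp
qed

lemma continuous_rng: "continuous_on UNIV (rng G)"
proof -
  have "continuous_on UNIV (\<lambda>\<gamma>. src G (ginv G \<gamma>))"
    by (rule continuous_on_compose2[OF continuous_src continuous_inv]) simp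
  then show ?thesis by (simp add: src_inv)
qed

text \<open>Composable pairs form a closed set because the space is Hausdorff, so the product set is
  a continuous image of a compact set.\<close>

lemma compact_set_mult:
  assumes "compact K" "compact L"
  shows "compact (set_mult G K L)"
proof -
  let ?D = "{p. src G (fst p) = rng G (snd p)}"
  have "closed ?D"
    by (intro closed_Collect_eq continuous_on_compose2[OF continuous_src] continuous_on_compose2[OF continuous_rng]
        continuous_intros) auto
  then have "compact ((K \<times> L) \<inter> ?D)"
    by (intro compact_Int_closed compact_Times assms)
  moreover have "continuous_on ((K \<times> L) \<inter> ?D) (\<lambda>(\<alpha>, \<beta>). \<alpha> \<cdot> \<beta>)"
    by (rule continuous_on_subset[OF continuous_mult]) auto
  moreover have "set_mult G K L = (\<lambda>(\<alpha>, \<beta>). \<alpha> \<cdot> \<beta>) ` ((K \<times> L) \<inter> ?D)"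
    unfolding set_mult_def by (force simp: image_iff)
  ultimately show ?thesis using compact_continuous_image by metis
qed

section \<open>The Hilbert module\<close>

text \<open>For \<open>x\<close> outside \<open>units G\<close> the fibre is empty and the condition
  there reads \<open>0 \<le> c\<close>; quantifying over all \<open>x\<close> thus adds nothing but
  a sign and spares a side condition.\<close>

abbreviation L2_le :: "('g \<Rightarrow> complex) \<Rightarrow> real \<Rightarrow> bool" where
  "L2_le \<xi> c \<equiv> (\<forall>x. ell2_le (fibre G x) \<xi> c)"

text \<open>A function supported in a bisection has at most one nonzero value in each fibre, so its
  fibre norms are bounded by its supremum.\<close>

lemma Cc_L2_le:
  assumes "f \<in> Cc" shows "\<exists>c. L2_le f c"
  using assms
proof (induction rule: Cc_induct)
  case (bisection f)
  obtain b where b: "b \<ge> 0" "\<And>\<gamma>. cmod (f \<gamma>) \<le> b"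
    using Cc_bounded[OF bisection_supported_Cc[OF bisection]] by blast
  have "ell2_le (fibre G x) f b" for x
  proof (cases "\<exists>\<alpha>\<in>fibre G x. f \<alpha> \<noteq> 0")
    case True
    then obtain \<alpha> where \<alpha>: "src G \<alpha> = x" "f \<alpha> \<noteq> 0" by (auto simp: fibre_iff)
    have "ell2_le (fibre G x) f (L2_set (\<lambda>\<gamma>. cmod (f \<gamma>)) {\<alpha>})"
      by (rule ell2_le_finite_support) (use \<alpha> bisection_supported_inj[OF bisection] in \<open>auto simp: fibre_iff\<close>)
    then show ?thesis
      by (rule ell2_le_mono) (use b in auto)
  next
    case False
    then have "ell2_le (fibre G x) f (L2_set (\<lambda>\<gamma>. cmod (f \<gamma>)) {})"
      by (intro ell2_le_finite_support) auto
    then show ?thesis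
      by (rule ell2_le_mono) (use b in auto)
  qed
  then show ?case by (intro exI allI)
next
  case (add f g)
  from add.IH obtain c d where "L2_le f c" "L2_le g d" by (elim exE)
  then have "L2_le (\<lambda>\<gamma>. f \<gamma> + g \<gamma>) (c + d)" by (simp add: ell2_le_add)
  then show ?case by (rule exI)
qed

lemma L2_inner_eq: "x \<in> units G \<Longrightarrow> L2_inner G \<eta> \<xi> x = ell2_inner (fibre G x) \<eta> \<xi>"
  by (simp add: L2_inner_def ell2_inner_def)

text \<open>The a priori bound makes the sums converge and the supremum range over a bounded set, so
  that neither \<open>infsum\<close> nor \<open>SUP\<close> takes a default value in
  \<open>L2_norm\<close>.\<close>

lemma L2_norm_bounds:
  assumes "L2_le d c"
  shows "L2_norm G d \<le> c" "L2_le d (L2_norm G d)"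
proof -
  let ?q = "\<lambda>x. (ell2_norm (fibre G x) d)\<^sup>2"
  have eq: "cmod (L2_inner G d d x) = ?q x" if "x \<in> units G" for x
    using ell2_inner_self[of "fibre G x" d c] assms that by (simp add: L2_inner_eq norm_power)
  have N: "L2_norm G d = sqrt (SUP x\<in>units G. ?q x)"
    unfolding L2_norm_def using eq by (simp cong: image_cong)
  have c: "0 \<le> c" using assms[rule_format] by (rule ell2_le_nonneg)
  have le: "?q x \<le> c\<^sup>2" for x
    using assms by (intro power_mono ell2_le_norm ell2_norm_nonneg) simp
  have ne: "units G \<noteq> {}" using src_units by blast
  have "(SUP x\<in>units G. ?q x) \<le> c\<^sup>2"
    using ne le by (intro cSUP_least) auto
  then show "L2_norm G d \<le> c"
    unfolding N using c by (simp add: real_le_lsqrt)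
  have bdd: "bdd_above (?q ` units G)"
    using le by (intro bdd_aboveI2)
  have up: "?q x \<le> (SUP x\<in>units G. ?q x)" if "x \<in> units G" for x
    by (rule cSUP_upper[OF that bdd])
  then have "0 \<le> (SUP x\<in>units G. ?q x)"
    using ne by (metis ex_in_conv order_trans zero_le_power2)
  then have N0: "0 \<le> L2_norm G d" by (simp add: N)
  show "L2_le d (L2_norm G d)"
  proof
    fix x
    show "ell2_le (fibre G x) d (L2_norm G d)"
    proof (cases "x \<in> units G")
      case True
      then have "ell2_norm (fibre G x) d \<le> L2_norm G d"
        unfolding N using up[OF True] by (simp add: real_le_rsqrt)
      then show ?thesis by (rule ell2_leI[OF ell2_le_summable[OF assms[rule_format]]])
    next
      case False
      then show ?thesis using N0 by (simp add: fibre_empty ell2_le_def)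
    qed
  qed
qed

text \<open>Eliminates Cauchy sequences in favour of uniform approximation by \<open>Cc\<close>. In
  one direction \<open>ell2_le_limit\<close> turns the Cauchy condition into an estimate against the
  pointwise limit; in the other, pointwise convergence is automatic because a fibre norm dominates
  every value in the fibre.\<close>

lemma L2_iff: "\<xi> \<in> L2 G \<longleftrightarrow> (\<forall>\<epsilon>>0. \<exists>f\<in>Cc. L2_le (\<lambda>\<gamma>. f \<gamma> - \<xi> \<gamma>) \<epsilon>)"
proof
  assume "\<xi> \<in> L2 G"
  then obtain f where f: "\<And>n. f n \<in> Cc" "\<And>\<gamma>. (\<lambda>n. f n \<gamma>) \<longlonglongrightarrow> \<xi> \<gamma>"
    "\<And>\<epsilon>. \<epsilon> > 0 \<Longrightarrow> \<exists>N. \<forall>m\<ge>N. \<forall>n\<ge>N. L2_norm G (\<lambda>\<gamma>. f m \<gamma> - f n \<gamma>) < \<epsilon>"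
    unfolding L2_def by blast
  show "\<forall>\<epsilon>>0. \<exists>f\<in>Cc. L2_le (\<lambda>\<gamma>. f \<gamma> - \<xi> \<gamma>) \<epsilon>"
  proof (intro allI impI)
    fix \<epsilon> :: real assume "\<epsilon> > 0"
    then obtain N where N: "\<And>m n. m \<ge> N \<Longrightarrow> n \<ge> N \<Longrightarrow> L2_norm G (\<lambda>\<gamma>. f m \<gamma> - f n \<gamma>) < \<epsilon>"
      using f(3) by blast
    have "ell2_le (fibre G x) (\<lambda>\<gamma>. f N \<gamma> - \<xi> \<gamma>) \<epsilon>" for x
    proof (rule ell2_le_limit)
      show "(\<lambda>n. f N \<gamma> - f n \<gamma>) \<longlonglongrightarrow> f N \<gamma> - \<xi> \<gamma>" for \<gamma>
        by (intro tendsto_intros f(2))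
      show "\<forall>\<^sub>F n in sequentially. ell2_le (fibre G x) (\<lambda>\<gamma>. f N \<gamma> - f n \<gamma>) \<epsilon>"
        using eventually_ge_at_top[of N]
      proof eventually_elim
        case (elim n)
        obtain c where "L2_le (\<lambda>\<gamma>. f N \<gamma> - f n \<gamma>) c"
          using Cc_L2_le[OF Cc_diff[OF f(1)[of N] f(1)[of n]]] by (rule exE)
        from L2_norm_bounds(2)[OF this] show ?case
          by (rule ell2_le_mono[OF spec[of _ x]]) (use N[OF order_refl elim] in auto)
      qed
    qed
    then show "\<exists>f\<in>Cc. L2_le (\<lambda>\<gamma>. f \<gamma> - \<xi> \<gamma>) \<epsilon>" using f(1) by blast
  qed
next
  assume "\<forall>\<epsilon>>0. \<exists>f\<in>Cc. L2_le (\<lambda>\<gamma>. f \<gamma> - \<xi> \<gamma>) \<epsilon>"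
  then have "\<forall>n. \<exists>f\<in>Cc. L2_le (\<lambda>\<gamma>. f \<gamma> - \<xi> \<gamma>) (inverse (real (Suc n)))" by simp
  then obtain f where f: "\<And>n. f n \<in> Cc" "\<And>n. L2_le (\<lambda>\<gamma>. f n \<gamma> - \<xi> \<gamma>) (inverse (real (Suc n)))"
    by metis
  show "\<xi> \<in> L2 G"
    unfolding L2_def mem_Collect_eq
  proof (intro exI[of _ f] conjI allI impI)
    fix \<epsilon> :: real assume e: "\<epsilon> > 0"
    obtain N where N: "inverse (real (Suc N)) < \<epsilon> / 2"
      using reals_Archimedean[of "\<epsilon> / 2"] e by auto
    have N': "L2_le (\<lambda>\<gamma>. f n \<gamma> - \<xi> \<gamma>) (inverse (real (Suc N)))" if "n \<ge> N" for n
    proof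
      fix x show "ell2_le (fibre G x) (\<lambda>\<gamma>. f n \<gamma> - \<xi> \<gamma>) (inverse (real (Suc N)))"
        by (rule ell2_le_mono[OF f(2)[rule_format, of x n]]) (use that in \<open>simp_all add: le_imp_inverse_le\<close>)
    qed
    show "\<exists>N. \<forall>m\<ge>N. \<forall>n\<ge>N. L2_norm G (\<lambda>\<gamma>. f m \<gamma> - f n \<gamma>) < \<epsilon>"
    proof (intro exI[of _ N] allI impI)
      fix m n assume "m \<ge> N" "n \<ge> N"
      then have "L2_le (\<lambda>\<gamma>. f m \<gamma> - f n \<gamma>) (inverse (real (Suc N)) + inverse (real (Suc N)))"
        by (intro allI ell2_le_triangle[of _ _ \<xi>] ell2_le_sym[of _ "f n"] N'[rule_format])
      from L2_norm_bounds(1)[OF this] N show "L2_norm G (\<lambda>\<gamma>. f m \<gamma> - f n \<gamma>) < \<epsilon>" by simp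
    qed
  next
    fix \<gamma>
    have "cmod (f n \<gamma> - \<xi> \<gamma>) \<le> inverse (real (Suc n))" for n
      using ell2_le_point[OF f(2)[rule_format], of \<gamma> "src G \<gamma>" n] by (simp add: fibre_iff)
    then show "(\<lambda>n. f n \<gamma>) \<longlonglongrightarrow> \<xi> \<gamma>"
      by (intro LIM_zero_cancel[OF Lim_null_comparison[OF _ LIMSEQ_inverse_real_of_nat]]) auto
  qed (rule f)
qed

lemma Cc_subset_L2: "f \<in> Cc \<Longrightarrow> f \<in> L2 G"
  unfolding L2_iff by (intro allI impI bexI[of _ f]) (auto simp: ell2_le_def L2_set_def)

text \<open>Completeness in the form used later: for the limit in \<open>gliding_hump\<close> and
  for the passage from \<open>Cc\<close> to \<open>L2 G\<close> in
  \<open>fibrewise_L2\<close>.\<close>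

lemma L2_closed:
  assumes "\<And>\<epsilon>. \<epsilon> > 0 \<Longrightarrow> \<exists>\<eta>\<in>L2 G. L2_le (\<lambda>\<gamma>. \<eta> \<gamma> - \<xi> \<gamma>) \<epsilon>"
  shows "\<xi> \<in> L2 G"
  unfolding L2_iff
proof (intro allI impI)
  fix \<epsilon> :: real assume e: "\<epsilon> > 0"
  obtain \<eta> where \<eta>: "\<eta> \<in> L2 G" "L2_le (\<lambda>\<gamma>. \<eta> \<gamma> - \<xi> \<gamma>) (\<epsilon> / 2)"
    using assms[of "\<epsilon> / 2"] e by auto
  obtain f where f: "f \<in> Cc" "L2_le (\<lambda>\<gamma>. f \<gamma> - \<eta> \<gamma>) (\<epsilon> / 2)"
    using \<eta>(1) e unfolding L2_iff by (meson half_gt_zero)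
  have "L2_le (\<lambda>\<gamma>. f \<gamma> - \<xi> \<gamma>) (\<epsilon> / 2 + \<epsilon> / 2)"
    by (intro allI ell2_le_triangle[OF f(2)[rule_format] \<eta>(2)[rule_format]])
  then show "\<exists>f\<in>Cc. L2_le (\<lambda>\<gamma>. f \<gamma> - \<xi> \<gamma>) \<epsilon>" using f(1) by auto
qed

lemma L2_bounded:
  assumes "\<xi> \<in> L2 G" shows "\<exists>c. L2_le \<xi> c"
proof -
  obtain f where f: "f \<in> Cc" "L2_le (\<lambda>\<gamma>. f \<gamma> - \<xi> \<gamma>) 1"
    using assms unfolding L2_iff by (meson zero_less_one)
  obtain c where c: "L2_le f c" using Cc_L2_le[OF f(1)] by (rule exE)
  have "ell2_le (fibre G x) (\<lambda>\<gamma>. f \<gamma> - (f \<gamma> - \<xi> \<gamma>)) (c + 1)" for x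
    by (intro ell2_le_diff) (use c f in auto)
  then show ?thesis by auto
qed

lemma L2_le_norm: "\<xi> \<in> L2 G \<Longrightarrow> L2_le \<xi> (L2_norm G \<xi>)"
  by (drule L2_bounded, erule exE, rule L2_norm_bounds(2))

lemma L2_add:
  assumes "\<xi> \<in> L2 G" "\<eta> \<in> L2 G" shows "(\<lambda>\<gamma>. \<xi> \<gamma> + \<eta> \<gamma>) \<in> L2 G"
  unfolding L2_iff
proof (intro allI impI)
  fix \<epsilon> :: real assume e: "\<epsilon> > 0"
  obtain f g where f: "f \<in> Cc" "L2_le (\<lambda>\<gamma>. f \<gamma> - \<xi> \<gamma>) (\<epsilon> / 2)"
    and g: "g \<in> Cc" "L2_le (\<lambda>\<gamma>. g \<gamma> - \<eta> \<gamma>) (\<epsilon> / 2)"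
    using assms e unfolding L2_iff by (meson half_gt_zero)
  have "L2_le (\<lambda>\<gamma>. (f \<gamma> - \<xi> \<gamma>) + (g \<gamma> - \<eta> \<gamma>)) (\<epsilon> / 2 + \<epsilon> / 2)"
    by (intro allI ell2_le_add f(2)[rule_format] g(2)[rule_format])
  then have "L2_le (\<lambda>\<gamma>. (f \<gamma> + g \<gamma>) - (\<xi> \<gamma> + \<eta> \<gamma>)) \<epsilon>" by (simp add: algebra_simps)
  then show "\<exists>f\<in>Cc. L2_le (\<lambda>\<gamma>. f \<gamma> - (\<xi> \<gamma> + \<eta> \<gamma>)) \<epsilon>" using Cc_add[OF f(1) g(1)] by (rule bexI)
qed

lemma L2_scale:
  assumes "\<xi> \<in> L2 G" shows "(\<lambda>\<gamma>. a * \<xi> \<gamma>) \<in> L2 G"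
  unfolding L2_iff
proof (intro allI impI)
  fix \<epsilon> :: real assume e: "\<epsilon> > 0"
  define \<delta> where "\<delta> = \<epsilon> / (cmod a + 1)"
  have pos: "cmod a + 1 > 0" by (simp add: add_nonneg_pos)
  have d: "\<delta> > 0" "cmod a * \<delta> \<le> \<epsilon>"
    using e pos by (simp_all add: \<delta>_def field_simps)
  obtain f where f: "f \<in> Cc" "L2_le (\<lambda>\<gamma>. f \<gamma> - \<xi> \<gamma>) \<delta>"
    using assms d(1) unfolding L2_iff by blast
  have "ell2_le (fibre G x) (\<lambda>\<gamma>. a * f \<gamma> - a * \<xi> \<gamma>) \<epsilon>" for x
    using ell2_le_scale[of "fibre G x" "\<lambda>\<gamma>. f \<gamma> - \<xi> \<gamma>" \<delta> a] f(2) d(2)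
      ell2_le_mono[of _ "\<lambda>\<gamma>. a * f \<gamma> - a * \<xi> \<gamma>" "cmod a * \<delta>" "\<lambda>\<gamma>. a * f \<gamma> - a * \<xi> \<gamma>" \<epsilon>]
    by (simp add: right_diff_distrib)
  then show "\<exists>f\<in>Cc. L2_le (\<lambda>\<gamma>. f \<gamma> - a * \<xi> \<gamma>) \<epsilon>"
    using Cc_mult[OF f(1) continuous_on_const[of _ a]] by (intro bexI allI)
qed

lemma L2_diff: "\<xi> \<in> L2 G \<Longrightarrow> \<eta> \<in> L2 G \<Longrightarrow> (\<lambda>\<gamma>. \<xi> \<gamma> - \<eta> \<gamma>) \<in> L2 G"
  using L2_add[of \<xi> "\<lambda>\<gamma>. -1 * \<eta> \<gamma>"] L2_scale[of \<eta> "-1"] by simp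

text \<open>The fibre norms dominate the supremum norm, so approximation by \<open>Cc\<close> in the
  module norm is uniform.\<close>

lemma L2_continuous:
  assumes "\<xi> \<in> L2 G" shows "continuous_on UNIV \<xi>"
proof -
  have "\<forall>n. \<exists>f\<in>Cc. L2_le (\<lambda>\<gamma>. f \<gamma> - \<xi> \<gamma>) (inverse (real (Suc n)))"
    using assms unfolding L2_iff by simp
  then obtain f where f: "\<And>n. f n \<in> Cc" "\<And>n. L2_le (\<lambda>\<gamma>. f n \<gamma> - \<xi> \<gamma>) (inverse (real (Suc n)))"
    by metis
  have le: "dist (f n \<gamma>) (\<xi> \<gamma>) \<le> inverse (real (Suc n))" for n \<gamma>
    using ell2_le_point[OF f(2)[rule_format], of \<gamma> "src G \<gamma>" n] by (simp add: fibre_iff dist_norm)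
  have "uniform_limit UNIV f \<xi> sequentially"
  proof (rule uniform_limitI)
    fix e :: real assume "e > 0"
    then have "\<forall>\<^sub>F n in sequentially. inverse (real (Suc n)) < e"
      using LIMSEQ_inverse_real_of_nat by (rule order_tendstoD(2)[rotated])
    then show "\<forall>\<^sub>F n in sequentially. \<forall>\<gamma>\<in>UNIV. dist (f n \<gamma>) (\<xi> \<gamma>) < e"
      by eventually_elim (meson le le_less_trans)
  qed
  then show ?thesis
    by (rule uniform_limit_theorem[rotated]) (auto simp: CcD(1)[OF f(1)])
qed

lemma L2_cutoff: "\<xi> \<in> L2 G \<Longrightarrow> cutoff (fibre G x) \<xi> \<in> ell2 (fibre G x)"
  by (drule L2_bounded) (auto intro: cutoff_ell2)

text \<open>Every point mass of a fibre is the restriction of an element of \<open>L2 G\<close>.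
  Operators on a single fibre can therefore be probed by global elements.\<close>

lemma peak_function:
  obtains \<zeta> where "bisection_supported G \<zeta>" "\<zeta> \<gamma> = 1" "\<zeta> \<in> L2 G" "cutoff (fibre G (src G \<gamma>)) \<zeta> = delta \<gamma>"
proof -
  obtain \<zeta> where \<zeta>: "bisection_supported G \<zeta>" "\<zeta> \<gamma> = 1"
    by (rule bisection_supported_bump)
  have "cutoff (fibre G (src G \<gamma>)) \<zeta> = delta \<gamma>"
  proof
    fix \<alpha>
    have "src G \<alpha> = src G \<gamma> \<Longrightarrow> \<alpha> \<noteq> \<gamma> \<Longrightarrow> \<zeta> \<alpha> = 0"
      using bisection_supported_inj[OF \<zeta>(1), of \<alpha> \<gamma>] \<zeta>(2) by auto
    then show "cutoff (fibre G (src G \<gamma>)) \<zeta> \<alpha> = delta \<gamma> \<alpha>"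
      using \<zeta>(2) by (cases "\<alpha> = \<gamma>") (auto simp: cutoff_def indicator_def fibre_iff)
  qed
  then show thesis using that \<zeta> Cc_subset_L2 bisection_supported_Cc by blast
qed

end

section \<open>Matrix coefficients and continuous sections\<close>

text \<open>The matrix entry in column \<open>\<alpha>\<close> and row \<open>\<beta>\<close>.
  Uncurrying makes it a function on a subset of the product space, so that continuity of a section
  of the fibre space becomes plain \<open>continuous_on\<close>.\<close>

definition coefficient :: "'g groupoid \<Rightarrow> ('g \<Rightarrow> 'g operator) \<Rightarrow> 'g \<times> 'g \<Rightarrow> complex" where
  "coefficient G T = (\<lambda>(\<alpha>, \<beta>). T (src G \<alpha>) (delta \<alpha>) \<beta>)"

definition same_src :: "'g groupoid \<Rightarrow> ('g \<times> 'g) set" where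
  "same_src G = {(\<alpha>, \<beta>). src G \<alpha> = src G \<beta>}"

lemma set_multI: "\<alpha> \<in> A \<Longrightarrow> \<beta> \<in> B \<Longrightarrow> src G \<alpha> = rng G \<beta> \<Longrightarrow> \<alpha> \<cdot>\<^bsub>G\<^esub> \<beta> \<in> set_mult G A B"
  by (auto simp: set_mult_def)

lemma continuous_on_locally_eq:
  assumes "\<And>x. x \<in> S \<Longrightarrow> \<exists>W g. open W \<and> x \<in> W \<and> continuous_on W g \<and> (\<forall>y\<in>S \<inter> W. f y = g y)"
  shows "continuous_on S f"
  unfolding continuous_on_topological
proof (intro ballI allI impI)
  fix x B assume x: "x \<in> S" and B: "open B" "f x \<in> B"
  obtain W g where W: "open W" "x \<in> W" "continuous_on W g" "\<forall>y\<in>S \<inter> W. f y = g y"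
    using assms[OF x] by blast
  have "g x \<in> B" using W(2,4) x B(2) by auto
  then obtain A where A: "open A" "x \<in> A" "\<forall>y\<in>W. y \<in> A \<longrightarrow> g y \<in> B"
    using W(2,3) B(1) unfolding continuous_on_topological by metis
  show "\<exists>A. open A \<and> x \<in> A \<and> (\<forall>y\<in>S. y \<in> A \<longrightarrow> f y \<in> B)"
    by (rule exI[of _ "A \<inter> W"]) (use A W in auto)
qed

lemma atin_top_of_set: "x \<in> S \<Longrightarrow> atin (top_of_set S) x = at x within S"
  unfolding filter_eq_iff
  by (simp add: eventually_atin eventually_at_topological openin_open) blast

context lc_etale_groupoid
begin

text \<open>From left to right the section is pulled back along the source map to
  \<open>same_src G\<close>, where the two projections supply the arrows that
  \<open>op_fibre_conv\<close> asks for. From right to left a pair of converging arrows is a path in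
  \<open>same_src G\<close>, along which \<open>coefficient\<close> is continuous.\<close>

lemma continuous_section_iff:
  assumes T: "\<And>x. x \<in> units G \<Longrightarrow> T x \<in> bounded_ops (fibre G x)"
  shows "continuous_map (top_of_set (units G)) (op_fibre_topology G) (\<lambda>x. (x, T x)) \<longleftrightarrow>
    continuous_on (same_src G) (coefficient G T)"
proof
  assume L: "continuous_map (top_of_set (units G)) (op_fibre_topology G) (\<lambda>x. (x, T x))"
  have "continuous_on (same_src G) (\<lambda>p. src G (fst p))"
    by (rule continuous_on_compose2[OF continuous_src]) (auto intro: continuous_on_fst continuous_on_id)
  then have "continuous_map (top_of_set (same_src G)) (top_of_set (units G)) (\<lambda>p. src G (fst p))"
    by (simp add: continuous_map_in_subtopology)
  from continuous_map_compose[OF this L]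
  have c: "continuous_map (top_of_set (same_src G)) (op_fibre_topology G)
      (\<lambda>p. (src G (fst p), T (src G (fst p))))"
    by (simp add: comp_def)
  show "continuous_on (same_src G) (coefficient G T)"
    unfolding continuous_on_def
  proof
    fix p0 assume p0: "p0 \<in> same_src G"
    let ?F = "at p0 within same_src G"
    have "limitin (op_fibre_topology G) (\<lambda>p. (src G (fst p), T (src G (fst p))))
        (src G (fst p0), T (src G (fst p0))) ?F"
      using c p0 unfolding continuous_map_atin by (simp add: atin_top_of_set)
    then have conv: "op_fibre_conv G (\<lambda>p. (src G (fst p), T (src G (fst p))))
        (src G (fst p0), T (src G (fst p0))) ?F"
      by (simp add: limitin_op_fibre_topology)
    have ev: "\<forall>\<^sub>F p in ?F. p \<in> same_src G" by (simp add: eventually_at_filter)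
    have "((\<lambda>p. ell2_inner (fibre G (src G (fst p))) (delta (snd p)) (T (src G (fst p)) (delta (fst p)))) \<longlongrightarrow>
      ell2_inner (fibre G (src G (fst p0))) (delta (snd p0)) (T (src G (fst p0)) (delta (fst p0)))) ?F"
    proof -
      have "(fst \<longlongrightarrow> fst p0) ?F" "(snd \<longlongrightarrow> snd p0) ?F"
        by (auto intro: tendsto_intros)
      moreover have "\<forall>\<^sub>F p in ?F. src G (fst p) = src G (fst p) \<and> src G (snd p) = src G (fst p)"
        using ev by eventually_elim (auto simp: same_src_def)
      ultimately show ?thesis
        using conv unfolding op_fibre_conv_def by auto
    qed
    moreover have inn: "ell2_inner (fibre G (src G (fst p))) (delta (snd p)) (T (src G (fst p)) (delta (fst p)))
        = coefficient G T p" if "p \<in> same_src G" for p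
      using that by (auto simp: same_src_def coefficient_def fibre_iff ell2_inner_delta_left)
    ultimately show "(coefficient G T \<longlongrightarrow> coefficient G T p0) ?F"
      using inn[OF p0] by (auto elim!: Lim_transform_eventually intro: eventually_mono[OF ev])
  qed
next
  assume R: "continuous_on (same_src G) (coefficient G T)"
  show "continuous_map (top_of_set (units G)) (op_fibre_topology G) (\<lambda>x. (x, T x))"
    unfolding continuous_map_atin
  proof
    fix x0 assume "x0 \<in> topspace (top_of_set (units G))"
    then have x0: "x0 \<in> units G" by simp
    let ?F = "at x0 within units G"
    have ev: "\<forall>\<^sub>F x in ?F. x \<in> units G" by (simp add: eventually_at_filter)
    have "op_fibre_conv G (\<lambda>x. (x, T x)) (x0, T x0) ?F"
      unfolding op_fibre_conv_def fst_conv snd_conv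
    proof (intro conjI allI impI)
      show "(x0, T x0) \<in> op_fibre_space G" using x0 T by (simp add: op_fibre_space_def)
      show "\<forall>\<^sub>F x in ?F. (x, T x) \<in> op_fibre_space G"
        using ev by eventually_elim (simp add: T op_fibre_space_def)
      show "((\<lambda>x. x) \<longlongrightarrow> x0) ?F" by (rule tendsto_ident_at)
      fix g' g'' \<gamma>' \<gamma>''
      assume g: "(g' \<longlongrightarrow> \<gamma>') ?F" "(g'' \<longlongrightarrow> \<gamma>'') ?F"
        and s: "\<forall>\<^sub>F x in ?F. src G (g' x) = x \<and> src G (g'' x) = x"
      show "((\<lambda>x. ell2_inner (fibre G x) (delta (g'' x)) (T x (delta (g' x)))) \<longlongrightarrow>
          ell2_inner (fibre G x0) (delta \<gamma>'') (T x0 (delta \<gamma>'))) ?F"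
      proof (cases "?F = bot")
        case False
        \<comment> \<open>\<open>op_fibre_conv\<close> does not ask that the limit arrows lie over
          \<open>x0\<close>. This follows from continuity of the source and uniqueness of limits,
          for which the filter must be proper; at an isolated unit it is \<open>bot\<close> and
          there is nothing to show.\<close>
        have lim: "src G \<gamma> = x0" if "(h \<longlongrightarrow> \<gamma>) ?F" "\<forall>\<^sub>F x in ?F. src G (h x) = x" for h \<gamma>
        proof -
          have "((\<lambda>x. src G (h x)) \<longlongrightarrow> src G \<gamma>) ?F"
            using continuous_on_tendsto_compose[OF continuous_src that(1)] by simp
          then have "((\<lambda>x. x) \<longlongrightarrow> src G \<gamma>) ?F"
            using tendsto_cong[OF that(2)] by simp
          then show ?thesis using False tendsto_unique tendsto_ident_at by blast
        qed
        have s0: "src G \<gamma>' = x0" "src G \<gamma>'' = x0"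
          using lim[OF g(1)] lim[OF g(2)] s by (auto simp: eventually_conj_iff)
        have "((\<lambda>x. coefficient G T (g' x, g'' x)) \<longlongrightarrow> coefficient G T (\<gamma>', \<gamma>'')) ?F"
          by (rule continuous_on_tendsto_compose[OF R])
            (use g s0 s in \<open>auto intro: tendsto_Pair simp: same_src_def elim!: eventually_mono\<close>)
        moreover have "\<forall>\<^sub>F x in ?F. coefficient G T (g' x, g'' x) = ell2_inner (fibre G x) (delta (g'' x)) (T x (delta (g' x)))"
          using s by eventually_elim (simp add: coefficient_def fibre_iff ell2_inner_delta_left)
        ultimately show ?thesis
          using s0 by (simp add: coefficient_def fibre_iff ell2_inner_delta_left Lim_transform_eventually)
      qed simp
    qed
    then show "limitin (op_fibre_topology G) (\<lambda>x. (x, T x)) (x0, T x0) (atin (top_of_set (units G)) x0)"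
      using x0 by (simp add: atin_top_of_set limitin_op_fibre_topology)
  qed
qed

section \<open>Slices of adjointable operators are continuous and quasi-local\<close>

lemma slices_coefficient_continuous:
  assumes T: "\<And>x. x \<in> units G \<Longrightarrow> T x \<in> bounded_ops (fibre G x)"
    and S: "\<And>\<xi>. \<xi> \<in> L2 G \<Longrightarrow> S \<xi> \<in> L2 G"
    and TS: "\<And>x \<xi>. x \<in> units G \<Longrightarrow> \<xi> \<in> L2 G \<Longrightarrow> T x (cutoff (fibre G x) \<xi>) = cutoff (fibre G x) (S \<xi>)"
  shows "continuous_on (same_src G) (coefficient G T)"
proof (rule continuous_on_locally_eq)
  fix p assume p: "p \<in> same_src G"
  obtain \<zeta> where \<zeta>: "bisection_supported G \<zeta>" "\<zeta> (fst p) = 1" "\<zeta> \<in> L2 G"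
    using peak_function[of "fst p"] by metis
  define W where "W = {q::'g \<times> 'g. \<zeta> (fst q) \<noteq> 0}"
  \<comment> \<open>On the fibre of an arrow \<open>\<alpha>\<close> in the support,
    \<open>\<zeta>\<close> is \<open>\<zeta> \<alpha>\<close> times the point mass at
    \<open>\<alpha>\<close>. Dividing by this factor expresses all columns near
    \<open>fst p\<close>, not only the one where \<open>\<zeta>\<close> is 1, through the single
    continuous function \<open>S \<zeta>\<close>.\<close>
  define f where "f = (\<lambda>q. S \<zeta> (snd q) / \<zeta> (fst q))"
  have c\<zeta>: "continuous_on V (\<lambda>q. \<zeta> (fst q))" for V :: "('g \<times> 'g) set"
    by (rule continuous_on_compose2[OF L2_continuous[OF \<zeta>(3)]]) (auto intro: continuous_on_fst continuous_on_id)
  have cS: "continuous_on V (\<lambda>q. S \<zeta> (snd q))" for V :: "('g \<times> 'g) set"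
    by (rule continuous_on_compose2[OF L2_continuous[OF S[OF \<zeta>(3)]]]) (auto intro: continuous_on_snd continuous_on_id)
  have "open W" unfolding W_def by (rule open_Collect_neq[OF c\<zeta> continuous_on_const])
  moreover have "p \<in> W" using \<zeta>(2) by (simp add: W_def)
  moreover have "continuous_on W f"
    unfolding f_def by (rule continuous_on_divide[OF cS c\<zeta>]) (simp add: W_def)
  moreover have "coefficient G T q = f q" if q: "q \<in> same_src G \<inter> W" for q
  proof -
    obtain \<alpha> \<beta> where ab: "q = (\<alpha>, \<beta>)" "src G \<beta> = src G \<alpha>" "\<zeta> \<alpha> \<noteq> 0"
      using q by (auto simp: same_src_def W_def)
    have "cutoff (fibre G (src G \<alpha>)) \<zeta> = (\<lambda>\<gamma>. \<zeta> \<alpha> * delta \<alpha> \<gamma>)"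
    proof
      fix \<gamma>
      have "\<zeta> \<gamma> = 0" if "src G \<gamma> = src G \<alpha>" "\<gamma> \<noteq> \<alpha>"
        using bisection_supported_inj[OF \<zeta>(1) _ ab(3) that(1)] that(2) by blast
      then show "cutoff (fibre G (src G \<alpha>)) \<zeta> \<gamma> = \<zeta> \<alpha> * delta \<alpha> \<gamma>"
        by (cases "\<gamma> = \<alpha>") (auto simp: cutoff_def indicator_def fibre_iff)
    qed
    then have "(\<lambda>\<gamma>. \<zeta> \<alpha> * T (src G \<alpha>) (delta \<alpha>) \<gamma>) = cutoff (fibre G (src G \<alpha>)) (S \<zeta>)"
      using TS[OF src_units \<zeta>(3), of \<alpha>] bounded_ops_scale[OF T[OF src_units] delta_ell2, of \<alpha> \<alpha> "\<zeta> \<alpha>"]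
      by (simp add: fibre_iff)
    from fun_cong[OF this, of \<beta>] show ?thesis
      using ab by (simp add: f_def coefficient_def cutoff_def fibre_iff field_simps)
  qed
  ultimately show "\<exists>W f. open W \<and> p \<in> W \<and> continuous_on W f \<and> (\<forall>q\<in>same_src G \<inter> W. coefficient G T q = f q)"
    by blast
qed

text \<open>If \<open>\<eta>\<close> in \<open>Cc\<close> approximates \<open>S f\<close>, then
  \<open>K\<close> is the support of \<open>\<eta>\<close> times the inverse of the support of
  \<open>f\<close>. For \<open>\<beta>\<close> in \<open>B\<close> with
  \<open>f \<beta> \<noteq> 0\<close>, the part of the support of \<open>\<eta>\<close> in the fibre
  lies in \<open>K B\<close>, hence misses \<open>A\<close>, and on \<open>A\<close> only the error
  of approximation remains. The lemma is stated for a pair \<open>T\<close>, \<open>S\<close> linked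
  by restriction so that it also applies to the adjoint family and \<open>R\<close>.\<close>

lemma slices_quasi_local:
  assumes T: "\<And>x. x \<in> units G \<Longrightarrow> T x \<in> bounded_ops (fibre G x)"
    and S: "\<And>\<xi>. \<xi> \<in> L2 G \<Longrightarrow> S \<xi> \<in> L2 G"
    and TS: "\<And>x \<xi>. x \<in> units G \<Longrightarrow> \<xi> \<in> L2 G \<Longrightarrow> T x (cutoff (fibre G x) \<xi>) = cutoff (fibre G x) (S \<xi>)"
  shows "quasi_local G T"
proof -
  \<comment> \<open>With \<open>ell2_le\<close> and a non-strict bound, quasi-locality adds up under
    sums of functions. The strict inequality in \<open>quasi_local\<close> is recovered at the end
    by halving \<open>\<epsilon>\<close>.\<close>
  define Q where "Q = (\<lambda>\<xi> \<epsilon> K. \<forall>x\<in>units G. \<forall>A B. A \<subseteq> fibre G x \<longrightarrow> B \<subseteq> fibre G x \<longrightarrow>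
    A \<inter> set_mult G K B = {} \<longrightarrow>
    ell2_le (fibre G x) (cutoff A (T x (cutoff B (cutoff (fibre G x) \<xi>)))) \<epsilon>)"
  have "\<forall>\<epsilon>>0. \<exists>K. compact K \<and> Q \<xi> \<epsilon> K" if "\<xi> \<in> Cc" for \<xi>
    using that
  proof (induction rule: Cc_induct)
    case (bisection f)
    have fL: "f \<in> L2 G" using Cc_subset_L2 bisection_supported_Cc[OF bisection] by blast
    show ?case
    proof (intro allI impI)
      fix \<epsilon> :: real assume e: "\<epsilon> > 0"
      obtain \<eta> where \<eta>: "\<eta> \<in> Cc" "L2_le (\<lambda>\<gamma>. \<eta> \<gamma> - S f \<gamma>) \<epsilon>"
        using S[OF fL] e unfolding L2_iff by blast
      \<comment> \<open>Since \<open>f\<close> is supported in a bisection, cutting it off in a fibre by \<open>B\<close> leaves all of it or nothing.\<close>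
      define K where "K = set_mult G (closure {\<gamma>. \<eta> \<gamma> \<noteq> 0}) (ginv G ` closure {\<gamma>. f \<gamma> \<noteq> 0})"
      have "compact (ginv G ` closure {\<gamma>. f \<gamma> \<noteq> 0})"
        by (rule compact_continuous_image[OF continuous_on_subset[OF continuous_inv]])
          (use CcD(2)[OF bisection_supported_Cc[OF bisection]] in auto)
      then have "compact K"
        unfolding K_def by (rule compact_set_mult[OF CcD(2)[OF \<eta>(1)]])
      moreover have "Q f \<epsilon> K"
        unfolding Q_def
      proof (intro ballI allI impI)
        fix x A B
        assume x: "x \<in> units G" and AB: "A \<subseteq> fibre G x" "B \<subseteq> fibre G x" "A \<inter> set_mult G K B = {}"
        show "ell2_le (fibre G x) (cutoff A (T x (cutoff B (cutoff (fibre G x) f)))) \<epsilon>"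
        proof (cases "\<exists>\<beta>\<in>B. f \<beta> \<noteq> 0")
          case False
          then have "cutoff B (cutoff (fibre G x) f) = (\<lambda>_. 0)"
            by (auto simp: cutoff_def indicator_def)
          then have z: "cutoff A (T x (cutoff B (cutoff (fibre G x) f))) = (\<lambda>_. 0)"
            using bounded_ops_zero[OF T[OF x]] by (auto simp: cutoff_def)
          show ?thesis unfolding z using e by (simp add: ell2_le_def L2_set_def)
        next
          case True
          then obtain \<beta> where \<beta>: "\<beta> \<in> B" "f \<beta> \<noteq> 0" by blast
          have s: "src G \<beta> = x" using \<beta>(1) AB(2) by (auto simp: fibre_iff)
          have "cutoff B (cutoff (fibre G x) f) = cutoff (fibre G x) f"
          proof
            fix \<gamma>
            have "f \<gamma> = 0" if "\<gamma> \<notin> B" "src G \<gamma> = x"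
              using bisection_supported_inj[OF bisection _ \<beta>(2), of \<gamma>] that \<beta>(1) s by auto
            then show "cutoff B (cutoff (fibre G x) f) \<gamma> = cutoff (fibre G x) f \<gamma>"
              by (auto simp: cutoff_def indicator_def fibre_iff)
          qed
          then have eq: "cutoff A (T x (cutoff B (cutoff (fibre G x) f))) = cutoff A (cutoff (fibre G x) (S f))"
            using TS[OF x fL] by simp
          \<comment> \<open>Otherwise \<open>\<gamma>\<close> factors as
            \<open>(\<gamma> \<cdot> ginv G \<beta>) \<cdot> \<beta>\<close> with first factor in
            \<open>K\<close> and second in \<open>B\<close>.\<close>
          have zero: "\<eta> \<gamma> = 0" if "\<gamma> \<in> A" for \<gamma>
          proof (rule ccontr)
            assume "\<eta> \<gamma> \<noteq> 0"
            have sg: "src G \<gamma> = x" using that AB(1) by (auto simp: fibre_iff)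
            have "\<gamma> \<in> closure {\<gamma>. \<eta> \<gamma> \<noteq> 0}" "\<beta> \<in> closure {\<gamma>. f \<gamma> \<noteq> 0}"
              using not_in_support[of \<gamma> \<eta>] not_in_support[of \<beta> f] \<open>\<eta> \<gamma> \<noteq> 0\<close> \<beta>(2) by auto
            then have k: "\<gamma> \<cdot> ginv G \<beta> \<in> K"
              unfolding K_def using s sg by (intro set_multI) (simp_all add: rng_inv)
            have "(\<gamma> \<cdot> ginv G \<beta>) \<cdot> \<beta> = \<gamma>"
              using mult_assoc[of \<gamma> "ginv G \<beta>" \<beta>] s sg by (metis inv_left rng_inv src_inv unit_right)
            moreover have "src G (\<gamma> \<cdot> ginv G \<beta>) = rng G \<beta>"
              using src_mult[of \<gamma> "ginv G \<beta>"] s sg by (simp add: src_inv rng_inv)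
            ultimately have "\<gamma> \<in> set_mult G K B"
              using set_multI[where G=G, OF k \<beta>(1)] by simp
            then show False using that AB(3) by blast
          qed
          show ?thesis
            unfolding eq
          proof (rule ell2_le_mono[OF \<eta>(2)[rule_format] _ order_refl])
            show "cmod (cutoff A (cutoff (fibre G x) (S f)) \<gamma>) \<le> cmod (\<eta> \<gamma> - S f \<gamma>)" for \<gamma>
              using zero[of \<gamma>] by (cases "\<gamma> \<in> A") (auto simp: cutoff_def indicator_def)
          qed
        qed
      qed
      ultimately show "\<exists>K. compact K \<and> Q f \<epsilon> K" by blast
    qed
  next
    case (add f g)
    show ?case
    proof (intro allI impI)
      fix \<epsilon> :: real assume e: "\<epsilon> > 0"
      obtain K where K: "compact K" "Q f (\<epsilon>/2) K" using add.IH(1) e by (meson half_gt_zero)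
      obtain L where L: "compact L" "Q g (\<epsilon>/2) L" using add.IH(2) e by (meson half_gt_zero)
      have "Q (\<lambda>\<gamma>. f \<gamma> + g \<gamma>) \<epsilon> (K \<union> L)"
        unfolding Q_def
      proof (intro ballI allI impI)
        fix x A B
        assume x: "x \<in> units G" and AB: "A \<subseteq> fibre G x" "B \<subseteq> fibre G x" "A \<inter> set_mult G (K \<union> L) B = {}"
        have AB': "A \<inter> set_mult G K B = {}" "A \<inter> set_mult G L B = {}"
          using AB(3) unfolding set_mult_def by blast+
        let ?c = "\<lambda>h. cutoff B (cutoff (fibre G x) h)"
        have mem: "?c h \<in> ell2 (fibre G x)" if "h \<in> Cc" for h
          by (intro cutoff_ell2' L2_cutoff Cc_subset_L2 that)
        have "?c (\<lambda>\<gamma>. f \<gamma> + g \<gamma>) = (\<lambda>\<gamma>. ?c f \<gamma> + ?c g \<gamma>)"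
          by (auto simp: cutoff_def algebra_simps)
        then have eq: "cutoff A (T x (?c (\<lambda>\<gamma>. f \<gamma> + g \<gamma>))) = (\<lambda>\<gamma>. cutoff A (T x (?c f)) \<gamma> + cutoff A (T x (?c g)) \<gamma>)"
          using bounded_ops_add[OF T[OF x] mem[OF add.hyps(1)] mem[OF add.hyps(2)]]
          by (auto simp: cutoff_def algebra_simps)
        have "ell2_le (fibre G x) (cutoff A (T x (?c f))) (\<epsilon>/2)"
          "ell2_le (fibre G x) (cutoff A (T x (?c g))) (\<epsilon>/2)"
          using K(2) L(2) x AB(1,2) AB' unfolding Q_def by simp_all
        from ell2_le_add[OF this] show "ell2_le (fibre G x) (cutoff A (T x (?c (\<lambda>\<gamma>. f \<gamma> + g \<gamma>)))) \<epsilon>"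
          unfolding eq by simp
      qed
      then show "\<exists>K. compact K \<and> Q (\<lambda>\<gamma>. f \<gamma> + g \<gamma>) \<epsilon> K"
        using compact_Un[OF K(1) L(1)] by blast
    qed
  qed
  then have main: "\<exists>K. compact K \<and> Q \<xi> \<epsilon> K" if "\<xi> \<in> Cc" "\<epsilon> > 0" for \<xi> \<epsilon>
    using that by blast
  show ?thesis
    unfolding quasi_local_def
  proof (intro allI impI ballI)
    fix \<epsilon> :: real and \<xi> :: "'g \<Rightarrow> complex" assume e: "\<epsilon> > 0" and \<xi>: "\<xi> \<in> Cc"
    obtain K where K: "compact K" "Q \<xi> (\<epsilon>/2) K"
      using main[OF \<xi>, of "\<epsilon>/2"] e by auto
    show "\<exists>K. compact K \<and> (\<forall>x\<in>units G. \<forall>A B. A \<subseteq> fibre G x \<longrightarrow> B \<subseteq> fibre G x \<longrightarrow> A \<inter> set_mult G K B = {} \<longrightarrow>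
        ell2_norm (fibre G x) (cutoff A (T x (cutoff B (cutoff (fibre G x) \<xi>)))) < \<epsilon>)"
    proof (intro exI[of _ K] conjI ballI allI impI K(1))
      fix x A B
      assume "x \<in> units G" "A \<subseteq> fibre G x" "B \<subseteq> fibre G x" "A \<inter> set_mult G K B = {}"
      then have "ell2_le (fibre G x) (cutoff A (T x (cutoff B (cutoff (fibre G x) \<xi>)))) (\<epsilon>/2)"
        using K(2) unfolding Q_def by blast
      from ell2_le_norm[OF this] e
      show "ell2_norm (fibre G x) (cutoff A (T x (cutoff B (cutoff (fibre G x) \<xi>)))) < \<epsilon>" by simp
    qed
  qed
qed

end

section \<open>Continuous quasi-local families are families of slices\<close>

context lc_etale_groupoid
begin

text \<open>The candidate for a preimage of \<open>T\<close> under \<open>Phi\<close>: on every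
  fibre it restricts to the given operator, see \<open>cutoff_fibrewise\<close>.\<close>

definition fibrewise :: "('g \<Rightarrow> 'g operator) \<Rightarrow> 'g operator" where
  "fibrewise T \<xi> = (\<lambda>\<gamma>. T (src G \<gamma>) (cutoff (fibre G (src G \<gamma>)) \<xi>) \<gamma>)"

lemma fibrewise_eq: "\<gamma> \<in> fibre G x \<Longrightarrow> fibrewise T \<xi> \<gamma> = T x (cutoff (fibre G x) \<xi>) \<gamma>"
  by (simp add: fibrewise_def fibre_iff)

lemma cutoff_fibrewise:
  assumes "T x \<in> bounded_ops (fibre G x)" "\<xi> \<in> L2 G"
  shows "cutoff (fibre G x) (fibrewise T \<xi>) = T x (cutoff (fibre G x) \<xi>)"
proof
  fix \<gamma>
  show "cutoff (fibre G x) (fibrewise T \<xi>) \<gamma> = T x (cutoff (fibre G x) \<xi>) \<gamma>"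
    using bounded_ops_mem[OF assms(1) L2_cutoff[OF assms(2)]]
    by (cases "\<gamma> \<in> fibre G x") (auto simp: cutoff_eq fibrewise_eq ell2_def)
qed

text \<open>Two open sets cover the space. Over \<open>Y\<close> the function \<open>f\<close>
  restricts to a multiple of the point mass at \<open>s x\<close>, so the image is a value of
  \<open>f\<close> times a matrix coefficient, both taken along the continuous section
  \<open>s\<close>. The other set consists of the arrows whose source avoids the compact, hence
  closed, image of the support; there the image is 0.\<close>

lemma fibrewise_continuous:
  assumes T: "\<And>x. x \<in> units G \<Longrightarrow> T x \<in> bounded_ops (fibre G x)"
    and c: "continuous_on (same_src G) (coefficient G T)"
    and "\<xi> \<in> Cc"
  shows "continuous_on UNIV (fibrewise T \<xi>)"
  using assms(3)
proof (induction rule: Cc_induct)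
  case (bisection f)
  let ?K = "closure {\<gamma>. f \<gamma> \<noteq> 0}"
  obtain U Y s where U: "open U" "open Y" "src G ` U = Y \<inter> units G"
    "continuous_on (src G ` U) s" "\<forall>\<alpha>\<in>U. s (src G \<alpha>) = \<alpha>" "?K \<subseteq> U"
    using bisection unfolding bisection_supported_def by metis
  have s: "src G (s (src G \<gamma>)) = src G \<gamma>" "s (src G \<gamma>) \<in> U" if "src G \<gamma> \<in> src G ` U" for \<gamma>
  proof -
    obtain \<alpha> where "\<alpha> \<in> U" "src G \<gamma> = src G \<alpha>" using \<open>src G \<gamma> \<in> src G ` U\<close> by blast
    then show "src G (s (src G \<gamma>)) = src G \<gamma>" "s (src G \<gamma>) \<in> U" using U(5) by auto
  qed
  define V where "V = src G -` Y"
  have V: "open V" "\<And>\<gamma>. \<gamma> \<in> V \<longleftrightarrow> src G \<gamma> \<in> src G ` U"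
    unfolding V_def using open_vimage[OF U(2) continuous_src] U(3) by auto
  have cs: "continuous_on V (\<lambda>\<gamma>. s (src G \<gamma>))"
    by (rule continuous_on_compose2[OF U(4) continuous_on_subset[OF continuous_src]]) (use V in auto)
  have "compact (src G ` ?K)"
    by (rule compact_continuous_image[OF continuous_on_subset[OF continuous_src]])
      (use CcD(2)[OF bisection_supported_Cc[OF bisection]] in auto)
  then have "closed (src G ` ?K)" by (rule compact_imp_closed)
  then have W: "open (- (src G -` (src G ` ?K)))"
    using closed_vimage[OF _ continuous_src] by (simp add: open_Compl)
  show ?case
  proof (rule continuous_on_locally_eq)
    fix \<gamma> :: 'g
    show "\<exists>W g. open W \<and> \<gamma> \<in> W \<and> continuous_on W g \<and> (\<forall>\<alpha>\<in>UNIV \<inter> W. fibrewise T f \<alpha> = g \<alpha>)"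
    proof (cases "\<gamma> \<in> V")
      case True
      define g where "g = (\<lambda>\<alpha>. f (s (src G \<alpha>)) * coefficient G T (s (src G \<alpha>), \<alpha>))"
      have "continuous_on V (\<lambda>\<alpha>. coefficient G T (s (src G \<alpha>), \<alpha>))"
        by (rule continuous_on_compose2[OF c continuous_on_Pair[OF cs continuous_on_id]])
          (use s V in \<open>auto simp: same_src_def\<close>)
      moreover have "continuous_on V (\<lambda>\<alpha>. f (s (src G \<alpha>)))"
        by (rule continuous_on_compose2[OF CcD(1)[OF bisection_supported_Cc[OF bisection]] cs]) simp
      ultimately have "continuous_on V g"
        unfolding g_def by (rule continuous_on_mult[rotated])
      moreover have "fibrewise T f \<alpha> = g \<alpha>" if "\<alpha> \<in> V" for \<alpha>
      proof -
        let ?x = "src G \<alpha>" and ?b = "s (src G \<alpha>)"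
        have b: "src G ?b = ?x" "?b \<in> U" using s[of \<alpha>] V(2) that by auto
        have "cutoff (fibre G ?x) f = (\<lambda>\<beta>. f ?b * delta ?b \<beta>)"
        proof
          fix \<beta>
          have "f \<beta> = 0" if "src G \<beta> = ?x" "\<beta> \<noteq> ?b"
          proof -
            have "\<beta> \<notin> U" using that U(5) by metis
            then show ?thesis using not_in_support[of \<beta> f] U(6) by blast
          qed
          then show "cutoff (fibre G ?x) f \<beta> = f ?b * delta ?b \<beta>"
            using b by (cases "\<beta> = ?b") (auto simp: cutoff_def indicator_def fibre_iff)
        qed
        then show ?thesis
          using bounded_ops_scale[OF T[OF src_units] delta_ell2, of ?b \<alpha> "f ?b"] b
          by (simp add: fibrewise_def g_def coefficient_def fibre_iff)
      qed
      ultimately show ?thesis using True V(1) by (intro exI[of _ V] exI[of _ g]) simp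
    next
      case False
      have "fibrewise T f \<alpha> = 0" if "\<alpha> \<in> - (src G -` (src G ` ?K))" for \<alpha>
      proof -
        have "f \<beta> = 0" if "src G \<beta> = src G \<alpha>" for \<beta>
          using not_in_support[of \<beta> f] that \<open>\<alpha> \<in> - (src G -` (src G ` ?K))\<close>
          by (metis ComplD imageI vimageI)
        then have "cutoff (fibre G (src G \<alpha>)) f = (\<lambda>_. 0)"
          by (auto simp: cutoff_def indicator_def fibre_iff)
        then show ?thesis using bounded_ops_zero[OF T[OF src_units, of \<alpha>]] by (simp add: fibrewise_def)
      qed
      moreover have "\<gamma> \<in> - (src G -` (src G ` ?K))"
        using False V(2) U(6) by blast
      ultimately show ?thesis
        using W by (intro exI[of _ "- (src G -` (src G ` ?K))"] exI[of _ "\<lambda>_. 0"]) simp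
    qed
  qed
next
  case (add f g)
  have "fibrewise T (\<lambda>\<gamma>. f \<gamma> + g \<gamma>) = (\<lambda>\<gamma>. fibrewise T f \<gamma> + fibrewise T g \<gamma>)"
  proof
    fix \<gamma>
    let ?F = "fibre G (src G \<gamma>)"
    have "cutoff ?F (\<lambda>\<gamma>. f \<gamma> + g \<gamma>) = (\<lambda>\<gamma>. cutoff ?F f \<gamma> + cutoff ?F g \<gamma>)"
      by (auto simp: cutoff_def algebra_simps)
    then show "fibrewise T (\<lambda>\<gamma>. f \<gamma> + g \<gamma>) \<gamma> = fibrewise T f \<gamma> + fibrewise T g \<gamma>"
      using bounded_ops_add[OF T[OF src_units[of \<gamma>]] L2_cutoff[OF Cc_subset_L2[OF add.hyps(1)]]
          L2_cutoff[OF Cc_subset_L2[OF add.hyps(2)]]]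
      by (simp add: fibrewise_def)
  qed
  then show ?case using add.IH by (simp add: continuous_on_add)
qed

text \<open>For \<open>f\<close> in \<open>Cc\<close> the products with bump functions are
  continuous with compact support by \<open>fibrewise_continuous\<close>. Since \<open>C\<close>
  serves all fibres at once, approximation of \<open>\<xi>\<close> by \<open>Cc\<close> carries over
  to the images uniformly.\<close>

lemma fibrewise_L2:
  assumes T: "\<And>x. x \<in> units G \<Longrightarrow> T x \<in> bounded_ops (fibre G x)"
    and C: "C \<ge> 0" "\<And>x v. x \<in> units G \<Longrightarrow> v \<in> ell2 (fibre G x) \<Longrightarrow>
      ell2_norm (fibre G x) (T x v) \<le> C * ell2_norm (fibre G x) v"
    and c: "continuous_on (same_src G) (coefficient G T)"
    and q: "quasi_local G T"
    and \<xi>: "\<xi> \<in> L2 G"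
  shows "fibrewise T \<xi> \<in> L2 G"
proof -
  have Cc: "fibrewise T f \<in> L2 G" if f: "f \<in> Cc" for f
    unfolding L2_iff
  proof (intro allI impI)
    fix \<epsilon> :: real assume e: "\<epsilon> > 0"
    let ?S = "closure {\<gamma>. f \<gamma> \<noteq> 0}"
    from q[unfolded quasi_local_def, THEN spec[of _ \<epsilon>], THEN mp, OF e, THEN bspec, OF f]
    obtain K where K: "compact K" "\<forall>x\<in>units G. \<forall>A B. A \<subseteq> fibre G x \<longrightarrow> B \<subseteq> fibre G x \<longrightarrow>
        A \<inter> set_mult G K B = {} \<longrightarrow>
        ell2_norm (fibre G x) (cutoff A (T x (cutoff B (cutoff (fibre G x) f)))) < \<epsilon>"
      by (elim exE conjE)
    define L where "L = set_mult G K ?S"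
    have "compact L" unfolding L_def by (rule compact_set_mult[OF K(1) CcD(2)[OF f]])
    then obtain h :: "'g \<Rightarrow> real" where h: "continuous_on UNIV h" "\<And>x. 0 \<le> h x" "\<And>x. h x \<le> 1"
      "\<And>x. x \<in> L \<Longrightarrow> h x = 1" "compact (closure {x. h x \<noteq> 0})"
      by (rule locally_compact_bump[OF locally_compact _ open_UNIV subset_UNIV]) (rule that, simp_all)
    \<comment> \<open>quasi-locality makes the part of \<open>fibrewise T f\<close> off the compact set \<open>L\<close> small\<close>
    define g where "g = (\<lambda>\<gamma>. fibrewise T f \<gamma> * complex_of_real (h \<gamma>))"
    have g: "g \<in> Cc"
      unfolding g_def
      by (rule Cc_mult[OF _ fibrewise_continuous[OF T c f]])
        (use h in \<open>auto simp: Cc_def continuous_on_of_real\<close>)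
    have "ell2_le (fibre G x) (\<lambda>\<gamma>. g \<gamma> - fibrewise T f \<gamma>) \<epsilon>" for x
    proof (cases "x \<in> units G")
      case False
      then show ?thesis using e by (simp add: fibre_empty ell2_le_def)
    next
      case x: True
      \<comment> \<open>Quasi-locality is used with \<open>B\<close> the support of \<open>f\<close>
        in the fibre, so that cutting off by \<open>B\<close> changes nothing, and with
        \<open>A\<close> all of the fibre outside \<open>L\<close>. Multiplying by \<open>h\<close>
        alters values only there, and by at most their own size.\<close>
      let ?v = "cutoff (fibre G x - L) (T x (cutoff (fibre G x) f))"
      have "cutoff (fibre G x \<inter> ?S) (cutoff (fibre G x) f) = cutoff (fibre G x) f"
      proof
        fix \<gamma> show "cutoff (fibre G x \<inter> ?S) (cutoff (fibre G x) f) \<gamma> = cutoff (fibre G x) f \<gamma>"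
          using not_in_support[of \<gamma> f] by (cases "\<gamma> \<in> ?S") (auto simp: cutoff_def indicator_def)
      qed
      moreover have "(fibre G x - L) \<inter> set_mult G K (fibre G x \<inter> ?S) = {}"
        unfolding L_def set_mult_def by blast
      ultimately have "ell2_norm (fibre G x) ?v < \<epsilon>"
        using K(2)[rule_format, OF x, of "fibre G x - L" "fibre G x \<inter> ?S"] by simp
      moreover have "?v \<in> ell2 (fibre G x)"
        by (intro cutoff_ell2' bounded_ops_mem[OF T[OF x]] L2_cutoff Cc_subset_L2 f)
      ultimately have "ell2_le (fibre G x) ?v \<epsilon>"
        by (intro ell2_leI) (auto simp: ell2_def)
      then show ?thesis
      proof (rule ell2_le_mono)
        fix \<gamma> assume g: "\<gamma> \<in> fibre G x"
        show "cmod (g \<gamma> - fibrewise T f \<gamma>) \<le> cmod (?v \<gamma>)"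
        proof (cases "\<gamma> \<in> L")
          case True
          then show ?thesis using h(4) by (simp add: g_def)
        next
          case False
          have "g \<gamma> - fibrewise T f \<gamma> = complex_of_real (h \<gamma> - 1) * fibrewise T f \<gamma>"
            by (simp add: g_def algebra_simps)
          also have "cmod \<dots> \<le> 1 * cmod (fibrewise T f \<gamma>)"
            unfolding norm_mult using h(2,3)[of \<gamma>]
            by (intro mult_right_mono) (auto simp: norm_of_real simp del: of_real_diff)
          finally show ?thesis using False g by (simp add: cutoff_eq fibrewise_eq)
        qed
      qed simp
    qed
    then show "\<exists>g\<in>Cc. L2_le (\<lambda>\<gamma>. g \<gamma> - fibrewise T f \<gamma>) \<epsilon>" using g by (intro bexI[of _ g] allI)
  qed
  show ?thesis
  proof (rule L2_closed)
    fix \<epsilon> :: real assume e: "\<epsilon> > 0"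
    define \<delta> where "\<delta> = \<epsilon> / (C + 1)"
    have d: "\<delta> > 0" "C * \<delta> \<le> \<epsilon>" using e C(1) by (simp_all add: \<delta>_def field_simps)
    obtain f where f: "f \<in> Cc" "L2_le (\<lambda>\<gamma>. f \<gamma> - \<xi> \<gamma>) \<delta>"
      using \<xi> d(1) unfolding L2_iff by blast
    have "ell2_le (fibre G x) (\<lambda>\<gamma>. fibrewise T f \<gamma> - fibrewise T \<xi> \<gamma>) \<epsilon>" for x
    proof (cases "x \<in> units G")
      case False
      then show ?thesis using e by (simp add: fibre_empty ell2_le_def)
    next
      case x: True
      let ?F = "fibre G x"
      define v where "v = (\<lambda>\<gamma>. cutoff ?F f \<gamma> - cutoff ?F \<xi> \<gamma>)"
      have v: "v \<in> ell2 ?F" unfolding v_def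
        by (intro ell2_diff L2_cutoff Cc_subset_L2 f(1) \<xi>)
      have "ell2_le ?F v \<delta>"
        using f(2)[rule_format, of x] by (rule ell2_le_mono) (simp_all add: v_def cutoff_eq)
      then have "ell2_norm ?F (T x v) \<le> \<epsilon>"
        using C(2)[OF x v] mult_left_mono[OF ell2_le_norm C(1), of ?F v \<delta>] d(2) by simp
      then have "ell2_le ?F (T x v) \<epsilon>"
        using bounded_ops_mem[OF T[OF x] v] by (intro ell2_leI) (auto simp: ell2_def)
      moreover have "T x v = (\<lambda>\<gamma>. T x (cutoff ?F f) \<gamma> - T x (cutoff ?F \<xi>) \<gamma>)"
        unfolding v_def by (intro bounded_ops_diff[OF T[OF x]] L2_cutoff Cc_subset_L2 f(1) \<xi>)
      ultimately show ?thesis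
        by (simp add: fibrewise_eq cong: ell2_le_cong)
    qed
    then show "\<exists>\<eta>\<in>L2 G. L2_le (\<lambda>\<gamma>. \<eta> \<gamma> - fibrewise T \<xi> \<gamma>) \<epsilon>"
      using Cc[OF f(1)] by (intro bexI[of _ "fibrewise T f"] allI)
  qed
qed

end

section \<open>Adjointable operators have slices\<close>

text \<open>Log-convexity makes the successive ratios nondecreasing. A first ratio \<open>r\<close>
  above \<open>C\<close> would give \<open>r ^ n * a 0 \<le> a n\<close>, which outgrows
  \<open>C ^ n * c\<close> whatever \<open>c\<close> is.\<close>

lemma log_convex_ratio_le:
  fixes a :: "nat \<Rightarrow> real"
  assumes nonneg: "\<And>n. 0 \<le> a n" and convex: "\<And>n. (a (Suc n))\<^sup>2 \<le> a n * a (Suc (Suc n))"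
    and growth: "\<And>n. a n \<le> C ^ n * c" and C: "C > 0"
  shows "a 1 \<le> C * a 0"
proof (cases "a 0 = 0")
  case True
  then show ?thesis using convex[of 0] by simp
next
  case False
  then have a0: "a 0 > 0" using nonneg[of 0] by simp
  show ?thesis
  proof (rule ccontr)
    assume "\<not> a 1 \<le> C * a 0"
    then have a1: "a 1 > C * a 0" by simp
    define r where "r = a 1 / a 0"
    have r: "r > C" using a1 a0 by (simp add: r_def field_simps)
    have step: "a n > 0 \<and> a (Suc n) \<ge> r * a n" for n
    proof (induction n)
      case 0
      then show ?case using a0 by (simp add: r_def)
    next
      case (Suc n)
      have "0 < r * a n" using Suc r C by simp
      then have p: "a (Suc n) > 0" using Suc by linarith
      have "(r * a (Suc n)) * a n \<le> a (Suc n) * a (Suc n)"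
        using Suc p by (simp add: mult_ac)
      also have "\<dots> \<le> a (Suc (Suc n)) * a n"
        using convex[of n] by (simp add: power2_eq_square mult.commute)
      finally have "r * a (Suc n) \<le> a (Suc (Suc n))"
        using Suc by simp
      then show ?case using p by simp
    qed
    have low: "r ^ n * a 0 \<le> a n" for n
    proof (induction n)
      case (Suc n)
      have "r ^ Suc n * a 0 = r * (r ^ n * a 0)" by simp
      also have "\<dots> \<le> r * a n" using Suc r C by (intro mult_left_mono) auto
      also have "\<dots> \<le> a (Suc n)" using step by simp
      finally show ?case .
    qed simp
    obtain n where n: "c / a 0 < (r / C) ^ n"
      using real_arch_pow[of "r / C" "c / a 0"] r C by auto
    have "c * C ^ n < r ^ n * a 0"
      using n a0 C by (simp add: power_divide field_simps)
    then show False using low[of n] growth[of n] by (simp add: mult.commute)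
  qed
qed

context lc_etale_groupoid
begin

section \<open>Boundedness of symmetric and of adjointable operators\<close>

text \<open>A uniform boundedness argument by hand: \<open>X\<close> is a limit of sums of the unit
  vectors \<open>e n\<close> with coefficients of modulus \<open>(1/5) ^ n\<close>, each chosen to
  make its own functional large. The ratio 1/5 is small enough that everything added after step
  \<open>n\<close> undoes only half of what step \<open>n\<close> achieved.\<close>

lemma gliding_hump:
  assumes e: "\<And>n. e n \<in> L2 G" "\<And>n. L2_le (e n) 1"
    and lin: "\<And>n \<xi> \<eta> c. \<xi> \<in> L2 G \<Longrightarrow> \<eta> \<in> L2 G \<Longrightarrow> \<phi> n (\<lambda>\<gamma>. \<xi> \<gamma> + c * \<eta> \<gamma>) = \<phi> n \<xi> + c * (\<phi> n \<eta> :: complex)"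
    and bound: "\<And>n \<xi> c. \<xi> \<in> L2 G \<Longrightarrow> L2_le \<xi> c \<Longrightarrow> cmod (\<phi> n \<xi>) \<le> M n * c"
    and big: "\<And>n. M n / 2 \<le> cmod (\<phi> n (e n))"
  shows "\<exists>\<xi>\<in>L2 G. \<forall>n. (1/5) ^ n * M n / 4 \<le> cmod (\<phi> n \<xi>)"
proof -
  define Q where "Q = (\<lambda>n \<xi> \<xi>'. \<exists>s. cmod s = (1/5) ^ n \<and> \<xi>' = (\<lambda>\<gamma>. \<xi> \<gamma> + s * e n \<gamma>) \<and>
    (1/5) ^ n * M n / 2 \<le> cmod (\<phi> n \<xi>'))"
  have "\<exists>x. \<forall>n. x n \<in> L2 G \<and> Q n (x n) (x (Suc n))"
  proof (rule dependent_nat_choice)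
    show "\<exists>x. x \<in> L2 G" using e(1) by blast
    fix \<xi> n assume \<xi>: "\<xi> \<in> L2 G"
    define t where "t = complex_of_real ((1/5) ^ n)"
    have t: "cmod t = (1/5) ^ n" by (simp add: t_def norm_power)
    define z where "z = \<phi> n \<xi>"
    define w where "w = t * \<phi> n (e n)"
    have w: "(1/5) ^ n * M n / 2 \<le> cmod w"
      using mult_left_mono[OF big, of "(1/5) ^ n" n] by (simp add: w_def norm_mult t)
    \<comment> \<open>Whatever earlier humps contributed to the functional, one of the two signs of
      the new hump leaves a value of modulus at least \<open>cmod w\<close>; no bookkeeping of the
      past is required.\<close>
    have "2 * cmod w \<le> cmod (z + w) + cmod (z - w)"
      using norm_triangle_ineq4[of "z + w" "z - w"] by simp
    then have "cmod w \<le> cmod (z + w) \<or> cmod w \<le> cmod (z - w)" by linarith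
    then obtain s where s: "cmod s = (1/5) ^ n" "cmod w \<le> cmod (z + s * \<phi> n (e n))"
      using t by (auto simp: w_def intro: that[of t] that[of "- t"])
    have "(\<lambda>\<gamma>. \<xi> \<gamma> + s * e n \<gamma>) \<in> L2 G"
      by (intro L2_add L2_scale \<xi> e)
    moreover have "Q n \<xi> (\<lambda>\<gamma>. \<xi> \<gamma> + s * e n \<gamma>)"
      unfolding Q_def
      by (rule exI[of _ s]) (use s w lin[OF \<xi> e(1), of n s n] in \<open>simp add: z_def\<close>)
    ultimately show "\<exists>\<xi>'. \<xi>' \<in> L2 G \<and> Q n \<xi> \<xi>'" by blast
  qed
  then obtain x where x: "\<And>n. x n \<in> L2 G" "\<And>n. Q n (x n) (x (Suc n))" by blast
  \<comment> \<open>A partial geometric sum: 5/4 is \<open>1 / (1 - 1/5)\<close>. The factor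
    \<open>1 - (1/5) ^ k\<close> lets the induction close and is dropped afterwards.\<close>
  have incr: "L2_le (\<lambda>\<gamma>. x (n + k) \<gamma> - x n \<gamma>) (5/4 * (1/5) ^ n * (1 - (1/5) ^ k))" for n k
  proof (induction k)
    case 0
    then show ?case by (simp add: ell2_le_def L2_set_def)
  next
    case (Suc k)
    obtain s where s: "cmod s = (1/5) ^ (n + k)" "x (Suc (n + k)) = (\<lambda>\<gamma>. x (n + k) \<gamma> + s * e (n + k) \<gamma>)"
      using x(2)[of "n + k"] unfolding Q_def by blast
    have "L2_le (\<lambda>\<gamma>. (x (n + k) \<gamma> - x n \<gamma>) + s * e (n + k) \<gamma>)
        (5/4 * (1/5) ^ n * (1 - (1/5) ^ k) + cmod s * 1)"
      by (intro allI ell2_le_add ell2_le_scale Suc[rule_format] e(2)[rule_format])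
    moreover have "5/4 * (1/5) ^ n * (1 - (1/5) ^ k) + cmod s * 1 = 5/4 * (1/5) ^ n * (1 - (1/5) ^ Suc k)"
      using s(1) by (simp add: power_add algebra_simps diff_divide_distrib)
    moreover have "(\<lambda>\<gamma>. (x (n + k) \<gamma> - x n \<gamma>) + s * e (n + k) \<gamma>) = (\<lambda>\<gamma>. x (n + Suc k) \<gamma> - x n \<gamma>)"
      using s(2) by (simp add: fun_eq_iff)
    ultimately show ?case by metis
  qed
  have incr': "ell2_le (fibre G y) (\<lambda>\<gamma>. x (n + k) \<gamma> - x n \<gamma>) (5/4 * (1/5) ^ n)" for n k y
    by (rule ell2_le_mono[OF incr[rule_format, of _ n k]]) (simp_all add: mult_left_le)
  have tail0: "(\<lambda>n. 5/4 * (1/5 :: real) ^ n) \<longlonglongrightarrow> 0"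
    by (intro tendsto_mult_right_zero LIMSEQ_power_zero) simp
  have small: "\<exists>n. 5/4 * (1/5 :: real) ^ n < \<epsilon>" if "\<epsilon> > 0" for \<epsilon>
    using order_tendstoD(2)[OF tail0 that] by (auto simp: eventually_sequentially)
  have "Cauchy (\<lambda>n. x n \<gamma>)" for \<gamma>
  proof (rule CauchyI')
    fix \<epsilon> :: real assume "\<epsilon> > 0"
    then obtain N where N: "5/4 * (1/5 :: real) ^ N < \<epsilon> / 2" using small[of "\<epsilon> / 2"] by auto
    have d: "cmod (x m \<gamma> - x N \<gamma>) < \<epsilon> / 2" if "m \<ge> N" for m
      using ell2_le_point[OF incr'[of "src G \<gamma>" N "m - N"], of \<gamma>] N that by (simp add: fibre_iff)
    have "cmod (x m \<gamma> - x n \<gamma>) < \<epsilon>" if "m \<ge> N" "n > m" for m n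
      using norm_triangle_ineq4[of "x m \<gamma> - x N \<gamma>" "x n \<gamma> - x N \<gamma>"] d[of m] d[of n] that by simp
    then show "\<exists>M. \<forall>m\<ge>M. \<forall>n>m. dist (x m \<gamma>) (x n \<gamma>) < \<epsilon>" by (auto simp: dist_norm)
  qed
  then have "\<exists>l. (\<lambda>n. x n \<gamma>) \<longlonglongrightarrow> l" for \<gamma>
    using Cauchy_convergent_iff convergent_def by blast
  then obtain X where X: "\<And>\<gamma>. (\<lambda>n. x n \<gamma>) \<longlonglongrightarrow> X \<gamma>" by metis
  have tail: "ell2_le (fibre G y) (\<lambda>\<gamma>. X \<gamma> - x n \<gamma>) (5/4 * (1/5) ^ n)" for y n
  proof (rule ell2_le_limit)
    show "(\<lambda>k. x (n + k) \<gamma> - x n \<gamma>) \<longlonglongrightarrow> X \<gamma> - x n \<gamma>" for \<gamma>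
      using LIMSEQ_ignore_initial_segment[OF X[of \<gamma>], of n] by (intro tendsto_intros) (simp add: add.commute)
  qed (rule always_eventually, rule allI, rule incr')
  have XL: "X \<in> L2 G"
  proof (rule L2_closed)
    fix \<epsilon> :: real assume "\<epsilon> > 0"
    then obtain n where n: "5/4 * (1/5 :: real) ^ n < \<epsilon>" using small by blast
    show "\<exists>\<eta>\<in>L2 G. L2_le (\<lambda>\<gamma>. \<eta> \<gamma> - X \<gamma>) \<epsilon>"
      by (rule bexI[OF _ x(1)[of n]], intro allI, rule ell2_le_mono[OF ell2_le_sym[OF tail[of _ n]]])
        (use n in simp_all)
  qed
  have "(1/5) ^ n * M n / 4 \<le> cmod (\<phi> n X)" for n
  proof -
    let ?d = "\<lambda>\<gamma>. X \<gamma> - x (Suc n) \<gamma>"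
    have "\<phi> n X = \<phi> n (x (Suc n)) + \<phi> n ?d"
      using lin[OF x(1)[of "Suc n"] L2_diff[OF XL x(1)[of "Suc n"]], of n 1] by simp
    \<comment> \<open>\<open>x (Suc n)\<close> is the first iterate containing hump
      \<open>n\<close>. The tail after it is at most \<open>5/4 * (1/5) ^ Suc n\<close>, that is
      \<open>(1/5) ^ n / 4\<close>, against the lower bound
      \<open>(1/5) ^ n * M n / 2\<close>.\<close>
    moreover have "cmod (\<phi> n ?d) \<le> M n * (5/4 * (1/5) ^ Suc n)"
      by (rule bound[OF L2_diff[OF XL x(1)]]) (intro allI tail)
    moreover have "(1/5) ^ n * M n / 2 \<le> cmod (\<phi> n (x (Suc n)))"
      using x(2)[of n] unfolding Q_def by blast
    ultimately show ?thesis
      using norm_diff_ineq[of "\<phi> n (x (Suc n))" "\<phi> n ?d"]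
      by (simp add: mult.commute[of "M n"])
  qed
  then show ?thesis using XL by blast
qed

text \<open>If every fibre stayed below half of the squared norm, \<open>L2_norm G \<xi>\<close>
  would be bounded by itself times \<open>sqrt (1/2)\<close>. The factor 1/2 leaves room, so it does
  not matter whether the supremum is attained.\<close>

lemma L2_norm_approx:
  assumes "\<xi> \<in> L2 G" "L2_norm G \<xi> > 0"
  shows "\<exists>x\<in>units G. (L2_norm G \<xi>)\<^sup>2 / 2 \<le> (ell2_norm (fibre G x) \<xi>)\<^sup>2"
proof (rule ccontr)
  let ?N = "L2_norm G \<xi>"
  assume "\<not> ?thesis"
  then have less: "(ell2_norm (fibre G x) \<xi>)\<^sup>2 < ?N\<^sup>2 / 2" if "x \<in> units G" for x
    using that by (simp add: not_le)
  have "L2_le \<xi> (?N * sqrt (1/2))"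
  proof
    fix x
    show "ell2_le (fibre G x) \<xi> (?N * sqrt (1/2))"
    proof (cases "x \<in> units G")
      case True
      have "(ell2_norm (fibre G x) \<xi>)\<^sup>2 \<le> (?N * sqrt (1/2))\<^sup>2"
        using less[OF True] by (simp add: power_mult_distrib)
      then have "ell2_norm (fibre G x) \<xi> \<le> ?N * sqrt (1/2)"
        by (rule power2_le_imp_le) (use assms(2) in simp)
      then show ?thesis
        by (rule ell2_leI[OF ell2_le_summable[OF L2_le_norm[OF assms(1), rule_format]]])
    next
      case False
      then show ?thesis using assms(2) by (simp add: fibre_empty ell2_le_def)
    qed
  qed
  then have "?N \<le> ?N * sqrt (1/2)" by (rule L2_norm_bounds(1))
  moreover have "sqrt (1/2) < 1" by (simp add: real_sqrt_less_iff[of "1/2" 1, simplified])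
  ultimately show False using assms(2) by (simp add: mult_le_cancel_left1)
qed

lemma ell2_inner_L2_add_scale:
  assumes "\<zeta> \<in> L2 G" "\<xi> \<in> L2 G" "\<eta> \<in> L2 G"
  shows "ell2_inner (fibre G x) \<zeta> (\<lambda>\<gamma>. \<xi> \<gamma> + c * \<eta> \<gamma>) =
    ell2_inner (fibre G x) \<zeta> \<xi> + c * ell2_inner (fibre G x) \<zeta> \<eta>"
  using ell2_inner_add_right[OF L2_le_norm[OF assms(1), rule_format] L2_le_norm[OF assms(2), rule_format]
      ell2_le_scale[OF L2_le_norm[OF assms(3), rule_format]], of x c]
  by (simp add: ell2_inner_scale_right)

text \<open>A Hellinger--Toeplitz theorem for the module. Were \<open>P\<close> unbounded along
  \<open>\<zeta> n\<close>, a gliding hump \<open>\<xi>\<close> would make the fibre inner products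
  of \<open>P (\<zeta> n)\<close> with \<open>\<xi>\<close> large. By symmetry they equal those of
  \<open>\<zeta> n\<close> with \<open>P \<xi>\<close>, which Cauchy--Schwarz makes too
  small.\<close>

lemma symmetric_bounded:
  assumes P: "\<And>\<xi>. \<xi> \<in> L2 G \<Longrightarrow> P \<xi> \<in> L2 G"
    and sym: "\<And>x \<xi> \<eta>. x \<in> units G \<Longrightarrow> \<xi> \<in> L2 G \<Longrightarrow> \<eta> \<in> L2 G \<Longrightarrow>
      ell2_inner (fibre G x) (P \<eta>) \<xi> = ell2_inner (fibre G x) \<eta> (P \<xi>)"
  shows "\<exists>C>0. \<forall>\<xi>\<in>L2 G. L2_norm G (P \<xi>) \<le> C * L2_norm G \<xi>"
proof (rule ccontr)
  assume neg: "\<not> ?thesis"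
  \<comment> \<open>The base 20 is 4 times 5: the factor \<open>5 ^ n\<close> pays for the size of
    the humps, and the remaining \<open>4 ^ n\<close> contradicts the finiteness of
    \<open>L2_norm G (P \<xi>)\<close>.\<close>
  have "\<exists>\<zeta>. \<zeta> \<in> L2 G \<and> 20 ^ n * L2_norm G \<zeta> < L2_norm G (P \<zeta>)" for n :: nat
  proof -
    have "\<not> (\<forall>\<xi>\<in>L2 G. L2_norm G (P \<xi>) \<le> 20 ^ n * L2_norm G \<xi>)"
      using neg by (meson zero_less_numeral zero_less_power)
    then show ?thesis by (simp add: not_le) blast
  qed
  then obtain \<zeta> where \<zeta>: "\<And>n. \<zeta> n \<in> L2 G" "\<And>n. 20 ^ n * L2_norm G (\<zeta> n) < L2_norm G (P (\<zeta> n))"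
    by metis
  define M where "M = (\<lambda>n. L2_norm G (P (\<zeta> n)))"
  have nn: "0 \<le> L2_norm G \<xi>" if "\<xi> \<in> L2 G" for \<xi>
    using ell2_le_nonneg[OF L2_le_norm[OF that, rule_format]] .
  have M: "0 < M n" for n
  proof -
    have "0 \<le> 20 ^ n * L2_norm G (\<zeta> n)" using nn[OF \<zeta>(1)] by simp
    then show ?thesis using \<zeta>(2)[of n] by (simp add: M_def)
  qed
  have PL: "P (\<zeta> n) \<in> L2 G" for n by (rule P[OF \<zeta>(1)])
  have "\<exists>y. y \<in> units G \<and> (M n)\<^sup>2 / 2 \<le> (ell2_norm (fibre G y) (P (\<zeta> n)))\<^sup>2" for n
    using L2_norm_approx[OF PL[of n]] M[of n] unfolding M_def by blast
  then obtain y where y: "\<And>n. y n \<in> units G" "\<And>n. (M n)\<^sup>2 / 2 \<le> (ell2_norm (fibre G (y n)) (P (\<zeta> n)))\<^sup>2"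
    by metis
  define \<phi> where "\<phi> = (\<lambda>n \<xi>. ell2_inner (fibre G (y n)) (P (\<zeta> n)) \<xi>)"
  \<comment> \<open>The normalised \<open>P (\<zeta> n)\<close> nearly maximises its own functional:
    the value is the squared norm in the fibre over \<open>y n\<close> divided by
    \<open>M n\<close>, at least \<open>M n / 2\<close> by the choice of \<open>y n\<close>.\<close>
  define e where "e = (\<lambda>n \<gamma>. complex_of_real (inverse (M n)) * P (\<zeta> n) \<gamma>)"
  have "\<exists>\<xi>\<in>L2 G. \<forall>n. (1/5) ^ n * M n / 4 \<le> cmod (\<phi> n \<xi>)"
  proof (rule gliding_hump)
    show "e n \<in> L2 G" for n unfolding e_def by (rule L2_scale[OF PL])
    show "L2_le (e n) 1" for n
    proof
      fix x
      have "cmod (complex_of_real (inverse (M n))) * M n = 1" using M[of n] by (simp add: norm_inverse)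
      then show "ell2_le (fibre G x) (e n) 1"
        using ell2_le_scale[OF L2_le_norm[OF PL[of n], rule_format], of x "complex_of_real (inverse (M n))"]
        by (simp add: e_def M_def)
    qed
    show "\<phi> n (\<lambda>\<gamma>. \<xi> \<gamma> + c * \<eta> \<gamma>) = \<phi> n \<xi> + c * \<phi> n \<eta>" if "\<xi> \<in> L2 G" "\<eta> \<in> L2 G" for n \<xi> \<eta> c
      unfolding \<phi>_def by (rule ell2_inner_L2_add_scale[OF PL that])
    show "cmod (\<phi> n \<xi>) \<le> M n * c" if "\<xi> \<in> L2 G" "L2_le \<xi> c" for n \<xi> c
      unfolding \<phi>_def M_def
      by (rule ell2_inner_bound(2)[OF L2_le_norm[OF PL, rule_format] that(2)[rule_format]])
    show "M n / 2 \<le> cmod (\<phi> n (e n))" for n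
    proof -
      have "\<phi> n (e n) = complex_of_real (inverse (M n)) * complex_of_real ((ell2_norm (fibre G (y n)) (P (\<zeta> n)))\<^sup>2)"
        unfolding \<phi>_def e_def ell2_inner_scale_right
        by (simp add: ell2_inner_self[OF L2_le_norm[OF PL, rule_format]])
      then have "cmod (\<phi> n (e n)) = inverse (M n) * (ell2_norm (fibre G (y n)) (P (\<zeta> n)))\<^sup>2"
        using M[of n] by (simp add: norm_mult norm_power norm_inverse)
      moreover have "inverse (M n) * ((M n)\<^sup>2 / 2) \<le> inverse (M n) * (ell2_norm (fibre G (y n)) (P (\<zeta> n)))\<^sup>2"
        using y(2) M[of n] by (intro mult_left_mono) auto
      moreover have "inverse (M n) * ((M n)\<^sup>2 / 2) = M n / 2"
        using M[of n] by (simp add: field_simps power2_eq_square)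
      ultimately show ?thesis by simp
    qed
  qed
  then obtain \<xi> where \<xi>: "\<xi> \<in> L2 G" "\<And>n. (1/5) ^ n * M n / 4 \<le> cmod (\<phi> n \<xi>)" by blast
  have "4 ^ n \<le> 4 * L2_norm G (P \<xi>)" for n :: nat
  proof -
    have "\<phi> n \<xi> = ell2_inner (fibre G (y n)) (\<zeta> n) (P \<xi>)"
      unfolding \<phi>_def by (rule sym[OF y(1) \<xi>(1) \<zeta>(1)])
    then have "cmod (\<phi> n \<xi>) \<le> L2_norm G (\<zeta> n) * L2_norm G (P \<xi>)"
      using ell2_inner_bound(2)[OF L2_le_norm[OF \<zeta>(1), rule_format] L2_le_norm[OF P[OF \<xi>(1)], rule_format]]
      by simp
    then have "20 ^ n * ((1/5) ^ n * M n / 4) \<le> 20 ^ n * (L2_norm G (\<zeta> n) * L2_norm G (P \<xi>))"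
      using order_trans[OF \<xi>(2)[of n]] by (intro mult_left_mono) auto
    also have "\<dots> = (20 ^ n * L2_norm G (\<zeta> n)) * L2_norm G (P \<xi>)" by simp
    also have "\<dots> \<le> M n * L2_norm G (P \<xi>)"
      using \<zeta>(2)[of n] nn[OF P[OF \<xi>(1)]] by (intro mult_right_mono) (auto simp: M_def)
    also have "20 ^ n * ((1/5) ^ n * M n / 4) = M n * (4 ^ n / 4)"
      using power_mult_distrib[of "20::real" "1/5" n] by simp
    finally have "M n * (4 ^ n / 4) \<le> M n * L2_norm G (P \<xi>)" .
    then show ?thesis using M[of n] by simp
  qed
  moreover obtain n where "4 * L2_norm G (P \<xi>) < 4 ^ n"
    using real_arch_pow[of "4::real"] by auto
  ultimately show False by (metis not_le)
qed

text \<open>By the Cauchy--Schwarz inequality \<open>n \<mapsto> \<parallel>P\<^sup>n \<xi>\<parallel>\<^sub>x\<close> is log-convex, and by the global bound it grows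
  at most like \<open>C\<^sup>n\<close>; so its first ratio is at most \<open>C\<close>.\<close>

lemma symmetric_fibre_bounded:
  assumes P: "\<And>\<xi>. \<xi> \<in> L2 G \<Longrightarrow> P \<xi> \<in> L2 G"
    and sym: "\<And>x \<xi> \<eta>. x \<in> units G \<Longrightarrow> \<xi> \<in> L2 G \<Longrightarrow> \<eta> \<in> L2 G \<Longrightarrow>
      ell2_inner (fibre G x) (P \<eta>) \<xi> = ell2_inner (fibre G x) \<eta> (P \<xi>)"
  shows "\<exists>C>0. \<forall>\<xi>\<in>L2 G. \<forall>x\<in>units G. ell2_norm (fibre G x) (P \<xi>) \<le> C * ell2_norm (fibre G x) \<xi>"
proof -
  obtain C where C: "C > 0" "\<forall>\<xi>\<in>L2 G. L2_norm G (P \<xi>) \<le> C * L2_norm G \<xi>"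
    using symmetric_bounded[of P, OF P sym] by blast
  have "ell2_norm (fibre G x) (P \<xi>) \<le> C * ell2_norm (fibre G x) \<xi>" if \<xi>: "\<xi> \<in> L2 G" and x: "x \<in> units G" for \<xi> x
  proof -
    define a where "a = (\<lambda>n. ell2_norm (fibre G x) ((P ^^ n) \<xi>))"
    have mem: "(P ^^ n) \<xi> \<in> L2 G" for n by (induction n) (simp_all add: \<xi> P)
    have le: "ell2_le (fibre G x) ((P ^^ n) \<xi>) (a n)" for n
      unfolding a_def by (rule ell2_leI[OF ell2_le_summable[OF L2_le_norm[OF mem, rule_format]] order_refl])
    have "a 1 \<le> C * a 0"
    proof (rule log_convex_ratio_le[OF _ _ _ C(1)])
      show "0 \<le> a n" for n by (simp add: a_def ell2_norm_nonneg)
      show "(a (Suc n))\<^sup>2 \<le> a n * a (Suc (Suc n))" for n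
      proof -
        have "complex_of_real ((a (Suc n))\<^sup>2) = ell2_inner (fibre G x) ((P ^^ Suc n) \<xi>) ((P ^^ Suc n) \<xi>)"
          using ell2_inner_self[OF le[of "Suc n"]] by (simp only: a_def)
        also have "\<dots> = ell2_inner (fibre G x) ((P ^^ n) \<xi>) ((P ^^ Suc (Suc n)) \<xi>)"
          using sym[OF x mem[of "Suc n"] mem[of n]] by simp
        finally have "cmod (complex_of_real ((a (Suc n))\<^sup>2)) \<le> a n * a (Suc (Suc n))"
          using ell2_inner_bound(2)[OF le[of n] le[of "Suc (Suc n)"]] by simp
        then show ?thesis by (simp add: norm_power)
      qed
      \<comment> \<open>The global bound applies to the iterates, and the global norm dominates the
        fibre norm. The factor \<open>L2_norm G \<xi>\<close> may be far larger than the fibre norm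
        of \<open>\<xi>\<close>, but only the growth rate counts.\<close>
      show "a n \<le> C ^ n * L2_norm G \<xi>" for n
      proof -
        have "L2_norm G ((P ^^ n) \<xi>) \<le> C ^ n * L2_norm G \<xi>"
        proof (induction n)
          case (Suc n)
          have "L2_norm G ((P ^^ Suc n) \<xi>) \<le> C * L2_norm G ((P ^^ n) \<xi>)"
            using C(2) mem[of n] by simp
          also have "\<dots> \<le> C * (C ^ n * L2_norm G \<xi>)"
            using Suc C(1) by simp
          finally show ?case by simp
        qed simp
        moreover have "a n \<le> L2_norm G ((P ^^ n) \<xi>)"
          unfolding a_def by (rule ell2_le_norm[OF L2_le_norm[OF mem, rule_format]])
        ultimately show ?thesis by simp
      qed
    qed
    then show ?thesis by (simp add: a_def)
  qed
  then show ?thesis using C(1) by blast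
qed

text \<open>In each fibre the squared norm of \<open>R \<xi>\<close> is the inner product of
  \<open>S (R \<xi>)\<close> with \<open>\<xi>\<close>, and \<open>S\<close> after \<open>R\<close>
  is symmetric; hence the constant \<open>sqrt C\<close>.\<close>

lemma adjoint_fibre_bounded:
  assumes S: "\<And>\<xi>. \<xi> \<in> L2 G \<Longrightarrow> S \<xi> \<in> L2 G" and R: "\<And>\<xi>. \<xi> \<in> L2 G \<Longrightarrow> R \<xi> \<in> L2 G"
    and adj: "\<And>x \<xi> \<eta>. x \<in> units G \<Longrightarrow> \<xi> \<in> L2 G \<Longrightarrow> \<eta> \<in> L2 G \<Longrightarrow>
      ell2_inner (fibre G x) (S \<eta>) \<xi> = ell2_inner (fibre G x) \<eta> (R \<xi>)"
  shows "\<exists>C\<ge>0. \<forall>\<xi>\<in>L2 G. \<forall>x\<in>units G. ell2_norm (fibre G x) (R \<xi>) \<le> C * ell2_norm (fibre G x) \<xi>"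
proof -
  have sym: "ell2_inner (fibre G x) (S (R \<eta>)) \<xi> = ell2_inner (fibre G x) \<eta> (S (R \<xi>))"
    if "x \<in> units G" "\<xi> \<in> L2 G" "\<eta> \<in> L2 G" for x \<xi> \<eta>
    using adj[OF that(1,2) R[OF that(3)]] adj[OF that(1,3) R[OF that(2)]] by (metis ell2_inner_cnj)
  obtain C where C: "C > 0" "\<forall>\<xi>\<in>L2 G. \<forall>x\<in>units G.
      ell2_norm (fibre G x) (S (R \<xi>)) \<le> C * ell2_norm (fibre G x) \<xi>"
    using symmetric_fibre_bounded[of "\<lambda>\<xi>. S (R \<xi>)", OF S[OF R] sym] by blast
  have "ell2_norm (fibre G x) (R \<xi>) \<le> sqrt C * ell2_norm (fibre G x) \<xi>"
    if \<xi>: "\<xi> \<in> L2 G" and x: "x \<in> units G" for \<xi> x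
  proof -
    let ?N = "ell2_norm (fibre G x)"
    have le: "ell2_le (fibre G x) \<eta> (?N \<eta>)" if "\<eta> \<in> L2 G" for \<eta>
      by (rule ell2_leI[OF ell2_le_summable[OF L2_le_norm[OF that, rule_format]] order_refl])
    have "complex_of_real ((?N (R \<xi>))\<^sup>2) = ell2_inner (fibre G x) (S (R \<xi>)) \<xi>"
      using ell2_inner_self[OF le[OF R[OF \<xi>]]] adj[OF x \<xi> R[OF \<xi>]] by simp
    then have "cmod (complex_of_real ((?N (R \<xi>))\<^sup>2)) \<le> ?N (S (R \<xi>)) * ?N \<xi>"
      using ell2_inner_bound(2)[OF le[OF S[OF R[OF \<xi>]]] le[OF \<xi>]] by simp
    also have "\<dots> \<le> (C * ?N \<xi>) * ?N \<xi>"
      using C(2) \<xi> x by (intro mult_right_mono ell2_norm_nonneg) blast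
    also have "\<dots> = (sqrt C * ?N \<xi>)\<^sup>2"
      using C(1) by (simp add: power_mult_distrib power2_eq_square)
    finally have "(?N (R \<xi>))\<^sup>2 \<le> (sqrt C * ?N \<xi>)\<^sup>2" by (simp add: norm_power)
    then show ?thesis
      by (rule power2_le_imp_le) (use C(1) in \<open>simp add: ell2_norm_nonneg\<close>)
  qed
  then show ?thesis using C(1) by (intro exI[of _ "sqrt C"]) auto
qed

section \<open>Construction of the slices of an adjointable operator\<close>

text \<open>A fibre inner product sees only the restriction to that fibre. Pairing with a lifted
  point mass thus reads off values, which makes identities of inner products into identities of
  functions.\<close>

lemma ell2_inner_peak:
  assumes "cutoff (fibre G (src G \<gamma>)) \<zeta> = delta \<gamma>"
  shows "ell2_inner (fibre G (src G \<gamma>)) \<zeta> \<xi> = \<xi> \<gamma>"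
proof -
  have "ell2_inner (fibre G (src G \<gamma>)) \<zeta> \<xi> = ell2_inner (fibre G (src G \<gamma>)) (delta \<gamma>) \<xi>"
    by (rule ell2_inner_cong) (simp_all add: cutoff_eq flip: assms)
  then show ?thesis by (simp add: ell2_inner_delta_left fibre_iff)
qed

text \<open>Linearity of \<open>R\<close> comes from the adjoint relation: each value of
  \<open>R \<xi>\<close> is the inner product of \<open>\<xi>\<close> with the image under
  \<open>S\<close> of a lifted point mass.\<close>

lemma adjoint_sum:
  assumes S: "\<And>\<xi>. \<xi> \<in> L2 G \<Longrightarrow> S \<xi> \<in> L2 G"
    and adj: "\<And>x \<xi> \<eta>. x \<in> units G \<Longrightarrow> \<xi> \<in> L2 G \<Longrightarrow> \<eta> \<in> L2 G \<Longrightarrow>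
      ell2_inner (fibre G x) (S \<eta>) \<xi> = ell2_inner (fibre G x) \<eta> (R \<xi>)"
    and "finite F" "\<And>i. i \<in> F \<Longrightarrow> \<zeta> i \<in> L2 G"
  shows "(\<lambda>\<alpha>. \<Sum>i\<in>F. a i * \<zeta> i \<alpha>) \<in> L2 G" (is ?A)
    and "R (\<lambda>\<alpha>. \<Sum>i\<in>F. a i * \<zeta> i \<alpha>) = (\<lambda>\<alpha>. \<Sum>i\<in>F. a i * R (\<zeta> i) \<alpha>)" (is ?B)
proof -
  obtain \<zeta>\<^sub>0 where "\<zeta>\<^sub>0 \<in> L2 G"
    by (rule peak_function)
  from L2_scale[OF this, of 0] have zero: "(\<lambda>_. 0) \<in> L2 G" by simp
  have val: "\<exists>\<omega>\<in>L2 G. \<forall>\<xi>\<in>L2 G. R \<xi> \<gamma> = ell2_inner (fibre G (src G \<gamma>)) \<omega> \<xi>" for \<gamma>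
  proof -
    obtain \<delta> where \<delta>: "\<delta> \<in> L2 G" "cutoff (fibre G (src G \<gamma>)) \<delta> = delta \<gamma>"
      using peak_function[of \<gamma>] by metis
    show ?thesis
      by (rule bexI[OF _ S[OF \<delta>(1)]])
        (use adj[OF src_units _ \<delta>(1), of _ \<gamma>] ell2_inner_peak[OF \<delta>(2)] in auto)
  qed
  have lin: "R (\<lambda>\<gamma>. \<xi> \<gamma> + c * \<eta> \<gamma>) = (\<lambda>\<gamma>. R \<xi> \<gamma> + c * R \<eta> \<gamma>)" if "\<xi> \<in> L2 G" "\<eta> \<in> L2 G" for \<xi> \<eta> c
  proof
    fix \<gamma>
    obtain \<omega> where \<omega>: "\<omega> \<in> L2 G" "\<forall>\<xi>\<in>L2 G. R \<xi> \<gamma> = ell2_inner (fibre G (src G \<gamma>)) \<omega> \<xi>"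
      using val by blast
    show "R (\<lambda>\<gamma>. \<xi> \<gamma> + c * \<eta> \<gamma>) \<gamma> = R \<xi> \<gamma> + c * R \<eta> \<gamma>"
      using \<omega>(2) that L2_add[OF that(1) L2_scale[OF that(2)], of c] ell2_inner_L2_add_scale[OF \<omega>(1) that]
      by simp
  qed
  have R0: "R (\<lambda>_. 0) = (\<lambda>_. 0)"
    using lin[OF zero zero, of "-1"] by (simp add: fun_eq_iff)
  have "?A \<and> ?B"
    using assms(3,4)
  proof (induction F rule: finite_induct)
    case empty
    then show ?case using zero R0 by simp
  next
    case (insert i F)
    then have IH: "(\<lambda>\<alpha>. \<Sum>i\<in>F. a i * \<zeta> i \<alpha>) \<in> L2 G"
      "R (\<lambda>\<alpha>. \<Sum>i\<in>F. a i * \<zeta> i \<alpha>) = (\<lambda>\<alpha>. \<Sum>i\<in>F. a i * R (\<zeta> i) \<alpha>)" by auto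
    have i: "\<zeta> i \<in> L2 G" using insert.prems by simp
    show ?case
      using lin[OF IH(1) i, of "a i"] L2_add[OF IH(1) L2_scale[OF i, of "a i"]] IH(2) insert.hyps
      by (simp add: add.commute)
  qed
  then show ?A ?B by blast+
qed

text \<open>Restrictions of \<open>L2 G\<close> contain all point masses, so they determine a
  bounded operator; this is the uniqueness behind the definite description in
  \<open>slice\<close>.\<close>

lemma bounded_ops_eq_on_L2:
  assumes "T \<in> bounded_ops (fibre G x)" "T' \<in> bounded_ops (fibre G x)"
    and "\<And>\<xi>. \<xi> \<in> L2 G \<Longrightarrow> T (cutoff (fibre G x) \<xi>) = T' (cutoff (fibre G x) \<xi>)"
  shows "T = T'"
proof (rule bounded_ops_eqI[OF assms(1,2)])
  fix \<gamma> assume g: "\<gamma> \<in> fibre G x"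
  obtain \<zeta> where "\<zeta> \<in> L2 G" "cutoff (fibre G (src G \<gamma>)) \<zeta> = delta \<gamma>"
    using peak_function[of \<gamma>] by metis
  then show "T (delta \<gamma>) = T' (delta \<gamma>)"
    using assms(3)[of \<zeta>] g by (simp add: fibre_iff)
qed

lemma slice_eqI:
  assumes "T \<in> bounded_ops (fibre G x)"
    and "\<And>\<xi>. \<xi> \<in> L2 G \<Longrightarrow> T (cutoff (fibre G x) \<xi>) = cutoff (fibre G x) (S \<xi>)"
  shows "slice G x S = T"
  unfolding slice_def
proof (rule the_equality)
  fix T' assume T': "T' \<in> bounded_ops (fibre G x) \<and>
    (\<forall>\<xi>\<in>L2 G. T' (cutoff (fibre G x) \<xi>) = cutoff (fibre G x) (S \<xi>))"
  show "T' = T"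
    by (rule bounded_ops_eq_on_L2[of _ x]) (use T' assms in auto)
qed (use assms in blast)

text \<open>Existence of the slice. The value of \<open>S \<eta>\<close> at \<open>\<gamma>\<close>
  is the inner product of the lifted point mass \<open>\<zeta> \<gamma>\<close> with
  \<open>S \<eta>\<close>, hence of \<open>R (\<zeta> \<gamma>)\<close> with \<open>\<eta>\<close>;
  so the slice must be the column operator built from the restrictions of
  \<open>R (\<zeta> \<gamma>)\<close>. Its boundedness is the fibre bound for
  \<open>R\<close>.\<close>

lemma slice_adjointable:
  assumes S: "\<And>\<xi>. \<xi> \<in> L2 G \<Longrightarrow> S \<xi> \<in> L2 G" and R: "\<And>\<xi>. \<xi> \<in> L2 G \<Longrightarrow> R \<xi> \<in> L2 G"
    and adj: "\<And>x \<xi> \<eta>. x \<in> units G \<Longrightarrow> \<xi> \<in> L2 G \<Longrightarrow> \<eta> \<in> L2 G \<Longrightarrow>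
      ell2_inner (fibre G x) (S \<eta>) \<xi> = ell2_inner (fibre G x) \<eta> (R \<xi>)"
    and x: "x \<in> units G" and \<xi>: "\<xi> \<in> L2 G"
  shows "slice G x S (cutoff (fibre G x) \<xi>) = cutoff (fibre G x) (S \<xi>)"
proof -
  let ?F = "fibre G x"
  have "\<forall>\<gamma>. \<exists>\<delta>. \<delta> \<in> L2 G \<and> cutoff (fibre G (src G \<gamma>)) \<delta> = delta \<gamma>"
    using peak_function by metis
  then obtain \<zeta> where \<zeta>: "\<And>\<gamma>. \<zeta> \<gamma> \<in> L2 G" "\<And>\<gamma>. cutoff (fibre G (src G \<gamma>)) (\<zeta> \<gamma>) = delta \<gamma>"
    by metis
  obtain C where C: "C \<ge> 0" "\<forall>\<xi>\<in>L2 G. \<forall>x\<in>units G. ell2_norm (fibre G x) (R \<xi>) \<le> C * ell2_norm (fibre G x) \<xi>"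
    using adjoint_fibre_bounded[of S R, OF S R adj] by blast
  define K where "K = (\<lambda>\<gamma>. cutoff ?F (R (\<zeta> \<gamma>)))"
  have K: "K \<gamma> \<in> ell2 ?F" for \<gamma> unfolding K_def by (rule L2_cutoff[OF R[OF \<zeta>(1)]])
  have bound: "ell2_le ?F (\<lambda>\<alpha>. \<Sum>\<gamma>\<in>F. a \<gamma> * K \<gamma> \<alpha>) (C * L2_set (\<lambda>\<gamma>. cmod (a \<gamma>)) F)"
    if F: "finite F" "F \<subseteq> ?F" for F a
  proof -
    \<comment> \<open>On the fibre over \<open>x\<close> the function \<open>w\<close> is a
      combination of point masses with known norm, while nothing is known about its size on other
      fibres. This is where the bound for \<open>R\<close> has to hold fibre by fibre.\<close>
    define w where "w = (\<lambda>\<alpha>. \<Sum>\<gamma>\<in>F. a \<gamma> * \<zeta> \<gamma> \<alpha>)"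
    have w: "w \<in> L2 G" "R w = (\<lambda>\<alpha>. \<Sum>\<gamma>\<in>F. a \<gamma> * R (\<zeta> \<gamma>) \<alpha>)"
      unfolding w_def using adjoint_sum[of S R F \<zeta> a, OF S adj F(1) \<zeta>(1)] by simp_all
    have "\<zeta> \<gamma> \<alpha> = delta \<gamma> \<alpha>" if "\<gamma> \<in> F" "\<alpha> \<in> ?F" for \<gamma> \<alpha>
      using fun_cong[OF \<zeta>(2)[of \<gamma>], of \<alpha>] that F(2) by (auto simp: fibre_iff cutoff_def)
    then have "ell2_le ?F w (L2_set (\<lambda>\<gamma>. cmod (a \<gamma>)) F)"
      using ell2_le_delta_sum[OF F(1), of ?F a]
      by (subst ell2_le_cong[of _ w]) (auto simp: w_def intro!: sum.cong)
    then have "ell2_norm ?F (R w) \<le> C * L2_set (\<lambda>\<gamma>. cmod (a \<gamma>)) F"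
      using C(2) w(1) x mult_left_mono[OF ell2_le_norm C(1), of ?F w] by (meson order_trans)
    then have "ell2_le ?F (R w) (C * L2_set (\<lambda>\<gamma>. cmod (a \<gamma>)) F)"
      by (rule ell2_leI[OF ell2_le_summable[OF L2_le_norm[OF R[OF w(1)], rule_format]]])
    then show ?thesis
      by (rule ell2_le_mono) (simp_all add: w(2) K_def cutoff_eq)
  qed
  define T where "T = (\<lambda>v\<in>ell2 ?F. \<lambda>\<gamma>. if \<gamma> \<in> ?F then ell2_inner ?F (K \<gamma>) v else 0)"
  have T: "T \<in> bounded_ops ?F"
    unfolding T_def by (rule column_operator(1)[OF K C(1) bound])
  have TS: "T (cutoff ?F \<eta>) = cutoff ?F (S \<eta>)" if \<eta>: "\<eta> \<in> L2 G" for \<eta>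
  proof
    fix \<gamma>
    show "T (cutoff ?F \<eta>) \<gamma> = cutoff ?F (S \<eta>) \<gamma>"
    proof (cases "\<gamma> \<in> ?F")
      case True
      then have s: "src G \<gamma> = x" by (simp add: fibre_iff)
      have "ell2_inner ?F (K \<gamma>) (cutoff ?F \<eta>) = ell2_inner ?F (R (\<zeta> \<gamma>)) \<eta>"
        by (rule ell2_inner_cong) (simp_all add: K_def cutoff_eq)
      also have "\<dots> = ell2_inner ?F (\<zeta> \<gamma>) (S \<eta>)"
        using adj[OF x \<zeta>(1) \<eta>, of \<gamma>] by (metis ell2_inner_cnj)
      also have "\<dots> = S \<eta> \<gamma>"
        using ell2_inner_peak[OF \<zeta>(2)[of \<gamma>], of "S \<eta>"] s by simp
      finally show ?thesis using True L2_cutoff[OF \<eta>] by (simp add: T_def cutoff_eq)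
    qed (use L2_cutoff[OF \<eta>] in \<open>simp add: T_def cutoff_eq\<close>)
  qed
  show ?thesis using slice_eqI[OF T TS] TS[OF \<xi>] by simp
qed

end

section \<open>The equivalence\<close>

lemma op_families_bound:
  assumes "T \<in> op_families G"
  obtains C where "C \<ge> 0" "\<And>x v. x \<in> units G \<Longrightarrow> v \<in> ell2 (fibre G x) \<Longrightarrow>
    ell2_norm (fibre G x) (T x v) \<le> C * ell2_norm (fibre G x) v"
proof -
  obtain C where C: "\<forall>x\<in>units G. \<forall>v\<in>ell2 (fibre G x).
      ell2_norm (fibre G x) (T x v) \<le> C * ell2_norm (fibre G x) v"
    using assms unfolding op_families_def by blast
  show thesis
  proof (rule that[of "max C 0"])
    fix x v assume "x \<in> units G" "v \<in> ell2 (fibre G x)"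
    then have "ell2_norm (fibre G x) (T x v) \<le> C * ell2_norm (fibre G x) v" using C by blast
    also have "\<dots> \<le> max C 0 * ell2_norm (fibre G x) v"
      by (intro mult_right_mono ell2_norm_nonneg) simp
    finally show "ell2_norm (fibre G x) (T x v) \<le> max C 0 * ell2_norm (fibre G x) v" .
  qed simp
qed

lemma op_families_bounded_ops: "T \<in> op_families G \<Longrightarrow> x \<in> units G \<Longrightarrow> T x \<in> bounded_ops (fibre G x)"
  unfolding op_families_def by auto

lemma family_adjoint:
  assumes "T \<in> op_families G" "x \<in> units G"
  shows "family_adjoint G T x \<in> bounded_ops (fibre G x)"
    and "v \<in> ell2 (fibre G x) \<Longrightarrow> w \<in> ell2 (fibre G x) \<Longrightarrow>
      ell2_inner (fibre G x) (family_adjoint G T x v) w = ell2_inner (fibre G x) v (T x w)"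
proof -
  obtain C where "C \<ge> 0" and C: "\<And>x v. x \<in> units G \<Longrightarrow> v \<in> ell2 (fibre G x) \<Longrightarrow>
      ell2_norm (fibre G x) (T x v) \<le> C * ell2_norm (fibre G x) v"
    by (rule op_families_bound[OF assms(1)]) (rule that, simp_all)
  show "family_adjoint G T x \<in> bounded_ops (fibre G x)"
    and "v \<in> ell2 (fibre G x) \<Longrightarrow> w \<in> ell2 (fibre G x) \<Longrightarrow>
      ell2_inner (fibre G x) (family_adjoint G T x v) w = ell2_inner (fibre G x) v (T x w)"
    using op_adjoint(1,2)[OF op_families_bounded_ops[OF assms] \<open>C \<ge> 0\<close> C[OF assms(2)]] assms(2)
    by (simp_all add: family_adjoint_def)
qed

lemma family_adjoint_op_families:
  assumes "T \<in> op_families G"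
  shows "family_adjoint G T \<in> op_families G"
proof -
  obtain C where "C \<ge> 0" and C: "\<And>x v. x \<in> units G \<Longrightarrow> v \<in> ell2 (fibre G x) \<Longrightarrow>
      ell2_norm (fibre G x) (T x v) \<le> C * ell2_norm (fibre G x) v"
    by (rule op_families_bound[OF assms]) (rule that, simp_all)
  have "ell2_norm (fibre G x) (family_adjoint G T x v) \<le> C * ell2_norm (fibre G x) v"
    if "x \<in> units G" "v \<in> ell2 (fibre G x)" for x v
    using op_adjoint(3)[OF op_families_bounded_ops[OF assms that(1)] \<open>C \<ge> 0\<close> C[OF that(1)] that(2)] that(1)
    by (simp add: family_adjoint_def)
  then have "\<exists>C. \<forall>x\<in>units G. \<forall>v\<in>ell2 (fibre G x).
      ell2_norm (fibre G x) (family_adjoint G T x v) \<le> C * ell2_norm (fibre G x) v"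
    by blast
  moreover have "family_adjoint G T \<in> (\<Pi>\<^sub>E x\<in>units G. bounded_ops (fibre G x))"
    using family_adjoint(1)[OF assms] by (simp add: PiE_def Pi_def family_adjoint_def)
  ultimately show ?thesis unfolding op_families_def by simp
qed

context lc_etale_groupoid
begin

text \<open>The matrix of an adjoint is the conjugate transpose, obtained by pairing point masses on
  both sides.\<close>

lemma coefficient_family_adjoint:
  assumes "T \<in> op_families G" "(\<alpha>, \<beta>) \<in> same_src G"
  shows "coefficient G (family_adjoint G T) (\<alpha>, \<beta>) = cnj (coefficient G T (\<beta>, \<alpha>))"
proof -
  let ?F = "fibre G (src G \<alpha>)"
  have m: "\<alpha> \<in> ?F" "\<beta> \<in> ?F" using assms(2) by (auto simp: same_src_def fibre_iff)
  have "cnj (family_adjoint G T (src G \<alpha>) (delta \<alpha>) \<beta>)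
      = ell2_inner ?F (family_adjoint G T (src G \<alpha>) (delta \<alpha>)) (delta \<beta>)"
    by (simp add: ell2_inner_delta_right m)
  also have "\<dots> = T (src G \<alpha>) (delta \<beta>) \<alpha>"
    by (simp add: family_adjoint(2)[OF assms(1) src_units] delta_ell2 m ell2_inner_delta_left)
  finally show ?thesis
    using m by (simp add: coefficient_def fibre_iff) (metis complex_cnj_cnj)
qed

text \<open>Continuity is assumed of \<open>T\<close> only. It passes to the adjoint family because
  \<open>same_src G\<close> is invariant under the swap and the coefficients are merely transposed
  and conjugated.\<close>

lemma family_adjoint_continuous:
  assumes "T \<in> op_families G" "continuous_on (same_src G) (coefficient G T)"
  shows "continuous_on (same_src G) (coefficient G (family_adjoint G T))"
proof -
  have "continuous_on (same_src G) (\<lambda>p. cnj (coefficient G T (snd p, fst p)))"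
    by (intro continuous_on_cnj continuous_on_compose2[OF assms(2)] continuous_on_Pair
        continuous_on_fst continuous_on_snd continuous_on_id) (auto simp: same_src_def)
  moreover have "coefficient G (family_adjoint G T) p = cnj (coefficient G T (snd p, fst p))"
    if "p \<in> same_src G" for p
    using coefficient_family_adjoint[OF assms(1), of "fst p" "snd p"] that by simp
  ultimately show ?thesis by (simp cong: continuous_on_cong)
qed

text \<open>Identifies the fibrewise adjoints with the restrictions of \<open>R\<close>, by testing
  against lifted point masses. With it the quasi-locality result for \<open>T\<close> and
  \<open>S\<close> can be repeated for the adjoint family and \<open>R\<close>.\<close>

lemma family_adjoint_slice:
  assumes T: "T \<in> op_families G"
    and TS: "\<And>x \<xi>. x \<in> units G \<Longrightarrow> \<xi> \<in> L2 G \<Longrightarrow> T x (cutoff (fibre G x) \<xi>) = cutoff (fibre G x) (S \<xi>)"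
    and adj: "\<And>x \<xi> \<eta>. x \<in> units G \<Longrightarrow> \<xi> \<in> L2 G \<Longrightarrow> \<eta> \<in> L2 G \<Longrightarrow>
      ell2_inner (fibre G x) (S \<eta>) \<xi> = ell2_inner (fibre G x) \<eta> (R \<xi>)"
    and x: "x \<in> units G" and \<xi>: "\<xi> \<in> L2 G"
  shows "family_adjoint G T x (cutoff (fibre G x) \<xi>) = cutoff (fibre G x) (R \<xi>)"
proof
  fix \<gamma>
  let ?F = "fibre G x" and ?A = "family_adjoint G T x"
  have c: "cutoff ?F \<xi> \<in> ell2 ?F" by (rule L2_cutoff[OF \<xi>])
  show "?A (cutoff ?F \<xi>) \<gamma> = cutoff ?F (R \<xi>) \<gamma>"
  proof (cases "\<gamma> \<in> ?F")
    case True
    then have s: "src G \<gamma> = x" by (simp add: fibre_iff)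
    obtain \<zeta> where "bisection_supported G \<zeta>" and \<zeta>: "\<zeta> \<in> L2 G" "cutoff (fibre G (src G \<gamma>)) \<zeta> = delta \<gamma>"
      by (rule peak_function)
    have "cnj (?A (cutoff ?F \<xi>) \<gamma>) = ell2_inner ?F (?A (cutoff ?F \<xi>)) (delta \<gamma>)"
      by (simp add: ell2_inner_delta_right True)
    also have "\<dots> = ell2_inner ?F (cutoff ?F \<xi>) (T x (delta \<gamma>))"
      by (rule family_adjoint(2)[OF T x c delta_ell2[OF True]])
    also have "\<dots> = ell2_inner ?F (cutoff ?F \<xi>) (cutoff ?F (S \<zeta>))"
      using TS[OF x \<zeta>(1)] \<zeta>(2) s by simp
    also have "\<dots> = ell2_inner ?F \<xi> (S \<zeta>)"
      by (rule ell2_inner_cong) (simp_all add: cutoff_eq)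
    also have "\<dots> = cnj (ell2_inner ?F \<zeta> (R \<xi>))"
      unfolding adj[OF x \<xi> \<zeta>(1), symmetric] by (rule ell2_inner_cnj[symmetric])
    also have "ell2_inner ?F \<zeta> (R \<xi>) = R \<xi> \<gamma>"
      using ell2_inner_peak[OF \<zeta>(2), of "R \<xi>"] s by simp
    finally show ?thesis using True by (simp add: cutoff_eq)
  next
    case False
    then show ?thesis
      using bounded_ops_mem[OF family_adjoint(1)[OF T x] c] by (simp add: cutoff_eq ell2_def)
  qed
qed

lemma Phi_image_imp:
  assumes T: "T \<in> op_families G" and "T \<in> Phi G ` adjointable_ops G"
  shows "continuous_on (same_src G) (coefficient G T)" "quasi_local G T" "quasi_local G (family_adjoint G T)"
proof -
  obtain S where "S \<in> adjointable_ops G" and TS0: "T = Phi G S" using assms(2) by blast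
  then obtain R where S0: "S \<in> L2 G \<rightarrow>\<^sub>E L2 G" and R0: "R \<in> L2 G \<rightarrow>\<^sub>E L2 G"
    and adj0: "\<forall>\<eta>\<in>L2 G. \<forall>\<xi>\<in>L2 G. L2_inner G (S \<eta>) \<xi> = L2_inner G \<eta> (R \<xi>)"
    unfolding adjointable_ops_def by blast
  have S: "\<And>\<xi>. \<xi> \<in> L2 G \<Longrightarrow> S \<xi> \<in> L2 G" and R: "\<And>\<xi>. \<xi> \<in> L2 G \<Longrightarrow> R \<xi> \<in> L2 G"
    using S0 R0 by auto
  have adj: "ell2_inner (fibre G x) (S \<eta>) \<xi> = ell2_inner (fibre G x) \<eta> (R \<xi>)"
    if "x \<in> units G" "\<xi> \<in> L2 G" "\<eta> \<in> L2 G" for x \<xi> \<eta>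
    using fun_cong[OF adj0[rule_format, OF that(3,2)], of x] by (simp add: L2_inner_eq that(1))
  have TS: "T x (cutoff (fibre G x) \<xi>) = cutoff (fibre G x) (S \<xi>)" if "x \<in> units G" "\<xi> \<in> L2 G" for x \<xi>
    using slice_adjointable[of S R, OF S R adj that] that(1) by (simp add: TS0 Phi_def)
  have TR: "family_adjoint G T x (cutoff (fibre G x) \<xi>) = cutoff (fibre G x) (R \<xi>)"
    if "x \<in> units G" "\<xi> \<in> L2 G" for x \<xi>
    by (rule family_adjoint_slice[of T S R, OF T TS adj that])
  note bT = op_families_bounded_ops[OF T] and bA = family_adjoint(1)[OF T]
  show "continuous_on (same_src G) (coefficient G T)"
    by (rule slices_coefficient_continuous[of T S, OF bT S TS])
  show "quasi_local G T"
    by (rule slices_quasi_local[of T S, OF bT S TS])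
  show "quasi_local G (family_adjoint G T)"
    by (rule slices_quasi_local[of "family_adjoint G T" R, OF bA R TR])
qed

text \<open>The preimage is \<open>fibrewise T\<close> and its adjoint is \<open>fibrewise\<close>
  of the adjoint family; quasi-locality of the latter ensures that the adjoint maps into
  \<open>L2 G\<close>. The adjoint relation holds fibre by fibre, and uniqueness of slices
  identifies the image under \<open>Phi\<close> with \<open>T\<close>.\<close>

lemma Phi_image_if:
  assumes T: "T \<in> op_families G"
    and c: "continuous_on (same_src G) (coefficient G T)"
    and q: "quasi_local G T" "quasi_local G (family_adjoint G T)"
  shows "T \<in> Phi G ` adjointable_ops G"
proof -
  let ?A = "family_adjoint G T"
  have A: "?A \<in> op_families G" by (rule family_adjoint_op_families[OF T])
  have L2: "fibrewise U \<xi> \<in> L2 G"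
    if U: "U \<in> op_families G" "continuous_on (same_src G) (coefficient G U)" "quasi_local G U"
      and \<xi>: "\<xi> \<in> L2 G" for U \<xi>
  proof -
    obtain C where "C \<ge> 0" and C: "\<And>x v. x \<in> units G \<Longrightarrow> v \<in> ell2 (fibre G x) \<Longrightarrow>
        ell2_norm (fibre G x) (U x v) \<le> C * ell2_norm (fibre G x) v"
      by (rule op_families_bound[OF U(1)]) (rule that, simp_all)
    show ?thesis
      by (rule fibrewise_L2[OF op_families_bounded_ops[OF U(1)] \<open>C \<ge> 0\<close> C U(2,3) \<xi>])
  qed
  define S where "S = (\<lambda>\<xi>\<in>L2 G. fibrewise T \<xi>)"
  define R where "R = (\<lambda>\<xi>\<in>L2 G. fibrewise ?A \<xi>)"
  have S: "S \<in> L2 G \<rightarrow>\<^sub>E L2 G" "R \<in> L2 G \<rightarrow>\<^sub>E L2 G"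
    using L2[OF T c q(1)] L2[OF A family_adjoint_continuous[OF T c] q(2)] by (auto simp: S_def R_def)
  have cut: "cutoff (fibre G x) (S \<xi>) = T x (cutoff (fibre G x) \<xi>)"
    "cutoff (fibre G x) (R \<xi>) = ?A x (cutoff (fibre G x) \<xi>)" if "x \<in> units G" "\<xi> \<in> L2 G" for x \<xi>
    using cutoff_fibrewise[of T x, OF op_families_bounded_ops[OF T that(1)] that(2)]
      cutoff_fibrewise[of ?A x, OF family_adjoint(1)[OF T that(1)] that(2)] that(2)
    by (simp_all add: S_def R_def)
  have adj: "L2_inner G (S \<eta>) \<xi> = L2_inner G \<eta> (R \<xi>)" if "\<eta> \<in> L2 G" "\<xi> \<in> L2 G" for \<eta> \<xi>
  proof
    fix x
    show "L2_inner G (S \<eta>) \<xi> x = L2_inner G \<eta> (R \<xi>) x"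
    proof (cases "x \<in> units G")
      case x: True
      let ?F = "fibre G x"
      have "ell2_inner ?F (S \<eta>) \<xi> = ell2_inner ?F (T x (cutoff ?F \<eta>)) (cutoff ?F \<xi>)"
        unfolding cut(1)[OF x that(1), symmetric] by (rule ell2_inner_cong) (simp_all add: cutoff_eq)
      also have "\<dots> = cnj (ell2_inner ?F (?A x (cutoff ?F \<xi>)) (cutoff ?F \<eta>))"
        by (simp add: family_adjoint(2)[OF T x] L2_cutoff that ell2_inner_cnj)
      also have "\<dots> = ell2_inner ?F (cutoff ?F \<eta>) (?A x (cutoff ?F \<xi>))"
        by (rule ell2_inner_cnj)
      also have "\<dots> = ell2_inner ?F \<eta> (R \<xi>)"
        unfolding cut(2)[OF x that(2), symmetric] by (rule ell2_inner_cong) (simp_all add: cutoff_eq)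
      finally show ?thesis by (simp add: L2_inner_eq x)
    qed (simp add: L2_inner_def)
  qed
  have "S \<in> adjointable_ops G"
    unfolding adjointable_ops_def using S adj by blast
  moreover have "T = Phi G S"
  proof
    fix x
    show "T x = Phi G S x"
    proof (cases "x \<in> units G")
      case True
      then show ?thesis
        using slice_eqI[OF op_families_bounded_ops[OF T True], of S] cut(1)[OF True]
        by (simp add: Phi_def)
    next
      case False
      have "T \<in> (\<Pi>\<^sub>E x\<in>units G. bounded_ops (fibre G x))"
        using T by (simp add: op_families_def)
      from PiE_arb[OF this False] show ?thesis using False by (simp add: Phi_def)
    qed
  qed
  ultimately show ?thesis by blast
qed

end

theorem theoremA:
  fixes G :: "'g::t2_space groupoid"
    and T :: "'g \<Rightarrow> 'g operator"
  assumes "lc_etale_groupoid G"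
    and "T \<in> op_families G"
  shows "T \<in> Phi G ` adjointable_ops G \<longleftrightarrow>
    continuous_map (top_of_set (units G)) (op_fibre_topology G) (\<lambda>x. (x, T x)) \<and>
    quasi_local G T \<and> quasi_local G (family_adjoint G T)"
proof -
  interpret lc_etale_groupoid G by (rule assms(1))
  have "continuous_map (top_of_set (units G)) (op_fibre_topology G) (\<lambda>x. (x, T x)) \<longleftrightarrow>
      continuous_on (same_src G) (coefficient G T)"
    by (rule continuous_section_iff[OF op_families_bounded_ops[OF assms(2)]])
  then show ?thesis
    using Phi_image_imp[OF assms(2)] Phi_image_if[OF assms(2)] by blast
qed

end
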